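(* Let $D\subset\mathbb{R}^d$ be a (possibly unbounded) domain with smooth boundary and let $p\ge 2$ be an integer with $d-p(d-2)>0$. Let $X^{(1)},\ldots,X^{(p)}$ be independent killed Brownian motions in $D$ with fixed initial points $x_0^{(1)},\ldots,x_0^{(p)}\in D$, with approximated intersection measures $\ell_{t,\varepsilon}^{\mathrm{IS}}$ and intersection measure $\ell_t^{\mathrm{IS}}$ up to time $t$. Then for each $f\in C_K(D)$ and $\varepsilon>0$ there exists a positive constant $C(\varepsilon)$, which depends on $p$ and $f$ and is independent of $t$ and $k$, such that $\lim_{\varepsilon\to0}C(\varepsilon)=0$ and $$\mathbb{E}\bigl[\,|\langle\ell_{t,\varepsilon}^{\mathrm{IS}},f\rangle-\langle\ell_t^{\mathrm{IS}},f\rangle|^k\,\bigr]\le e^{pt}(k!)^p\,C(\varepsilon)^k\qquad\text{for any integer }k\ge1\text{ and any }t>0.$$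
   Context: $C_K(D)$ is the set of continuous functions on $D$ with compact support; $\mathcal{M}(D)$ is the set of Radon measures on $D$ with the vague topology. Killed Brownian motion. $\partial$ is a point added to $D$ so that $D\cup\{\partial\}$ is the one-point compactification of $D$. For a Brownian motion $B$ on $\mathbb{R}^d$ with exit time $\tau_D=\inf\{t>0:B_t\notin D\}$, the killed Brownian motion is $X_t=B_t$ for $t<\tau_D$ and $X_t=\partial$ for $t\ge\tau_D$. The exit time associated with $X^{(i)}$ is $\tau_D^{(i)}$. Intersection measure. Let $q_\varepsilon(x,y)=|B(x,\varepsilon)|^{-1}1_{B(x,\varepsilon)}(y)$, where $B(x,\varepsilon)$ is the open Euclidean ball. The approximated intersection measure is $$\langle\ell_{t,\varepsilon}^{\mathrm{IS}},f\rangle=\int_D f(x)\Bigl[\prod_{i=1}^p\int_0^t q_\varepsilon(x,X_s^{(i)})\,ds\Bigr]dx$$ for bounded Borel $f$ on $D$, with $q_\varepsilon(x,X_s^{(i)})=0$ when $s\ge\tau_D^{(i)}$. It is known that for each $t>0$ there is a random measure $\ell_t^{\mathrm{IS}}\in\mathcal{M}(D)$ to which $\ell_{t,\varepsilon}^{\mathrm{IS}}$ converges vaguely as $\varepsilon\to0$ and such that $\lim_{\varepsilon\to0}\mathbb{E}[|\langle f,\ell_{t,\varepsilon}^{\mathrm{IS}}\rangle-\langle f,\ell_t^{\mathrm{IS}}\rangle|^k]=0$ for all integers $k\ge1$ and $f\in C_K(D)$; this limit is the intersection measure of $X^{(1)},\ldots,X^{(p)}$ up to time $t$. *)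

theory Defs
  imports "HOL-Probability.Probability"
begin

section \<open>Domains with smooth boundary\<close>

fun C_k_on :: "nat \<Rightarrow> 'a::euclidean_space set \<Rightarrow> ('a \<Rightarrow> real) \<Rightarrow> bool" where
  "C_k_on 0 U f \<longleftrightarrow> continuous_on U f"
| "C_k_on (Suc k) U f \<longleftrightarrow>
     (\<exists>g. (\<forall>x\<in>U. GDERIV f x :> g x) \<and> (\<forall>b\<in>Basis. C_k_on k U (\<lambda>x. g x \<bullet> b)))"

definition C_infinity_on :: "'a::euclidean_space set \<Rightarrow> ('a \<Rightarrow> real) \<Rightarrow> bool" where
  "C_infinity_on U f \<longleftrightarrow> (\<forall>k. C_k_on k U f)"

(* Near each boundary point D is a strict sublevel set of a smooth function without
   critical points; in particular D lies locally on one side of its boundary.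
   The boundary may be empty, so D = UNIV qualifies. *)
definition smooth_boundary :: "'a::euclidean_space set \<Rightarrow> bool" where
  "smooth_boundary D \<longleftrightarrow>
     (\<forall>z\<in>frontier D. \<exists>U \<rho> g. open U \<and> z \<in> U \<and> C_infinity_on U \<rho> \<and>
        (\<forall>x\<in>U. GDERIV \<rho> x :> g x \<and> g x \<noteq> 0) \<and> D \<inter> U = {x\<in>U. \<rho> x < 0})"


section \<open>Radon measures and the vague topology\<close>

definition topology_borel :: "'a topology \<Rightarrow> 'a measure" where
  "topology_borel T = sigma (topspace T) {U. openin T U}"

(* Only the values of f on D matter. *)
definition C_K :: "'a::euclidean_space set \<Rightarrow> ('a \<Rightarrow> real) set" where
  "C_K D = {f. continuous_on D f \<and> compact (top_of_set D closure_of support_on D f)}"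

(* On an open subset of a Euclidean space, inner and outer regularity of a Borel measure
   that is finite on compact sets are automatic. *)
definition radon_measures :: "'a::euclidean_space set \<Rightarrow> 'a measure set" where
  "radon_measures D =
     {\<mu>. sets \<mu> = sets (restrict_space borel D) \<and>
         (\<forall>K. compact K \<and> K \<subseteq> D \<longrightarrow> emeasure \<mu> K < \<infinity>)}"

(* The coarsest topology on the Radon measures that makes all maps "integrate f",
   f in C_K D, continuous. *)
definition vague_topology :: "'a::euclidean_space set \<Rightarrow> 'a measure topology" where
  "vague_topology D = topology_generated_by
     {{\<mu> \<in> radon_measures D. integral\<^sup>L \<mu> f \<in> U} | f U. f \<in> C_K D \<and> open U}"

lemma topspace_vague_topology: "topspace (vague_topology D) = radon_measures D"
proof -
  have "(\<lambda>x. 0) \<in> C_K D"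
    by (simp add: C_K_def support_on_def)
  then have "{\<mu> \<in> radon_measures D. integral\<^sup>L \<mu> (\<lambda>x. 0) \<in> UNIV}
      \<in> {{\<mu> \<in> radon_measures D. integral\<^sup>L \<mu> f \<in> U} | f U. f \<in> C_K D \<and> open U}"
    using open_UNIV by blast
  then show ?thesis
    unfolding vague_topology_def topology_generated_by_topspace by auto
qed

definition random_radon_measure ::
    "'w measure \<Rightarrow> 'a::euclidean_space set \<Rightarrow> ('w \<Rightarrow> 'a measure) \<Rightarrow> bool" where
  "random_radon_measure M D \<mu> \<longleftrightarrow> \<mu> \<in> measurable M (topology_borel (vague_topology D))"


section \<open>Killed Brownian motion\<close>

(* Standard normalisation: B t - B s has law N(0, (t - s) I). *)
definition brownian_motion ::
    "'w measure \<Rightarrow> 'a::euclidean_space \<Rightarrow> (real \<Rightarrow> 'w \<Rightarrow> 'a) \<Rightarrow> bool" where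
  "brownian_motion M x B \<longleftrightarrow>
     (\<forall>t\<ge>0. B t \<in> borel_measurable M) \<and>
     (\<forall>\<omega>\<in>space M. B 0 \<omega> = x \<and> continuous_on {0..} (\<lambda>t. B t \<omega>)) \<and>
     (\<forall>(n::nat) r. 0 \<le> r 0 \<and> (\<forall>j<n. r j \<le> r (Suc j)) \<longrightarrow>
        prob_space.indep_vars M (\<lambda>_. borel) (\<lambda>j \<omega>. B (r (Suc j)) \<omega> - B (r j) \<omega>) {..<n}) \<and>
     (\<forall>s t. 0 \<le> s \<and> s < t \<longrightarrow>
        distributed M lborel (\<lambda>\<omega>. B t \<omega> - B s \<omega>)
          (\<lambda>y. ennreal (\<Prod>b\<in>Basis. normal_density 0 (sqrt (t - s)) (y \<bullet> b))))"

definition exit_time :: "'a set \<Rightarrow> (real \<Rightarrow> 'a) \<Rightarrow> ereal" where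
  "exit_time D b = Inf {ereal t | t. 0 < t \<and> b t \<notin> D}"

(* The one-point compactification of D is Alexandroff_compactification (top_of_set D),
   whose underlying set is insert None (Some ` D): the cemetery point is None. *)
definition killed_path :: "'a set \<Rightarrow> (real \<Rightarrow> 'a) \<Rightarrow> real \<Rightarrow> 'a option" where
  "killed_path D b t = (if ereal t < exit_time D b then Some (b t) else None)"

definition killed_brownian_motion ::
    "'w measure \<Rightarrow> 'a::euclidean_space set \<Rightarrow> 'a \<Rightarrow> (real \<Rightarrow> 'w \<Rightarrow> 'a option) \<Rightarrow> bool" where
  "killed_brownian_motion M D x X \<longleftrightarrow>
     (\<exists>B. brownian_motion M x B \<and>
        (\<forall>\<omega>\<in>space M. \<forall>t\<ge>0. X t \<omega> = killed_path D (\<lambda>s. B s \<omega>) t))"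

definition independent_killed_processes ::
    "'w measure \<Rightarrow> 'a::euclidean_space set \<Rightarrow> nat \<Rightarrow> (nat \<Rightarrow> real \<Rightarrow> 'w \<Rightarrow> 'a option) \<Rightarrow> bool" where
  "independent_killed_processes M D p X \<longleftrightarrow>
     prob_space.indep_vars M
       (\<lambda>_. PiM {0..} (\<lambda>_. topology_borel (Alexandroff_compactification (top_of_set D))))
       (\<lambda>i \<omega>. \<lambda>t\<in>{0..}. X i t \<omega>) {1..p}"


section \<open>Intersection measures\<close>

definition q :: "real \<Rightarrow> 'a::euclidean_space \<Rightarrow> 'a option \<Rightarrow> real" where
  "q \<epsilon> x z = (case z of None \<Rightarrow> 0
                | Some y \<Rightarrow> indicat_real (ball x \<epsilon>) y / measure lborel (ball x \<epsilon>))"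

(* The pairing of the approximated intersection measure with f, along the trajectories Y 1, ..., Y p. *)
definition approx_IS ::
    "'a::euclidean_space set \<Rightarrow> nat \<Rightarrow> (nat \<Rightarrow> real \<Rightarrow> 'a option) \<Rightarrow> real \<Rightarrow> real \<Rightarrow> ('a \<Rightarrow> real) \<Rightarrow> real" where
  "approx_IS D p Y t \<epsilon> f =
     (LINT x:D|lborel. f x * (\<Prod>i=1..p. LINT s:{0..t}|lborel. q \<epsilon> x (Y i s)))"

definition IS_error ::
    "'a::euclidean_space set \<Rightarrow> nat \<Rightarrow> (nat \<Rightarrow> real \<Rightarrow> 'w \<Rightarrow> 'a option) \<Rightarrow> ('w \<Rightarrow> 'a measure) \<Rightarrow>
     real \<Rightarrow> real \<Rightarrow> ('a \<Rightarrow> real) \<Rightarrow> 'w \<Rightarrow> real" where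
  "IS_error D p X \<mu> t \<epsilon> f \<omega> =
     \<bar>approx_IS D p (\<lambda>i s. X i s \<omega>) t \<epsilon> f - integral\<^sup>L (\<mu> \<omega>) f\<bar>"

(* The second conjunct is vague convergence of random measures, in probability (it is implied
   by the third one). Expectations are nonnegative integrals, so that no integrability is presupposed
   and a non-integrable function has infinite expectation. *)
definition intersection_measure ::
    "'w measure \<Rightarrow> 'a::euclidean_space set \<Rightarrow> nat \<Rightarrow> (nat \<Rightarrow> real \<Rightarrow> 'w \<Rightarrow> 'a option) \<Rightarrow>
     real \<Rightarrow> ('w \<Rightarrow> 'a measure) \<Rightarrow> bool" where
  "intersection_measure M D p X t \<mu> \<longleftrightarrow>
     random_radon_measure M D \<mu> \<and>
     (\<forall>f\<in>C_K D. \<forall>\<delta>>0.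
        ((\<lambda>\<epsilon>. measure M {\<omega>\<in>space M. \<delta> < IS_error D p X \<mu> t \<epsilon> f \<omega>}) \<longlongrightarrow> 0) (at_right 0)) \<and>
     (\<forall>f\<in>C_K D. \<forall>k\<ge>1.
        ((\<lambda>\<epsilon>. \<integral>\<^sup>+\<omega>. ennreal (IS_error D p X \<mu> t \<epsilon> f \<omega> ^ k) \<partial>M) \<longlongrightarrow> 0) (at_right 0))"

end

theory Submission
  imports Defs
begin

text \<open>
  By Fubini and independence the even moments of the difference of two approximations
  \<open>\<ell>\<^sub>\<epsilon> - \<ell>\<^sub>\<delta>\<close> are integrals of products over the \<open>p\<close> processes, and telescoping over the
  processes puts the mollifier difference \<open>q\<^sub>\<epsilon> - q\<^sub>\<delta>\<close> on a single one of them. Hoelder's inequality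
  with exponent \<open>p\<close> in the space variables leaves \<open>L\<^sup>p\<close> norms of chains of killed heat kernels at
  fixed times; Jensen's inequality removes the remaining mollifiers, and the \<open>L\<^sup>p\<close> norm of one heat
  kernel at time \<open>r\<close> is integrable near \<open>r = 0\<close> exactly because \<open>d - p (d - 2) > 0\<close>. Ordering the
  times costs \<open>k!\<close> and replacing the indicator of \<open>s \<le> t\<close> by \<open>exp (t - s)\<close> costs \<open>e\<^sup>t\<close>, once per process.

  Smallness comes from pairs of consecutive time gaps: either a gap is short and its \<open>L\<^sup>p\<close> norm is
  small, or \<open>q\<^sub>\<epsilon> - q\<^sub>\<delta>\<close> acts on a function of small oscillation, since at interior points killing
  perturbs the free heat kernel by a function whose Lipschitz constant does not depend on time.
  Odd moments follow by Cauchy--Schwarz, and \<open>\<delta> \<rightarrow> 0\<close> uses the known convergence of moments.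
\<close>

section \<open>The Gaussian kernel\<close>

text \<open>The transition density of killed Brownian motion is never constructed. Killing is tested
  only at finitely many grid points of each time gap, so that all distributions involved are
  iterated integrals of Gaussian kernels with indicators. Killing on ever finer grids converges to
  killing on the whole gap only for closed sets; hence D is exhausted by the closed sets
  \<open>inner_part D N\<close>, and every estimate has to be uniform in the grid and in large N.
  For the oscillation estimate this uniformity comes from a last exit decomposition whose weights
  have total mass at most 1, whatever the number of killing times. Cancellation at one point needs
  regular kernels on both sides of it, so only every second mollifier is exploited, and a gain
  \<theta> per point requires a gain \<theta>^2 per pair. The exponent \<gamma> lies strictly
  between the L^p exponent of the kernel and 1: below 1 for integrability in time, above the L^p
  exponent so that a short gap gains a positive power of its length. Norms enter through their p-th
  powers, which avoids roots of extended reals.\<close>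

definition heat_kernel :: "real \<Rightarrow> 'a::euclidean_space \<Rightarrow> real" where
  "heat_kernel r u = (\<Prod>b\<in>Basis. normal_density 0 (sqrt r) (u \<bullet> b))"

lemma heat_kernel_measurable [measurable]: "heat_kernel r \<in> borel_measurable borel"
  unfolding heat_kernel_def by measurable

lemma heat_kernel_nonneg [simp]: "0 \<le> heat_kernel r u"
  unfolding heat_kernel_def by (intro prod_nonneg) simp

text \<open>The product over coordinates is the form in which \<open>brownian_motion\<close>
  supplies the density; the radial form is what the supremum and Lipschitz bounds need.\<close>

lemma heat_kernel_eq:
  fixes u :: "'a::euclidean_space"
  assumes "r > 0"
  shows "heat_kernel r u = (1 / sqrt (2 * pi * r)) ^ DIM('a) * exp (- (norm u)\<^sup>2 / (2 * r))"
proof -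
  have "(norm u)\<^sup>2 = (\<Sum>b\<in>Basis. (u \<bullet> b)\<^sup>2)"
    using euclidean_inner[of u u] unfolding power2_norm_eq_inner by (simp add: power2_eq_square)
  then have "exp (- (norm u)\<^sup>2 / (2 * r)) = (\<Prod>b\<in>Basis. exp (- (u \<bullet> b)\<^sup>2 / (2 * r)))"
    by (simp add: exp_sum[symmetric] sum_divide_distrib sum_negf)
  then show ?thesis
    using assms by (simp add: heat_kernel_def normal_density_def prod_dividef power_divide)
qed

lemma heat_kernel_uminus: "heat_kernel r (- u) = heat_kernel r u"
  unfolding heat_kernel_def normal_density_def by simp

lemma heat_kernel_commute: "heat_kernel r (x - y) = heat_kernel r (y - x)"
  using heat_kernel_uminus[of r "x - y"] by simp

lemma nn_integral_heat_kernel: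
  assumes "r > 0"
  shows "(\<integral>\<^sup>+u. ennreal (heat_kernel r u) \<partial>(lborel :: 'a::euclidean_space measure)) = 1"
proof -
  have "(\<integral>\<^sup>+u. ennreal (heat_kernel r u) \<partial>(lborel :: 'a measure))
      = (\<integral>\<^sup>+u. (\<Prod>b\<in>Basis. ennreal (normal_density 0 (sqrt r) (u \<bullet> b))) \<partial>(lborel :: 'a measure))"
    unfolding heat_kernel_def by (intro nn_integral_cong) (simp add: prod_ennreal)
  also have "\<dots> = (\<Prod>b\<in>(Basis::'a set). \<integral>\<^sup>+t. ennreal (normal_density 0 (sqrt r) t) \<partial>lborel)"
    by (rule nn_integral_lborel_prod) auto
  also have "\<dots> = 1"
    using assms by (simp add: nn_integral_eq_integral)
  finally show ?thesis .
qed

lemma nn_integral_lborel_shift: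
  fixes f :: "'a::euclidean_space \<Rightarrow> ennreal"
  assumes "f \<in> borel_measurable borel"
  shows "(\<integral>\<^sup>+z. f (z - y) \<partial>lborel) = (\<integral>\<^sup>+z. f z \<partial>lborel)"
proof -
  have "(\<integral>\<^sup>+z. f z \<partial>lborel) = (\<integral>\<^sup>+z. f z \<partial>distr lborel borel ((+) (- y)))"
    by (subst lborel_distr_plus[of "- y"]) simp
  also have "\<dots> = (\<integral>\<^sup>+z. f (- y + z) \<partial>lborel)"
    using assms by (subst nn_integral_distr) auto
  finally show ?thesis
    by simp
qed

lemma nn_integral_heat_kernel_shift:
  fixes y :: "'a::euclidean_space"
  assumes "r > 0"
  shows "(\<integral>\<^sup>+z. ennreal (heat_kernel r (z - y)) \<partial>lborel) = 1"
  using nn_integral_lborel_shift[of "\<lambda>z. ennreal (heat_kernel r z)" y]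
    nn_integral_heat_kernel[OF assms] by simp

text \<open>Integrand and result both factor over the coordinates, so the convolution of two centred
  normal densities on the line suffices.\<close>

lemma heat_kernel_convolution:
  fixes y z :: "'a::euclidean_space"
  assumes "r > 0" "s > 0"
  shows "(\<integral>\<^sup>+v. ennreal (heat_kernel r (v - y)) * ennreal (heat_kernel s (z - v)) \<partial>lborel)
      = ennreal (heat_kernel (r + s) (z - y))"
proof -
  have "(\<integral>\<^sup>+v. ennreal (heat_kernel r (v - y)) * ennreal (heat_kernel s (z - v)) \<partial>lborel)
      = (\<integral>\<^sup>+v. ennreal (heat_kernel r v) * ennreal (heat_kernel s (z - y - v)) \<partial>lborel)"
    using nn_integral_lborel_shift[of "\<lambda>v. ennreal (heat_kernel r v) * ennreal (heat_kernel s (z - y - v))" y]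
    by (simp add: algebra_simps)
  also have "\<dots> = (\<integral>\<^sup>+v. (\<Prod>b\<in>Basis. ennreal (normal_density 0 (sqrt s) ((z - y) \<bullet> b - v \<bullet> b)
       * normal_density 0 (sqrt r) (v \<bullet> b))) \<partial>lborel)"
    unfolding heat_kernel_def
    by (intro nn_integral_cong)
      (simp add: prod_ennreal ennreal_mult'[symmetric] prod_nonneg prod.distrib[symmetric] inner_diff_left mult.commute)
  also have "\<dots> = (\<Prod>b\<in>Basis. \<integral>\<^sup>+t. ennreal (normal_density 0 (sqrt s) ((z - y) \<bullet> b - t)
       * normal_density 0 (sqrt r) t) \<partial>lborel)"
    by (rule nn_integral_lborel_prod) auto
  also have "\<dots> = (\<Prod>b\<in>Basis. ennreal (normal_density 0 (sqrt (s + r)) ((z - y) \<bullet> b)))"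
    using conv_normal_density_zero_mean[of "sqrt s" "sqrt r"] assms
    by (intro prod.cong) (auto dest: fun_cong)
  also have "\<dots> = ennreal (heat_kernel (r + s) (z - y))"
    by (simp add: heat_kernel_def prod_ennreal add.commute)
  finally show ?thesis .
qed

section \<open>Supremum, Lipschitz and power bounds for the Gaussian kernel\<close>

lemma heat_kernel_le:
  fixes u :: "'a::euclidean_space"
  assumes "r > 0"
  shows "heat_kernel r u \<le> (1 / sqrt (2 * pi * r)) ^ DIM('a)"
  using assms by (subst heat_kernel_eq) (auto intro!: mult_left_le)

lemma heat_kernel_le_of_ge:
  fixes u :: "'a::euclidean_space"
  assumes "h > 0" "h \<le> r"
  shows "heat_kernel r u \<le> (1 / sqrt (2 * pi * h)) ^ DIM('a)"
proof -
  have "(1 / sqrt (2 * pi * r)) ^ DIM('a) \<le> (1 / sqrt (2 * pi * h)) ^ DIM('a)"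
    using assms by (intro power_mono divide_left_mono) auto
  then show ?thesis
    using heat_kernel_le[of r u] assms by linarith
qed

text \<open>Since the kernel is radial, its increments are controlled by a one-dimensional
  mean value estimate even when the segment between the two points enters the region
  where the gradient is large.\<close>

lemma heat_kernel_radial_Lipschitz:
  fixes u u' :: "'a::euclidean_space"
  assumes r: "r > 0" and rho: "\<rho> \<ge> 0"
    and B: "\<And>R. R \<ge> \<rho> \<Longrightarrow> R / r * ((1 / sqrt (2 * pi * r)) ^ DIM('a) * exp (- R\<^sup>2 / (2 * r))) \<le> B"
    and "norm u \<ge> \<rho>" "norm u' \<ge> \<rho>"
  shows "\<bar>heat_kernel r u - heat_kernel r u'\<bar> \<le> B * norm (u - u')"
proof -
  define G where "G R = (1 / sqrt (2 * pi * r)) ^ DIM('a) * exp (- R\<^sup>2 / (2 * r))" for R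
  have der: "(G has_field_derivative (- R / r * G R)) (at R within {\<rho>..})" for R
    unfolding G_def using r
    by (auto intro!: derivative_eq_intros simp: field_simps)
  have bound: "norm (- R / r * G R) \<le> B" if "R \<in> {\<rho>..}" for R
  proof -
    have "\<bar>- R / r * G R\<bar> = R / r * G R"
      using that rho r by (simp add: abs_mult G_def)
    then show ?thesis
      using B[of R] that by (simp add: G_def)
  qed
  have "norm (G (norm u) - G (norm u')) \<le> B * norm (norm u - norm u')"
    by (rule field_differentiable_bound[OF _ der bound]) (use assms in auto)
  moreover have "B \<ge> 0"
    using bound[of "norm u"] assms(4) norm_ge_zero order_trans atLeast_iff by blast
  moreover have "\<bar>norm u - norm u'\<bar> \<le> norm (u - u')"
    by (rule norm_triangle_ineq3)
  ultimately have "\<bar>G (norm u) - G (norm u')\<bar> \<le> B * norm (u - u')"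
    using mult_left_mono[of "\<bar>norm u - norm u'\<bar>" "norm (u - u')" B] by simp
  then show ?thesis
    using r by (simp add: heat_kernel_eq G_def)
qed

text \<open>In the scaled radius x = R / sqrt r the radial derivative is, up to sign, r^(-1/2) (2 pi
  r)^(-d/2) times x exp(-x^2/2). The last factor is at most 1, and the rest decreases in r.\<close>

lemma heat_kernel_Lipschitz_of_ge:
  fixes u u' :: "'a::euclidean_space"
  assumes h: "h > 0" "h \<le> r"
  shows "\<bar>heat_kernel r u - heat_kernel r u'\<bar>
      \<le> (1 / sqrt h) * (1 / sqrt (2 * pi * h)) ^ DIM('a) * norm (u - u')"
proof (rule heat_kernel_radial_Lipschitz[where \<rho> = 0])
  fix R :: real assume R: "R \<ge> 0"
  have r: "r > 0" using h by simp
  define x where "x = R / sqrt r"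
  have x: "x \<ge> 0" "R = x * sqrt r" using R r by (auto simp: x_def)
  have "x \<le> exp (x\<^sup>2 / 2)"
  proof -
    have "x \<le> 1 + x\<^sup>2 / 2"
      using zero_le_power2[of "x - 1"] by (simp add: power2_eq_square algebra_simps)
    also have "\<dots> \<le> exp (x\<^sup>2 / 2)" by (rule exp_ge_add_one_self)
    finally show ?thesis .
  qed
  then have 1: "x * exp (- x\<^sup>2 / 2) \<le> 1"
    by (simp add: exp_minus divide_inverse[symmetric])
  have "R / r = x / sqrt r"
    using r x(2) by (simp add: field_simps)
  moreover have "R\<^sup>2 / (2 * r) = x\<^sup>2 / 2"
    using r x(2) by (simp add: power_mult_distrib)
  ultimately have "R / r * ((1 / sqrt (2 * pi * r)) ^ DIM('a) * exp (- R\<^sup>2 / (2 * r)))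
      = (x * exp (- x\<^sup>2 / 2)) * ((1 / sqrt r) * (1 / sqrt (2 * pi * r)) ^ DIM('a))"
    by simp
  also have "\<dots> \<le> 1 * ((1 / sqrt r) * (1 / sqrt (2 * pi * r)) ^ DIM('a))"
    using 1 r by (intro mult_right_mono) auto
  also have "\<dots> \<le> (1 / sqrt h) * (1 / sqrt (2 * pi * h)) ^ DIM('a)"
    unfolding mult_1 using h r
    by (intro mult_mono power_mono divide_left_mono) auto
  finally show "R / r * ((1 / sqrt (2 * pi * r)) ^ DIM('a) * exp (- R\<^sup>2 / (2 * r)))
      \<le> (1 / sqrt h) * (1 / sqrt (2 * pi * h)) ^ DIM('a)" .
qed (use h in auto)

lemma power_le_fact_exp:
  fixes x :: real
  assumes "x \<ge> 0"
  shows "x ^ n \<le> fact n * exp x"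
proof -
  have "x ^ n /\<^sub>R fact n \<le> exp x"
  proof -
    have "(\<lambda>n. x ^ n /\<^sub>R fact n) sums exp x" by (rule exp_converges)
    then have "(\<Sum>i\<in>{n}. x ^ i /\<^sub>R fact i) \<le> exp x"
      using assms by (intro sum_le_suminf[THEN order_trans]) (auto simp: sums_iff)
    then show ?thesis by simp
  qed
  then show ?thesis by (simp add: field_simps)
qed

text \<open>With x = R^2/(2r), the powers of 1/r in the radial derivative become powers of x divided
  by powers of R \<ge> \<rho>, and exp(-x) absorbs the powers of x. Hence the constant is free of r,
  in contrast to the bound for r \<ge> h, which degenerates as h tends to 0.\<close>

lemma heat_kernel_Lipschitz_away:
  fixes u u' :: "'a::euclidean_space"
  assumes r: "r > 0" and rho: "\<rho> > 0" and u: "norm u \<ge> \<rho>" "norm u' \<ge> \<rho>"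
  shows "\<bar>heat_kernel r u - heat_kernel r u'\<bar>
      \<le> (2 / \<rho> * (1 / \<rho>) ^ DIM('a) * (exp 1 * fact (Suc DIM('a)))) * norm (u - u')"
proof (rule heat_kernel_radial_Lipschitz[where \<rho> = \<rho>])
  fix R assume R: "R \<ge> \<rho>"
  define d where "d = DIM('a)"
  define x where "x = R\<^sup>2 / (2 * r)"
  have x0: "x > 0" "R > 0" using R r rho by (auto simp: x_def)
  have sq: "1 / sqrt (2 * pi * r) = sqrt x / (sqrt pi * R)"
  proof -
    have "sqrt x = R / sqrt (2 * r)" using x0 by (simp add: x_def real_sqrt_divide)
    then show ?thesis using x0 r by (simp add: real_sqrt_mult)
  qed
  have "sqrt x / (sqrt pi * R) \<le> (1 + x) / (1 * \<rho>)"
  proof (intro frac_le mult_mono)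
    show "sqrt x \<le> 1 + x"
    proof (rule real_le_lsqrt)
      show "x \<le> (1 + x)\<^sup>2" using x0 by (simp add: power2_eq_square algebra_simps)
    qed (use x0 in auto)
    show "1 \<le> sqrt pi" using pi_ge_two by simp
  qed (use R rho x0 in auto)
  then have "(1 / sqrt (2 * pi * r)) ^ d \<le> ((1 + x) / (1 * \<rho>)) ^ d"
    unfolding sq using x0 by (intro power_mono) auto
  then have 1: "(1 / sqrt (2 * pi * r)) ^ d \<le> (1 / \<rho>) ^ d * (1 + x) ^ d"
    by (simp add: power_divide)
  have "R / r = 2 * x / R"
    using x0 r by (simp add: x_def power2_eq_square)
  also have "\<dots> \<le> 2 * (1 + x) / \<rho>"
    using x0 R rho by (intro frac_le) auto
  finally have 2: "R / r \<le> (2 / \<rho>) * (1 + x)" by simp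
  \<comment> \<open>One power of 1 + x comes from R/r and d powers from the normalising factor. The
    exponential series pays for them, which is the origin of \<open>fact (Suc DIM('a))\<close> and
    \<open>exp 1\<close>.\<close>
  have "(1 + x) ^ Suc d \<le> fact (Suc d) * exp (1 + x)"
    using x0 by (intro power_le_fact_exp) auto
  then have 3: "(1 + x) ^ Suc d * exp (- x) \<le> exp 1 * fact (Suc d)"
    by (simp add: exp_add exp_minus field_simps)
  have "R / r * ((1 / sqrt (2 * pi * r)) ^ d * exp (- x))
      \<le> ((2 / \<rho>) * (1 + x)) * (((1 / \<rho>) ^ d * (1 + x) ^ d) * exp (- x))"
    using 1 2 x0 rho r by (intro mult_mono) auto
  also have "\<dots> = 2 / \<rho> * (1 / \<rho>) ^ d * ((1 + x) ^ Suc d * exp (- x))"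
    by simp
  also have "\<dots> \<le> 2 / \<rho> * (1 / \<rho>) ^ d * (exp 1 * fact (Suc d))"
    using 3 rho by (intro mult_left_mono) auto
  finally show "R / r * ((1 / sqrt (2 * pi * r)) ^ DIM('a) * exp (- R\<^sup>2 / (2 * r)))
      \<le> 2 / \<rho> * (1 / \<rho>) ^ DIM('a) * (exp 1 * fact (Suc DIM('a)))"
    by (simp add: d_def x_def)
qed (use assms in auto)

text \<open>Of the p factors, p - 1 are replaced by the supremum of the kernel; the remaining one
  integrates to 1.\<close>

lemma nn_integral_heat_kernel_power:
  fixes y :: "'a::euclidean_space"
  assumes r: "r > 0" and p: "p \<ge> 1"
  shows "(\<integral>\<^sup>+z. ennreal (heat_kernel r (z - y)) ^ p \<partial>lborel)
      \<le> ennreal (((1 / sqrt (2 * pi * r)) ^ DIM('a)) ^ (p - 1))"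
proof -
  let ?c = "((1 / sqrt (2 * pi * r)) ^ DIM('a)) ^ (p - 1)"
  have "ennreal (heat_kernel r (z - y)) ^ p \<le> ennreal ?c * ennreal (heat_kernel r (z - y))" for z
  proof -
    have "heat_kernel r (z - y) ^ p = heat_kernel r (z - y) ^ (p - 1) * heat_kernel r (z - y)"
      using p by (metis One_nat_def Suc_pred less_eq_Suc_le power_Suc2)
    also have "\<dots> \<le> ?c * heat_kernel r (z - y)"
      using heat_kernel_le[OF r, of "z - y"] by (intro mult_right_mono power_mono) auto
    finally have "heat_kernel r (z - y) ^ p \<le> ?c * heat_kernel r (z - y)" .
    moreover have "?c \<ge> 0" using r by simp
    ultimately show ?thesis
      by (simp add: ennreal_power ennreal_mult'[symmetric] del: power_divide power_one)
  qed
  then have "(\<integral>\<^sup>+z. ennreal (heat_kernel r (z - y)) ^ p \<partial>lborel)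
      \<le> (\<integral>\<^sup>+z. ennreal ?c * ennreal (heat_kernel r (z - y)) \<partial>lborel)"
    by (intro nn_integral_mono)
  also have "\<dots> = ennreal ?c"
    using nn_integral_heat_kernel_shift[OF r, of y] by (subst nn_integral_cmult) auto
  finally show ?thesis .
qed


section \<open>Hoelder's inequality\<close>

text \<open>The inequality between arithmetic and geometric mean for the p-th powers of the factors,
  p = \<open>card I\<close>. An infinite factor makes the right side infinite, so it is split off
  before passing to real numbers.\<close>

lemma prod_le_mean_power:
  fixes a :: "'i \<Rightarrow> ennreal"
  assumes I: "finite I" "I \<noteq> {}"
  shows "of_nat (card I) * (\<Prod>i\<in>I. a i) \<le> (\<Sum>i\<in>I. a i ^ card I)"
proof (cases "\<exists>i\<in>I. a i = \<infinity>")
  case True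
  then obtain i where i: "i \<in> I" "a i = \<infinity>" by auto
  have "card I > 0" using I by (simp add: card_gt_0_iff)
  then have "a i ^ card I = \<infinity>"
    using i by (simp add: power_eq_top_ennreal)
  then have "(\<Sum>i\<in>I. a i ^ card I) = \<infinity>"
    using i I by (subst sum.remove[of I i]) (auto simp: infinity_ennreal_def)
  then show ?thesis by simp
next
  case False
  define p where "p = card I"
  have p: "p > 0" using I by (simp add: card_gt_0_iff p_def)
  define x where "x i = enn2real (a i)" for i
  have ax: "a i = ennreal (x i)" if "i \<in> I" for i
    using False that by (simp add: x_def less_top)
  have x0: "x i \<ge> 0" for i by (simp add: x_def)
  have "(\<Prod>i\<in>I. x i ^ p) powr (1 / p) \<le> (\<Sum>i\<in>I. x i ^ p / p)"
    using arith_geom_mean[OF I, of "\<lambda>i. x i ^ p"] x0 by (simp add: p_def)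
  also have "(\<Prod>i\<in>I. x i ^ p) powr (1 / p) = (\<Prod>i\<in>I. x i)"
  proof -
    have "(\<Prod>i\<in>I. x i) \<ge> 0" using x0 by (intro prod_nonneg) auto
    then show ?thesis
      using p by (simp add: prod_power_distrib[symmetric] powr_powr powr_realpow'[symmetric])
  qed
  finally have "p * (\<Prod>i\<in>I. x i) \<le> (\<Sum>i\<in>I. x i ^ p)"
    using p by (simp add: sum_divide_distrib[symmetric] field_simps)
  moreover have "(\<Prod>i\<in>I. a i) = ennreal (\<Prod>i\<in>I. x i)"
    using x0 ax by (simp add: prod_ennreal)
  moreover have "(\<Sum>i\<in>I. a i ^ p) = ennreal (\<Sum>i\<in>I. x i ^ p)"
    using x0 ax by (simp add: ennreal_power sum_nonneg)
  ultimately show ?thesis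
    unfolding p_def[symmetric]
    by (metis ennreal_leI ennreal_mult' ennreal_of_nat_eq_real_of_nat of_nat_0_le_iff)
qed

text \<open>The functions are normalised to L^p norm 1 and the mean inequality is integrated. A
  vanishing norm must be treated before an infinite one, because 0 times \<infinity> is 0 on the
  right side.\<close>

lemma nn_integral_Hoelder:
  fixes g :: "'i \<Rightarrow> 'b \<Rightarrow> ennreal"
  assumes I: "finite I" "I \<noteq> {}"
    and g[measurable]: "\<And>i. i \<in> I \<Longrightarrow> g i \<in> borel_measurable M"
  shows "(\<integral>\<^sup>+x. (\<Prod>i\<in>I. g i x) \<partial>M) ^ card I \<le> (\<Prod>i\<in>I. \<integral>\<^sup>+x. g i x ^ card I \<partial>M)"
proof -
  define p where "p = card I"
  have p: "p > 0" using I by (simp add: card_gt_0_iff p_def)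
  define N where "N i = (\<integral>\<^sup>+x. g i x ^ p \<partial>M)" for i
  consider (zero) i where "i \<in> I" "N i = 0" | (inf) "\<forall>i\<in>I. N i \<noteq> 0" "\<exists>i\<in>I. N i = \<infinity>"
    | (fin) "\<forall>i\<in>I. N i \<noteq> 0 \<and> N i < \<infinity>"
    by (metis infinity_ennreal_def top.not_eq_extremum)
  then have "(\<integral>\<^sup>+x. (\<Prod>i\<in>I. g i x) \<partial>M) ^ p \<le> (\<Prod>i\<in>I. N i)"
  proof cases
    case zero
    have "AE x in M. g i x ^ p = 0"
      using zero by (subst nn_integral_0_iff_AE[symmetric]) (auto simp: N_def)
    then have "AE x in M. (\<Prod>i\<in>I. g i x) = 0"
      by eventually_elim (use zero I in \<open>auto\<close>)
    then have "(\<integral>\<^sup>+x. (\<Prod>i\<in>I. g i x) \<partial>M) = 0"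
      by (subst nn_integral_0_iff_AE) auto
    then show ?thesis using p by (simp add: zero_power)
  next
    case inf
    then have "(\<Prod>i\<in>I. N i) = \<infinity>"
      using I by (metis ennreal_prod_eq_top infinity_ennreal_def)
    then show ?thesis by simp
  next
    case fin
    define c where "c i = enn2real (N i) powr (1 / p)" for i
    have N: "enn2real (N i) > 0" "N i = ennreal (enn2real (N i))" if "i \<in> I" for i
      using fin that by (auto simp: enn2real_positive_iff less_top zero_less_iff_neq_zero)
    have c: "c i > 0" "N i = ennreal (c i) ^ p" if "i \<in> I" for i
    proof -
      show "c i > 0" using N[OF that] by (simp add: c_def)
      have "c i ^ p = enn2real (N i)"
        using N[OF that] p by (simp add: c_def powr_realpow[symmetric] powr_powr)
      then show "N i = ennreal (c i) ^ p"
        using N[OF that] \<open>c i > 0\<close> by (simp add: ennreal_power)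
    qed
    define a where "a i x = g i x * ennreal (1 / c i)" for i x
    have am[measurable]: "a i \<in> borel_measurable M" if "i \<in> I" for i
      using that unfolding a_def by measurable
    have one: "(\<integral>\<^sup>+x. a i x ^ p \<partial>M) = 1" if "i \<in> I" for i
    proof -
      have "(\<integral>\<^sup>+x. a i x ^ p \<partial>M) = N i * ennreal (1 / c i) ^ p"
        unfolding a_def N_def power_mult_distrib
        by (rule nn_integral_multc) (use that in measurable)
      also have "\<dots> = (ennreal (c i) * ennreal (1 / c i)) ^ p"
        using c[OF that] by (simp add: power_mult_distrib)
      also have "\<dots> = 1" using c[OF that] by (simp add: ennreal_mult'[symmetric])
      finally show ?thesis .
    qed
    have "of_nat p * (\<integral>\<^sup>+x. (\<Prod>i\<in>I. a i x) \<partial>M) = (\<integral>\<^sup>+x. of_nat p * (\<Prod>i\<in>I. a i x) \<partial>M)"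
      by (subst nn_integral_cmult) auto
    also have "\<dots> \<le> (\<integral>\<^sup>+x. (\<Sum>i\<in>I. a i x ^ p) \<partial>M)"
      unfolding p_def by (intro nn_integral_mono prod_le_mean_power I)
    also have "\<dots> = (\<Sum>i\<in>I. \<integral>\<^sup>+x. a i x ^ p \<partial>M)"
      by (rule nn_integral_sum) auto
    also have "\<dots> = of_nat p" using one by (simp add: p_def)
    finally have "of_nat p * (\<integral>\<^sup>+x. (\<Prod>i\<in>I. a i x) \<partial>M) \<le> of_nat p * 1" by simp
    then have le1: "(\<integral>\<^sup>+x. (\<Prod>i\<in>I. a i x) \<partial>M) \<le> 1"
      using p by (subst (asm) ennreal_mult_le_mult_iff) (auto simp: of_nat_less_top less_top)
    have "(\<Prod>i\<in>I. g i x) = (\<Prod>i\<in>I. ennreal (c i)) * (\<Prod>i\<in>I. a i x)" for x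
    proof -
      have "g i x = ennreal (c i) * a i x" if "i \<in> I" for i
      proof -
        have "ennreal (c i) * a i x = g i x * (ennreal (c i) * ennreal (1 / c i))"
          by (simp add: a_def mult.left_commute)
        also have "ennreal (c i) * ennreal (1 / c i) = 1"
          using c[OF that] by (simp add: ennreal_mult'[symmetric])
        finally show ?thesis by simp
      qed
      then show ?thesis by (simp add: prod.distrib[symmetric])
    qed
    then have "(\<integral>\<^sup>+x. (\<Prod>i\<in>I. g i x) \<partial>M) = (\<Prod>i\<in>I. ennreal (c i)) * (\<integral>\<^sup>+x. (\<Prod>i\<in>I. a i x) \<partial>M)"
      by (simp add: nn_integral_cmult)
    also have "\<dots> \<le> (\<Prod>i\<in>I. ennreal (c i))"
      using le1 mult_left_mono[of _ 1 "\<Prod>i\<in>I. ennreal (c i)"] by simp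
    finally have "(\<integral>\<^sup>+x. (\<Prod>i\<in>I. g i x) \<partial>M) ^ p \<le> (\<Prod>i\<in>I. ennreal (c i)) ^ p"
      by (rule power_mono) simp
    also have "\<dots> = (\<Prod>i\<in>I. N i)"
      using c by (simp add: prod_power_distrib)
    finally show ?thesis .
  qed
  then show ?thesis by (simp add: N_def p_def)
qed

text \<open>Hoelder's inequality for the p functions f, 1, ..., 1 with respect to the measure with
  density m. It serves as Jensen's inequality for measures whose mass need not be 1.\<close>

lemma nn_integral_mult_power_le:
  fixes m f :: "'b \<Rightarrow> ennreal"
  assumes [measurable]: "m \<in> borel_measurable M" "f \<in> borel_measurable M" and p: "p \<ge> 1"
  shows "(\<integral>\<^sup>+x. m x * f x \<partial>M) ^ p \<le> (\<integral>\<^sup>+x. m x \<partial>M) ^ (p - 1) * (\<integral>\<^sup>+x. m x * f x ^ p \<partial>M)"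
proof -
  define \<mu> where "\<mu> = density M m"
  have [measurable_cong]: "sets \<mu> = sets M" by (simp add: \<mu>_def)
  have card: "card {..<p} = p" by simp
  define G where "G i x = (if i = 0 then f x else 1)" for i :: nat and x
  have [measurable]: "G i \<in> borel_measurable \<mu>" for i unfolding G_def by measurable
  have 0: "0 \<in> {..<p}" using p by simp
  have card0: "card ({..<p} - {0}) = p - 1" using 0 by simp
  have "(\<integral>\<^sup>+x. (\<Prod>i<p. G i x) \<partial>\<mu>) ^ p \<le> (\<Prod>i<p. \<integral>\<^sup>+x. G i x ^ p \<partial>\<mu>)"
    using nn_integral_Hoelder[of "{..<p}" G \<mu>] p by (simp add: lessThan_empty_iff)
  moreover have "(\<Prod>i<p. G i x) = f x" for x
    by (subst prod.remove[OF _ 0]) (auto simp: G_def)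
  moreover have "(\<Prod>i<p. \<integral>\<^sup>+x. G i x ^ p \<partial>\<mu>) = (\<integral>\<^sup>+x. f x ^ p \<partial>\<mu>) * (\<integral>\<^sup>+x. 1 \<partial>\<mu>) ^ (p - 1)"
    by (subst prod.remove[OF _ 0]) (use card0 in \<open>auto simp: G_def\<close>)
  ultimately show ?thesis
    by (simp add: \<mu>_def nn_integral_density mult.commute del: nn_integral_const)
qed

section \<open>Discretely killed kernels\<close>

text \<open>Density at z of a Gaussian walk from y with n + 1 steps of duration r, restricted to
  walks whose n intermediate positions lie in F. The endpoint is not tested, so n = 0 is the free
  kernel, and the total time is (n + 1) r.\<close>

fun killed_kernel :: "'a::euclidean_space set \<Rightarrow> real \<Rightarrow> nat \<Rightarrow> 'a \<Rightarrow> 'a \<Rightarrow> ennreal" where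
  "killed_kernel F r 0 y z = ennreal (heat_kernel r (z - y))"
| "killed_kernel F r (Suc n) y z =
     (\<integral>\<^sup>+v. ennreal (heat_kernel r (v - y)) * indicator F v * killed_kernel F r n v z \<partial>lborel)"

context
  fixes F :: "'a::euclidean_space set" and r :: real
  assumes F[measurable]: "F \<in> sets borel" and r: "r > 0"
begin

lemma killed_kernel_measurable [measurable]:
  "(\<lambda>x. killed_kernel F r n (fst x) (snd x)) \<in> borel_measurable (borel \<Otimes>\<^sub>M borel)"
proof (induction n)
  case (Suc n)
  have [measurable]: "(\<lambda>u. killed_kernel F r n (snd u) (snd (fst u)))
      \<in> borel_measurable ((borel \<Otimes>\<^sub>M borel) \<Otimes>\<^sub>M borel)"
    using measurable_compose[OF _ Suc, of "\<lambda>u. (snd u, snd (fst u))" "(borel \<Otimes>\<^sub>M borel) \<Otimes>\<^sub>M borel"] by simp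
  show ?case by simp
qed simp

lemma killed_kernel_measurable' [measurable (raw)]:
  assumes "f \<in> borel_measurable N" "g \<in> borel_measurable N"
  shows "(\<lambda>x. killed_kernel F r n (f x) (g x)) \<in> borel_measurable N"
  using measurable_compose[OF measurable_Pair[OF assms] killed_kernel_measurable[of n]] by simp

lemma killed_kernel_le: "killed_kernel F r n y z \<le> ennreal (heat_kernel (real (Suc n) * r) (z - y))"
proof (induction n arbitrary: y)
  case (Suc n)
  have "killed_kernel F r (Suc n) y z
      \<le> (\<integral>\<^sup>+v. ennreal (heat_kernel r (v - y)) * ennreal (heat_kernel (real (Suc n) * r) (z - v)) \<partial>lborel)"
    unfolding killed_kernel.simps
  proof (intro nn_integral_mono mult_mono Suc)
    show "ennreal (heat_kernel r (v - y)) * indicator F v \<le> ennreal (heat_kernel r (v - y))" for v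
      by (auto split: split_indicator)
  qed auto
  also have "\<dots> = ennreal (heat_kernel (r + real (Suc n) * r) (z - y))"
    using r by (intro heat_kernel_convolution) auto
  also have "r + real (Suc n) * r = real (Suc (Suc n)) * r" by (simp add: algebra_simps)
  finally show ?case .
qed simp

lemma killed_kernel_finite: "killed_kernel F r n y z < \<infinity>"
  unfolding infinity_ennreal_def by (rule le_less_trans[OF killed_kernel_le ennreal_less_top])

lemma killed_kernel_Suc_right:
  "killed_kernel F r (Suc n) y z =
     (\<integral>\<^sup>+w. killed_kernel F r n y w * indicator F w * ennreal (heat_kernel r (z - w)) \<partial>lborel)"
proof (induction n arbitrary: y)
  case (Suc n)
  have "killed_kernel F r (Suc (Suc n)) y z
      = (\<integral>\<^sup>+v. (\<integral>\<^sup>+w. ennreal (heat_kernel r (v - y)) * indicator F v * killed_kernel F r n v w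
           * indicator F w * ennreal (heat_kernel r (z - w)) \<partial>lborel) \<partial>lborel)"
    unfolding killed_kernel.simps(2)[of F r "Suc n"] Suc
    by (intro nn_integral_cong) (simp add: nn_integral_cmult[symmetric] mult.assoc)
  also have "\<dots> = (\<integral>\<^sup>+w. (\<integral>\<^sup>+v. ennreal (heat_kernel r (v - y)) * indicator F v * killed_kernel F r n v w
           * indicator F w * ennreal (heat_kernel r (z - w)) \<partial>lborel) \<partial>lborel)"
    by (rule lborel_pair.Fubini') simp
  also have "\<dots> = (\<integral>\<^sup>+w. killed_kernel F r (Suc n) y w * indicator F w * ennreal (heat_kernel r (z - w)) \<partial>lborel)"
    by (intro nn_integral_cong) (simp add: nn_integral_multc)
  finally show ?case .
qed simp

text \<open>Time reversal: expanding one side from the last step and the other from the first gives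
  the same integrand, by the symmetry of the Gaussian. It turns the oscillation estimate in the
  starting point into one in the end point.\<close>

lemma killed_kernel_commute: "killed_kernel F r n y z = killed_kernel F r n z y"
proof (induction n arbitrary: y z)
  case 0
  then show ?case by (simp add: heat_kernel_commute)
next
  case (Suc n)
  show ?case
    unfolding killed_kernel_Suc_right[of n y z] unfolding killed_kernel.simps(2)
    by (intro nn_integral_cong) (simp add: Suc[of y] heat_kernel_commute[of r z] mult_ac)
qed

text \<open>The free path is split at the first of the killing times, counted from \<open>w\<close>, after which
  the path stays in \<open>F\<close> (a last exit decomposition).\<close>

lemma heat_kernel_killed_decomposition:
  "ennreal (heat_kernel (real (Suc n) * r) (z - w)) = killed_kernel F r n w z
     + (\<Sum>i<n. \<integral>\<^sup>+v. ennreal (heat_kernel (real (Suc i) * r) (v - w)) * indicator (- F) v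
          * killed_kernel F r (n - 1 - i) v z \<partial>lborel)"
proof (induction n arbitrary: w)
  case (Suc n)
  define T where "T m i w = (\<integral>\<^sup>+v. ennreal (heat_kernel (real (Suc i) * r) (v - w)) * indicator (- F) v
          * killed_kernel F r (m - 1 - i) v z \<partial>lborel)" for m i w
  have [measurable]: "T m i \<in> borel_measurable borel" for m i
    unfolding T_def by measurable
  have "ennreal (heat_kernel (real (Suc (Suc n)) * r) (z - w))
      = (\<integral>\<^sup>+v. ennreal (heat_kernel r (v - w)) * ennreal (heat_kernel (real (Suc n) * r) (z - v)) \<partial>lborel)"
  proof -
    have "r + real (Suc n) * r = real (Suc (Suc n)) * r" by (simp add: algebra_simps)
    then show ?thesis
      using r heat_kernel_convolution[of r "real (Suc n) * r" w z] by simp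
  qed
  also have "\<dots> = (\<integral>\<^sup>+v. ennreal (heat_kernel r (v - w)) * (killed_kernel F r n v z + (\<Sum>i<n. T n i v)) \<partial>lborel)"
    unfolding Suc T_def ..
  also have "\<dots> = (\<integral>\<^sup>+v. ennreal (heat_kernel r (v - w)) * indicator F v * killed_kernel F r n v z
       + (ennreal (heat_kernel r (v - w)) * indicator (- F) v * killed_kernel F r n v z
       + (\<Sum>i<n. ennreal (heat_kernel r (v - w)) * T n i v)) \<partial>lborel)"
    by (intro nn_integral_cong) (auto simp: distrib_left sum_distrib_left split: split_indicator)
  also have "\<dots> = killed_kernel F r (Suc n) w z + (T (Suc n) 0 w
       + (\<Sum>i<n. \<integral>\<^sup>+v. ennreal (heat_kernel r (v - w)) * T n i v \<partial>lborel))"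
    by (simp add: nn_integral_add nn_integral_sum T_def)
  \<comment> \<open>By the convolution identity one more free step in front turns term i of the old
    sum into term i + 1 of the new one. The new term 0 collects the paths that are outside F at the
    first time and inside at all later ones.\<close>
  also have "(\<Sum>i<n. \<integral>\<^sup>+v. ennreal (heat_kernel r (v - w)) * T n i v \<partial>lborel) = (\<Sum>i<n. T (Suc n) (Suc i) w)"
  proof (intro sum.cong refl)
    fix i
    have "(\<integral>\<^sup>+v. ennreal (heat_kernel r (v - w)) * T n i v \<partial>lborel)
       = (\<integral>\<^sup>+v. (\<integral>\<^sup>+u. ennreal (heat_kernel r (v - w)) * (ennreal (heat_kernel (real (Suc i) * r) (u - v)) * indicator (- F) u
          * killed_kernel F r (n - 1 - i) u z) \<partial>lborel) \<partial>lborel)"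
      unfolding T_def by (simp add: nn_integral_cmult)
    also have "\<dots> = (\<integral>\<^sup>+u. (\<integral>\<^sup>+v. ennreal (heat_kernel r (v - w)) * (ennreal (heat_kernel (real (Suc i) * r) (u - v)) * indicator (- F) u
          * killed_kernel F r (n - 1 - i) u z) \<partial>lborel) \<partial>lborel)"
      by (rule lborel_pair.Fubini') simp
    also have "\<dots> = (\<integral>\<^sup>+u. (\<integral>\<^sup>+v. ennreal (heat_kernel r (v - w)) * ennreal (heat_kernel (real (Suc i) * r) (u - v)) \<partial>lborel)
         * (indicator (- F) u * killed_kernel F r (n - 1 - i) u z) \<partial>lborel)"
      by (intro nn_integral_cong) (simp add: nn_integral_multc[symmetric] mult.assoc)
    also have "\<dots> = T (Suc n) (Suc i) w"
    proof -
      have "r + real (Suc i) * r = real (Suc (Suc i)) * r" by (simp add: algebra_simps)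
      moreover have "real (Suc i) * r > 0" using r by simp
      ultimately have conv: "(\<integral>\<^sup>+v. ennreal (heat_kernel r (v - w)) * ennreal (heat_kernel (real (Suc i) * r) (u - v)) \<partial>lborel)
          = ennreal (heat_kernel (real (Suc (Suc i)) * r) (u - w))" for u
        using heat_kernel_convolution[of r "real (Suc i) * r" w u] r by simp
      show ?thesis
        unfolding T_def conv by (simp add: mult.assoc)
    qed
    finally show "(\<integral>\<^sup>+v. ennreal (heat_kernel r (v - w)) * T n i v \<partial>lborel) = T (Suc n) (Suc i) w" .
  qed
  also have "T (Suc n) 0 w + (\<Sum>i<n. T (Suc n) (Suc i) w) = (\<Sum>i<Suc n. T (Suc n) i w)"
    by (rule sum.lessThan_Suc_shift[symmetric])
  finally show ?case unfolding T_def .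
qed simp

text \<open>Integrating the decomposition over its starting point w turns every Gaussian factor, and
  the free kernel itself, into 1. The bound depends neither on n nor on r, and the uniformity of the
  oscillation estimate rests on it.\<close>

lemma killed_mass_le:
  "(\<Sum>i<n. \<integral>\<^sup>+v. indicator (- F) v * killed_kernel F r (n - 1 - i) v z \<partial>lborel) \<le> 1"
proof -
  have eq_le: "B \<le> X" if "X = C + B" for X B C :: ennreal
    using that by simp
  have "(\<Sum>i<n. \<integral>\<^sup>+v. indicator (- F) v * killed_kernel F r (n - 1 - i) v z \<partial>lborel)
     = (\<Sum>i<n. \<integral>\<^sup>+w. (\<integral>\<^sup>+v. ennreal (heat_kernel (real (Suc i) * r) (v - w)) * indicator (- F) v
          * killed_kernel F r (n - 1 - i) v z \<partial>lborel) \<partial>lborel)"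
  proof (intro sum.cong refl)
    fix i
    have "(\<integral>\<^sup>+w. (\<integral>\<^sup>+v. ennreal (heat_kernel (real (Suc i) * r) (v - w)) * indicator (- F) v
          * killed_kernel F r (n - 1 - i) v z \<partial>lborel) \<partial>lborel)
       = (\<integral>\<^sup>+v. (\<integral>\<^sup>+w. ennreal (heat_kernel (real (Suc i) * r) (v - w)) * indicator (- F) v
          * killed_kernel F r (n - 1 - i) v z \<partial>lborel) \<partial>lborel)"
      by (rule lborel_pair.Fubini') simp
    also have "\<dots> = (\<integral>\<^sup>+v. (\<integral>\<^sup>+w. ennreal (heat_kernel (real (Suc i) * r) (w - v)) \<partial>lborel) * (indicator (- F) v
          * killed_kernel F r (n - 1 - i) v z) \<partial>lborel)"
    proof (intro nn_integral_cong)
      fix v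
      show "(\<integral>\<^sup>+w. ennreal (heat_kernel (real (Suc i) * r) (v - w)) * indicator (- F) v
          * killed_kernel F r (n - 1 - i) v z \<partial>lborel)
        = (\<integral>\<^sup>+w. ennreal (heat_kernel (real (Suc i) * r) (w - v)) \<partial>lborel) * (indicator (- F) v
          * killed_kernel F r (n - 1 - i) v z)"
        unfolding heat_kernel_commute[of _ v] mult.assoc
        by (rule nn_integral_multc) simp
    qed
    also have "\<dots> = (\<integral>\<^sup>+v. indicator (- F) v * killed_kernel F r (n - 1 - i) v z \<partial>lborel)"
    proof -
      have "real (Suc i) * r > 0" using r by simp
      show ?thesis unfolding nn_integral_heat_kernel_shift[OF \<open>real (Suc i) * r > 0\<close>] by simp
    qed
    finally show "(\<integral>\<^sup>+v. indicator (- F) v * killed_kernel F r (n - 1 - i) v z \<partial>lborel)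
       = (\<integral>\<^sup>+w. (\<integral>\<^sup>+v. ennreal (heat_kernel (real (Suc i) * r) (v - w)) * indicator (- F) v
          * killed_kernel F r (n - 1 - i) v z \<partial>lborel) \<partial>lborel)" ..
  qed
  also have "\<dots> = (\<integral>\<^sup>+w. (\<Sum>i<n. \<integral>\<^sup>+v. ennreal (heat_kernel (real (Suc i) * r) (v - w)) * indicator (- F) v
          * killed_kernel F r (n - 1 - i) v z \<partial>lborel) \<partial>lborel)"
    by (rule nn_integral_sum[symmetric]) simp
  also have "\<dots> \<le> (\<integral>\<^sup>+w. ennreal (heat_kernel (real (Suc n) * r) (w - z)) \<partial>lborel)"
  proof (intro nn_integral_mono)
    fix w
    show "(\<Sum>i<n. \<integral>\<^sup>+v. ennreal (heat_kernel (real (Suc i) * r) (v - w)) * indicator (- F) v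
          * killed_kernel F r (n - 1 - i) v z \<partial>lborel) \<le> ennreal (heat_kernel (real (Suc n) * r) (w - z))"
      unfolding heat_kernel_commute[of _ w z]
      using eq_le[OF heat_kernel_killed_decomposition[of n z w]] .
  qed
  also have "\<dots> = 1"
    using r by (intro nn_integral_heat_kernel_shift) simp
  finally show ?thesis .
qed

text \<open>Away from the complement of \<open>F\<close>, killing perturbs the heat kernel by a function whose
  Lipschitz constant depends neither on the time nor on the number of killing times.\<close>

lemma killed_kernel_oscillation:
  assumes rho: "\<rho> > 0"
    and w: "\<And>v. v \<notin> F \<Longrightarrow> \<rho> \<le> dist w v" "\<And>v. v \<notin> F \<Longrightarrow> \<rho> \<le> dist w' v"
  shows "\<bar>enn2real (killed_kernel F r n w z) - enn2real (killed_kernel F r n w' z)\<bar>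
     \<le> \<bar>heat_kernel (real (Suc n) * r) (z - w) - heat_kernel (real (Suc n) * r) (z - w')\<bar>
       + (2 / \<rho> * (1 / \<rho>) ^ DIM('a) * (exp 1 * fact (Suc DIM('a)))) * dist w w'"
proof -
  define c where "c = (2 / \<rho> * (1 / \<rho>) ^ DIM('a) * (exp 1 * fact (Suc DIM('a))))"
  have c0: "c \<ge> 0" using rho by (simp add: c_def)
  \<comment> \<open>The mass that killing removes from the free kernel. It is compared at two
    starting points under the integral sign: v lies outside F, hence at distance at least \<rho>
    from both, where the Gaussian is Lipschitz uniformly in time.\<close>
  define A where "A w = (\<Sum>i<n. \<integral>\<^sup>+v. ennreal (heat_kernel (real (Suc i) * r) (v - w)) * indicator (- F) v
          * killed_kernel F r (n - 1 - i) v z \<partial>lborel)" for w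
  have A_le: "A a \<le> A b + ennreal (c * dist a b)"
    if a: "\<And>v. v \<notin> F \<Longrightarrow> \<rho> \<le> dist a v" and b: "\<And>v. v \<notin> F \<Longrightarrow> \<rho> \<le> dist b v" for a b
  proof -
    have "A a \<le> (\<Sum>i<n. \<integral>\<^sup>+v. ennreal (heat_kernel (real (Suc i) * r) (v - b)) * indicator (- F) v
          * killed_kernel F r (n - 1 - i) v z
          + ennreal (c * dist a b) * (indicator (- F) v * killed_kernel F r (n - 1 - i) v z) \<partial>lborel)"
      unfolding A_def
    proof (intro sum_mono nn_integral_mono)
      fix i v
      have "ennreal (heat_kernel (real (Suc i) * r) (v - a))
         \<le> ennreal (heat_kernel (real (Suc i) * r) (v - b)) + ennreal (c * dist a b)" if v: "v \<notin> F"
      proof -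
        have "\<bar>heat_kernel (real (Suc i) * r) (v - a) - heat_kernel (real (Suc i) * r) (v - b)\<bar>
            \<le> c * norm (v - a - (v - b))"
          unfolding c_def using r rho a[OF v] b[OF v]
          by (intro heat_kernel_Lipschitz_away) (auto simp: dist_norm norm_minus_commute)
        also have "norm (v - a - (v - b)) = dist a b" by (simp add: dist_norm norm_minus_commute)
        finally have "heat_kernel (real (Suc i) * r) (v - a)
            \<le> heat_kernel (real (Suc i) * r) (v - b) + c * dist a b"
          by linarith
        from ennreal_leI[OF this] show ?thesis
          using c0 by (simp del: of_nat_Suc)
      qed
      note le = this
      show "ennreal (heat_kernel (real (Suc i) * r) (v - a)) * indicator (- F) v * killed_kernel F r (n - 1 - i) v z
        \<le> ennreal (heat_kernel (real (Suc i) * r) (v - b)) * indicator (- F) v * killed_kernel F r (n - 1 - i) v z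
          + ennreal (c * dist a b) * (indicator (- F) v * killed_kernel F r (n - 1 - i) v z)"
      proof (cases "v \<in> F")
        case False
        then show ?thesis
          using mult_right_mono[OF le, of "killed_kernel F r (n - 1 - i) v z"]
          by (simp add: distrib_right del: of_nat_Suc)
      qed simp
    qed
    also have "\<dots> = A b + ennreal (c * dist a b)
        * (\<Sum>i<n. \<integral>\<^sup>+v. indicator (- F) v * killed_kernel F r (n - 1 - i) v z \<partial>lborel)"
      unfolding A_def sum_distrib_left sum.distrib[symmetric]
      by (intro sum.cong refl) (subst nn_integral_add, auto simp: nn_integral_cmult simp del: of_nat_Suc)
    also have "\<dots> \<le> A b + ennreal (c * dist a b) * 1"
      by (intro add_left_mono mult_left_mono killed_mass_le) auto
    finally show ?thesis by simp
  qed
  have eq_le: "B \<le> X" if "X = C + B" for X B C :: ennreal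
    using that by simp
  have A_fin: "A a < \<infinity>" for a
  proof -
    have "A a \<le> ennreal (heat_kernel (real (Suc n) * r) (z - a))"
      using eq_le[OF heat_kernel_killed_decomposition[of n z a]] unfolding A_def .
    then show ?thesis
      unfolding infinity_ennreal_def by (rule le_less_trans[OF _ ennreal_less_top])
  qed
  have eq: "enn2real (killed_kernel F r n a z) = heat_kernel (real (Suc n) * r) (z - a) - enn2real (A a)" for a
  proof -
    have "heat_kernel (real (Suc n) * r) (z - a) = enn2real (ennreal (heat_kernel (real (Suc n) * r) (z - a)))"
      by (rule enn2real_ennreal[symmetric]) simp
    also have "ennreal (heat_kernel (real (Suc n) * r) (z - a)) = killed_kernel F r n a z + A a"
      unfolding A_def by (rule heat_kernel_killed_decomposition)
    also have "enn2real (killed_kernel F r n a z + A a) = enn2real (killed_kernel F r n a z) + enn2real (A a)"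
      using A_fin killed_kernel_finite by (intro enn2real_plus) auto
    finally show ?thesis by simp
  qed
  have real_le: "enn2real (A a) \<le> enn2real (A b) + c * dist a b"
    if "\<And>v. v \<notin> F \<Longrightarrow> \<rho> \<le> dist a v" "\<And>v. v \<notin> F \<Longrightarrow> \<rho> \<le> dist b v" for a b
  proof -
    have "enn2real (A a) \<le> enn2real (A b + ennreal (c * dist a b))"
      using A_le[OF that] A_fin[of b] by (intro enn2real_mono) auto
    also have "\<dots> = enn2real (A b) + c * dist a b"
      using A_fin[of b] c0 by (subst enn2real_plus) auto
    finally show ?thesis .
  qed
  show ?thesis
    using real_le[OF w] real_le[OF w(2) w(1)] unfolding eq c_def[symmetric] dist_commute[of w' w]
    by linarith
qed

end

section \<open>Chains of kernels\<close>

lemma integral_abs_le_nn_integral: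
  fixes f :: "'b \<Rightarrow> real"
  shows "ennreal \<bar>integral\<^sup>L M f\<bar> \<le> (\<integral>\<^sup>+x. ennreal \<bar>f x\<bar> \<partial>M)"
  using integral_norm_bound_ennreal[of M f]
  by (cases "integrable M f") (auto simp: not_integrable_integral_eq)

lemma (in finite_measure) integrable_of_bound:
  fixes f :: "'a \<Rightarrow> real"
  assumes "f \<in> borel_measurable M" "\<And>x. x \<in> space M \<Longrightarrow> \<bar>f x\<bar> \<le> B"
  shows "integrable M f"
  using assms by (intro integrable_const_bound[where B = B]) auto

text \<open>The dominating function is a multiple of the joint density of two successive Gaussian
  steps. This is the integrability behind the exchange of two consecutive space integrals.\<close>

lemma integrable_two_heat_kernels:
  fixes f :: "'a::euclidean_space \<times> 'a \<Rightarrow> real"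
  assumes [measurable]: "f \<in> borel_measurable (borel \<Otimes>\<^sub>M borel)" and r: "r > 0" "s > 0"
    and le: "\<And>v z. \<bar>f (v, z)\<bar> \<le> C * (heat_kernel r (v - y) * heat_kernel s (z - v))"
  shows "integrable (lborel \<Otimes>\<^sub>M lborel) f"
proof (rule integrableI_bounded)
  have "(\<integral>\<^sup>+u. ennreal (norm (f u)) \<partial>(lborel \<Otimes>\<^sub>M lborel))
     \<le> (\<integral>\<^sup>+u. ennreal \<bar>C\<bar> * (ennreal (heat_kernel r (fst u - y)) * ennreal (heat_kernel s (snd u - fst u))) \<partial>(lborel \<Otimes>\<^sub>M lborel))"
  proof (intro nn_integral_mono)
    fix u :: "'a \<times> 'a"
    have "norm (f u) \<le> C * (heat_kernel r (fst u - y) * heat_kernel s (snd u - fst u))"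
      using le[of "fst u" "snd u"] by simp
    also have "\<dots> \<le> \<bar>C\<bar> * (heat_kernel r (fst u - y) * heat_kernel s (snd u - fst u))"
      by (intro mult_right_mono) auto
    finally show "ennreal (norm (f u)) \<le> ennreal \<bar>C\<bar> * (ennreal (heat_kernel r (fst u - y)) * ennreal (heat_kernel s (snd u - fst u)))"
      by (simp add: ennreal_mult'[symmetric] ennreal_leI)
  qed
  also have "\<dots> = (\<integral>\<^sup>+v. (\<integral>\<^sup>+z. ennreal \<bar>C\<bar> * (ennreal (heat_kernel r (v - y)) * ennreal (heat_kernel s (z - v))) \<partial>lborel) \<partial>lborel)"
    by (subst lborel.nn_integral_fst[symmetric]) auto
  also have "\<dots> = (\<integral>\<^sup>+v. ennreal \<bar>C\<bar> * ennreal (heat_kernel r (v - y)) \<partial>lborel)"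
    using r by (intro nn_integral_cong) (simp add: nn_integral_cmult nn_integral_heat_kernel_shift)
  also have "\<dots> = ennreal \<bar>C\<bar>"
    using nn_integral_heat_kernel_shift[OF r(1), of y] by (simp add: nn_integral_cmult)
  finally show "(\<integral>\<^sup>+u. ennreal (norm (f u)) \<partial>(lborel \<Otimes>\<^sub>M lborel)) < \<infinity>"
    by (simp add: le_less_trans[OF _ ennreal_less_top])
qed measurable

text \<open>For transition kernels \<kappa> this is the expectation of the product of the Q (x l)
  along n consecutive positions of a path started in y, as a function of the space points. The index
  j lets the tail of a chain be a chain in the same family x.\<close>

fun chain :: "(nat \<Rightarrow> 'a \<Rightarrow> 'a::euclidean_space \<Rightarrow> real) \<Rightarrow> ('a \<Rightarrow> 'a \<Rightarrow> real)
    \<Rightarrow> nat \<Rightarrow> nat \<Rightarrow> 'a \<Rightarrow> (nat \<Rightarrow> 'a) \<Rightarrow> real" where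
  "chain \<kappa> Q 0 j y x = 1"
| "chain \<kappa> Q (Suc n) j y x = (LINT z|lborel. \<kappa> j y z * Q (x j) z * chain \<kappa> Q n (Suc j) z x)"

lemma chain_cong:
  "(\<And>l. l \<in> {j..<j + n} \<Longrightarrow> x l = x' l) \<Longrightarrow> chain \<kappa> Q n j y x = chain \<kappa> Q n j y x'"
proof (induction n arbitrary: j y)
  case (Suc n)
  have "chain \<kappa> Q n (Suc j) z x = chain \<kappa> Q n (Suc j) z x'" for z
    by (rule Suc.IH) (use Suc.prems in auto)
  then show ?case using Suc.prems[of j] by simp
qed simp

text \<open>Lebesgue measure on K, but carried by the whole space, so that its measurable sets are
  all Borel sets. In exchange, membership in K holds only almost everywhere.\<close>

definition on_set :: "'a::euclidean_space set \<Rightarrow> 'a measure" where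
  "on_set K = density lborel (indicator K)"

lemma sets_on_set [simp, measurable_cong]: "sets (on_set K) = sets borel"
  and space_on_set [simp]: "space (on_set K) = UNIV"
  by (simp_all add: on_set_def)

lemma nn_integral_on_set:
  assumes "K \<in> sets borel" "f \<in> borel_measurable borel"
  shows "(\<integral>\<^sup>+x. f x \<partial>on_set K) = (\<integral>\<^sup>+x. f x * indicator K x \<partial>lborel)"
  using assms unfolding on_set_def by (subst nn_integral_density) (auto simp: mult.commute)

lemma nn_integral_on_set_le:
  assumes "K \<in> sets borel" "f \<in> borel_measurable borel"
  shows "(\<integral>\<^sup>+x. f x \<partial>on_set K) \<le> (\<integral>\<^sup>+x. f x \<partial>lborel)"
  unfolding nn_integral_on_set[OF assms]
  by (intro nn_integral_mono) (auto split: split_indicator)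

lemma emeasure_on_set:
  assumes "K \<in> sets borel" "A \<in> sets borel"
  shows "emeasure (on_set K) A = emeasure lborel (K \<inter> A)"
  using assms unfolding on_set_def
  by (subst emeasure_density) (auto simp: indicator_inter_arith[symmetric])

lemma finite_measure_on_set:
  assumes "K \<in> sets borel" "emeasure lborel K < \<infinity>"
  shows "finite_measure (on_set K)"
  by standard (use assms in \<open>auto simp: emeasure_on_set\<close>)

text \<open>Q will be a ball density or the difference of two of them, hence the mass bound 2. The
  bound b serves integrability alone; it explodes for small radii and must not enter any final
  estimate.\<close>

locale mollifier =
  fixes Q :: "'a::euclidean_space \<Rightarrow> 'a \<Rightarrow> real" and b :: real and K :: "'a set" and p :: nat
  assumes Q_measurable [measurable]: "case_prod Q \<in> borel_measurable (borel \<Otimes>\<^sub>M borel)"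
    and Q_bound: "\<bar>Q x y\<bar> \<le> b"
    and Q_mass: "(\<integral>\<^sup>+y. ennreal \<bar>Q x y\<bar> \<partial>lborel) \<le> 2"
    and Q_mass': "(\<integral>\<^sup>+x. ennreal \<bar>Q x y\<bar> \<partial>lborel) \<le> 2"
    and K [measurable]: "K \<in> sets borel" and K_finite: "emeasure lborel K < \<infinity>"
    and p: "p \<ge> 1"
begin

lemma b_nonneg: "b \<ge> 0"
  using Q_bound[of undefined undefined] by linarith

sublocale KM: finite_measure "on_set K"
  by (rule finite_measure_on_set) (use K_finite in auto)

sublocale KP: product_sigma_finite "\<lambda>_::nat. on_set K"
  by standard

text \<open>Jensen's inequality for the measure \<open>\<bar>Q x z\<bar> dz\<close> removes \<open>Q\<close>; integrating out \<open>x\<close>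
  leaves only the \<open>p\<close>-th power of the heat kernel.\<close>

lemma chain_step:
  fixes v :: "'a \<Rightarrow> 'c \<Rightarrow> ennreal"
  assumes N: "sigma_finite_measure N"
    and v[measurable]: "case_prod v \<in> borel_measurable (borel \<Otimes>\<^sub>M N)"
    and k[measurable]: "k \<in> borel_measurable borel"
    and k_le: "(\<integral>\<^sup>+z. k z ^ p \<partial>lborel) \<le> A"
    and S: "\<And>z. (\<integral>\<^sup>+\<xi>. v z \<xi> ^ p \<partial>N) \<le> S"
  shows "(\<integral>\<^sup>+x. \<integral>\<^sup>+\<xi>. (\<integral>\<^sup>+z. k z * ennreal \<bar>Q x z\<bar> * v z \<xi> \<partial>lborel) ^ p \<partial>N \<partial>on_set K)
      \<le> 2 ^ p * A * S"
proof -
  interpret N: sigma_finite_measure N by fact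
  interpret LN: pair_sigma_finite lborel N by standard

  have "(\<integral>\<^sup>+x. \<integral>\<^sup>+\<xi>. (\<integral>\<^sup>+z. k z * ennreal \<bar>Q x z\<bar> * v z \<xi> \<partial>lborel) ^ p \<partial>N \<partial>on_set K)
     \<le> (\<integral>\<^sup>+x. \<integral>\<^sup>+\<xi>. 2 ^ (p - 1) * (\<integral>\<^sup>+z. ennreal \<bar>Q x z\<bar> * (k z * v z \<xi>) ^ p \<partial>lborel) \<partial>N \<partial>on_set K)"
  proof (intro nn_integral_mono)
    fix x \<xi> assume [simp]: "\<xi> \<in> space N"
    have "(\<integral>\<^sup>+z. k z * ennreal \<bar>Q x z\<bar> * v z \<xi> \<partial>lborel) = (\<integral>\<^sup>+z. ennreal \<bar>Q x z\<bar> * (k z * v z \<xi>) \<partial>lborel)"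
      by (simp add: mult_ac)
    also have "\<dots> ^ p \<le> (\<integral>\<^sup>+z. ennreal \<bar>Q x z\<bar> \<partial>lborel) ^ (p - 1)
         * (\<integral>\<^sup>+z. ennreal \<bar>Q x z\<bar> * (k z * v z \<xi>) ^ p \<partial>lborel)"
      by (rule nn_integral_mult_power_le) (use p in auto)
    also have "\<dots> \<le> 2 ^ (p - 1) * (\<integral>\<^sup>+z. ennreal \<bar>Q x z\<bar> * (k z * v z \<xi>) ^ p \<partial>lborel)"
      by (intro mult_right_mono power_mono Q_mass) auto
    finally show "(\<integral>\<^sup>+z. k z * ennreal \<bar>Q x z\<bar> * v z \<xi> \<partial>lborel) ^ p
      \<le> 2 ^ (p - 1) * (\<integral>\<^sup>+z. ennreal \<bar>Q x z\<bar> * (k z * v z \<xi>) ^ p \<partial>lborel)" .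
  qed
  also have "\<dots> \<le> (\<integral>\<^sup>+x. \<integral>\<^sup>+\<xi>. 2 ^ (p - 1) * (\<integral>\<^sup>+z. ennreal \<bar>Q x z\<bar> * (k z * v z \<xi>) ^ p \<partial>lborel) \<partial>N \<partial>lborel)"
    by (rule nn_integral_on_set_le) auto
  also have "\<dots> = (\<integral>\<^sup>+x. 2 ^ (p - 1) * (\<integral>\<^sup>+z. ennreal \<bar>Q x z\<bar> * (k z ^ p * (\<integral>\<^sup>+\<xi>. v z \<xi> ^ p \<partial>N)) \<partial>lborel) \<partial>lborel)"
  proof (intro nn_integral_cong)
    fix x :: 'a
    have "(\<integral>\<^sup>+\<xi>. 2 ^ (p - 1) * (\<integral>\<^sup>+z. ennreal \<bar>Q x z\<bar> * (k z * v z \<xi>) ^ p \<partial>lborel) \<partial>N)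
      = 2 ^ (p - 1) * (\<integral>\<^sup>+\<xi>. (\<integral>\<^sup>+z. ennreal \<bar>Q x z\<bar> * (k z * v z \<xi>) ^ p \<partial>lborel) \<partial>N)"
      by (rule nn_integral_cmult) measurable
    also have "(\<integral>\<^sup>+\<xi>. (\<integral>\<^sup>+z. ennreal \<bar>Q x z\<bar> * (k z * v z \<xi>) ^ p \<partial>lborel) \<partial>N)
       = (\<integral>\<^sup>+z. (\<integral>\<^sup>+\<xi>. ennreal \<bar>Q x z\<bar> * (k z * v z \<xi>) ^ p \<partial>N) \<partial>lborel)"
      by (rule LN.Fubini') measurable
    also have "\<dots> = (\<integral>\<^sup>+z. ennreal \<bar>Q x z\<bar> * (k z ^ p * (\<integral>\<^sup>+\<xi>. v z \<xi> ^ p \<partial>N)) \<partial>lborel)"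
      by (intro nn_integral_cong)
        (simp add: power_mult_distrib nn_integral_cmult mult.assoc[symmetric])
    finally show "(\<integral>\<^sup>+\<xi>. 2 ^ (p - 1) * (\<integral>\<^sup>+z. ennreal \<bar>Q x z\<bar> * (k z * v z \<xi>) ^ p \<partial>lborel) \<partial>N)
      = 2 ^ (p - 1) * (\<integral>\<^sup>+z. ennreal \<bar>Q x z\<bar> * (k z ^ p * (\<integral>\<^sup>+\<xi>. v z \<xi> ^ p \<partial>N)) \<partial>lborel)" .
  qed
  also have "\<dots> \<le> (\<integral>\<^sup>+x. 2 ^ (p - 1) * (\<integral>\<^sup>+z. ennreal \<bar>Q x z\<bar> * (k z ^ p * S) \<partial>lborel) \<partial>lborel)"
    by (intro nn_integral_mono mult_left_mono S) auto
  also have "\<dots> = 2 ^ (p - 1) * (\<integral>\<^sup>+x. (\<integral>\<^sup>+z. ennreal \<bar>Q x z\<bar> * (k z ^ p * S) \<partial>lborel) \<partial>lborel)"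
    by (rule nn_integral_cmult) measurable
  also have "(\<integral>\<^sup>+x. (\<integral>\<^sup>+z. ennreal \<bar>Q x z\<bar> * (k z ^ p * S) \<partial>lborel) \<partial>lborel)
      = (\<integral>\<^sup>+z. (\<integral>\<^sup>+x. ennreal \<bar>Q x z\<bar> * (k z ^ p * S) \<partial>lborel) \<partial>lborel)"
    by (rule lborel_pair.Fubini') measurable
  also have "\<dots> = (\<integral>\<^sup>+z. (\<integral>\<^sup>+x. ennreal \<bar>Q x z\<bar> \<partial>lborel) * (k z ^ p * S) \<partial>lborel)"
    by (intro nn_integral_cong nn_integral_multc) measurable
  also have "\<dots> \<le> (\<integral>\<^sup>+z. 2 * (k z ^ p * S) \<partial>lborel)"
    by (intro nn_integral_mono mult_right_mono Q_mass') auto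
  also have "\<dots> = 2 * ((\<integral>\<^sup>+z. k z ^ p \<partial>lborel) * S)"
    by (simp add: nn_integral_cmult nn_integral_multc)
  also have "2 ^ (p - 1) * (2 * ((\<integral>\<^sup>+z. k z ^ p \<partial>lborel) * S)) \<le> 2 ^ (p - 1) * (2 * (A * S))"
    by (intro mult_left_mono mult_right_mono k_le) auto
  \<comment> \<open>Jensen's inequality contributes p - 1 factors 2, and integrating out x
    contributes the last one.\<close>
  also have "\<dots> = 2 ^ p * A * S"
    using p by (cases p) (auto simp: mult_ac)
  finally show ?thesis by (simp add: mult_left_mono)
qed

end

text \<open>G j bounds the L^p norm of the heat kernel at time r j, uniformly in the starting point.
  As an extended number it may be \<infinity>, which is enough where only measurability is
  wanted.\<close>

locale kernel_chain = mollifier Q b K p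
  for Q :: "'a::euclidean_space \<Rightarrow> 'a \<Rightarrow> real" and b :: real and K :: "'a set" and p :: nat +
  fixes \<kappa> :: "nat \<Rightarrow> 'a \<Rightarrow> 'a \<Rightarrow> real" and r :: "nat \<Rightarrow> real" and G :: "nat \<Rightarrow> ennreal"
  assumes \<kappa>_measurable [measurable]: "\<And>j. case_prod (\<kappa> j) \<in> borel_measurable (borel \<Otimes>\<^sub>M borel)"
    and r_pos: "\<And>j. r j > 0"
    and \<kappa>_nonneg: "\<And>j y z. 0 \<le> \<kappa> j y z"
    and \<kappa>_le: "\<And>j y z. \<kappa> j y z \<le> heat_kernel (r j) (z - y)"
    and heat_le: "\<And>j (y::'a). (\<integral>\<^sup>+z. ennreal (heat_kernel (r j) (z - y)) ^ p \<partial>lborel) \<le> G j ^ p"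
begin

lemma chain_measurable:
  "{j..<j + n} \<subseteq> I \<Longrightarrow>
    (\<lambda>u. chain \<kappa> Q n j (fst u) (snd u)) \<in> borel_measurable (borel \<Otimes>\<^sub>M PiM I (\<lambda>_. on_set K))"
proof (induction n arbitrary: j)
  case (Suc n)
  have "j \<in> I" "{Suc j..<Suc j + n} \<subseteq> I" using Suc.prems by auto
  have IH: "case_prod (chain \<kappa> Q n (Suc j)) \<in> borel_measurable (borel \<Otimes>\<^sub>M PiM I (\<lambda>_. on_set K))"
    using Suc.IH[OF \<open>{Suc j..<Suc j + n} \<subseteq> I\<close>] by (simp add: case_prod_beta')
  note [measurable] = IH
  have [measurable]: "(\<lambda>x. x j) \<in> borel_measurable (PiM I (\<lambda>_. on_set K))"
    using measurable_component_singleton[OF \<open>j \<in> I\<close>, of "\<lambda>_. on_set K"]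
    by (subst (asm) measurable_cong_sets[OF refl sets_on_set])
  show ?case unfolding chain.simps by measurable
qed simp

lemma chain_measurable' [measurable (raw)]:
  assumes "f \<in> borel_measurable N" "g \<in> measurable N (PiM I (\<lambda>_. on_set K))" "{j..<j + n} \<subseteq> I"
  shows "(\<lambda>x. chain \<kappa> Q n j (f x) (g x)) \<in> borel_measurable N"
  using measurable_compose[OF measurable_Pair[OF assms(1,2)] chain_measurable[OF assms(3)]] by simp

lemma chain_bounded: "\<bar>chain \<kappa> Q n j y x\<bar> \<le> b ^ n"
proof (induction n arbitrary: j y)
  case (Suc n)
  have "ennreal \<bar>chain \<kappa> Q (Suc n) j y x\<bar> \<le> (\<integral>\<^sup>+z. ennreal \<bar>\<kappa> j y z * Q (x j) z * chain \<kappa> Q n (Suc j) z x\<bar> \<partial>lborel)"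
    unfolding chain.simps by (rule integral_abs_le_nn_integral)
  also have "\<dots> \<le> (\<integral>\<^sup>+z. ennreal (b ^ Suc n) * ennreal (heat_kernel (r j) (z - y)) \<partial>lborel)"
  proof (intro nn_integral_mono)
    fix z
    have "\<bar>\<kappa> j y z * Q (x j) z * chain \<kappa> Q n (Suc j) z x\<bar> = \<kappa> j y z * (\<bar>Q (x j) z\<bar> * \<bar>chain \<kappa> Q n (Suc j) z x\<bar>)"
      using \<kappa>_nonneg[of j y z] by (simp add: abs_mult)
    also have "\<dots> \<le> heat_kernel (r j) (z - y) * (b * b ^ n)"
      using b_nonneg by (intro mult_mono \<kappa>_le Q_bound Suc) auto
    finally show "ennreal \<bar>\<kappa> j y z * Q (x j) z * chain \<kappa> Q n (Suc j) z x\<bar>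
      \<le> ennreal (b ^ Suc n) * ennreal (heat_kernel (r j) (z - y))"
      using b_nonneg by (simp add: ennreal_mult'[symmetric] mult.commute ennreal_leI)
  qed
  also have "\<dots> = ennreal (b ^ Suc n)"
    using nn_integral_heat_kernel_shift[OF r_pos[of j], of y] by (simp add: nn_integral_cmult)
  finally show ?case
    using b_nonneg by simp
qed simp

text \<open>The bound for the tail is uniform in its starting point, which is exactly the input that
  \<open>chain_step\<close> asks for in order to integrate out the first link.\<close>

lemma chain_abs_bound:
  "(\<integral>\<^sup>+x. ennreal \<bar>chain \<kappa> Q n j y x\<bar> ^ p \<partial>PiM {j..<j + n} (\<lambda>_. on_set K))
     \<le> (\<Prod>l\<in>{j..<j + n}. 2 * G l) ^ p"
proof (induction n arbitrary: j y)
  case 0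
  then show ?case by (simp add: KP.nn_integral_empty del: nn_integral_const)
next
  case (Suc n)
  let ?N = "PiM {Suc j..<Suc j + n} (\<lambda>_. on_set K)"
  have I: "{j..<j + Suc n} = insert j {Suc j..<Suc j + n}" by auto
  have "(\<lambda>x. chain \<kappa> Q (Suc n) j y x) \<in> borel_measurable (PiM (insert j {Suc j..<Suc j + n}) (\<lambda>_. on_set K))"
    by (rule chain_measurable'[where I = "insert j {Suc j..<Suc j + n}"]) auto
  then have m: "(\<lambda>x. ennreal \<bar>chain \<kappa> Q (Suc n) j y x\<bar> ^ p)
      \<in> borel_measurable (PiM (insert j {Suc j..<Suc j + n}) (\<lambda>_. on_set K))"
    by (intro borel_measurable_power_ennreal measurable_compose[OF _ measurable_ennreal] borel_measurable_abs)
  have [measurable]: "case_prod (\<lambda>z x. ennreal \<bar>chain \<kappa> Q n (Suc j) z x\<bar>) \<in> borel_measurable (borel \<Otimes>\<^sub>M ?N)"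
    using chain_measurable[of "Suc j" n "{Suc j..<Suc j + n}"] by (simp add: case_prod_beta')
  have "(\<integral>\<^sup>+x. ennreal \<bar>chain \<kappa> Q (Suc n) j y x\<bar> ^ p \<partial>PiM {j..<j + Suc n} (\<lambda>_. on_set K))
    = (\<integral>\<^sup>+a. \<integral>\<^sup>+x. ennreal \<bar>chain \<kappa> Q (Suc n) j y (x(j := a))\<bar> ^ p \<partial>?N \<partial>on_set K)"
    unfolding I by (rule KP.product_nn_integral_insert_rev[OF _ _ m]) auto
  also have "\<dots> \<le> (\<integral>\<^sup>+a. \<integral>\<^sup>+x. (\<integral>\<^sup>+z. ennreal (heat_kernel (r j) (z - y)) * ennreal \<bar>Q a z\<bar>
       * ennreal \<bar>chain \<kappa> Q n (Suc j) z x\<bar> \<partial>lborel) ^ p \<partial>?N \<partial>on_set K)"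
  proof (intro nn_integral_mono power_mono)
    fix a x
    have "chain \<kappa> Q n (Suc j) z (x(j := a)) = chain \<kappa> Q n (Suc j) z x" for z
      by (rule chain_cong) auto
    then have "ennreal \<bar>chain \<kappa> Q (Suc n) j y (x(j := a))\<bar>
      \<le> (\<integral>\<^sup>+z. ennreal \<bar>\<kappa> j y z * Q a z * chain \<kappa> Q n (Suc j) z x\<bar> \<partial>lborel)"
      using integral_abs_le_nn_integral[of lborel "\<lambda>z. \<kappa> j y z * Q a z * chain \<kappa> Q n (Suc j) z x"] by simp
    also have "\<dots> \<le> (\<integral>\<^sup>+z. ennreal (heat_kernel (r j) (z - y)) * ennreal \<bar>Q a z\<bar>
       * ennreal \<bar>chain \<kappa> Q n (Suc j) z x\<bar> \<partial>lborel)"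
      using \<kappa>_nonneg \<kappa>_le
      by (intro nn_integral_mono) (auto simp: abs_mult ennreal_mult'[symmetric] intro!: ennreal_leI mult_right_mono)
    finally show "ennreal \<bar>chain \<kappa> Q (Suc n) j y (x(j := a))\<bar>
      \<le> (\<integral>\<^sup>+z. ennreal (heat_kernel (r j) (z - y)) * ennreal \<bar>Q a z\<bar>
       * ennreal \<bar>chain \<kappa> Q n (Suc j) z x\<bar> \<partial>lborel)" .
  qed auto
  also have "\<dots> \<le> 2 ^ p * G j ^ p * (\<Prod>l\<in>{Suc j..<Suc j + n}. 2 * G l) ^ p"
  proof (rule chain_step[where N = ?N and k = "\<lambda>z. ennreal (heat_kernel (r j) (z - y))"
          and v = "\<lambda>z x. ennreal \<bar>chain \<kappa> Q n (Suc j) z x\<bar>"])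
    show "sigma_finite_measure ?N" by (rule KP.sigma_finite) simp
    show "(\<integral>\<^sup>+z. ennreal (heat_kernel (r j) (z - y)) ^ p \<partial>lborel) \<le> G j ^ p" by (rule heat_le)
    show "(\<integral>\<^sup>+x. ennreal \<bar>chain \<kappa> Q n (Suc j) z x\<bar> ^ p \<partial>?N) \<le> (\<Prod>l\<in>{Suc j..<Suc j + n}. 2 * G l) ^ p" for z
      by (rule Suc.IH)
  qed measurable
  also have "\<dots> = (\<Prod>l\<in>{j..<j + Suc n}. 2 * G l) ^ p"
    unfolding I by (subst prod.insert) (auto simp: power_mult_distrib)
  finally show ?case .
qed

end

text \<open>Gaps fall into two regimes. Below h the heat kernel gains a factor \<Lambda> in L^p;
  from h on the kernel is bounded by c and varies by at most \<eta> over \<epsilon>-balls around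
  points of K, in either argument. The last assumption makes the second regime as good as the first:
  a block of two long gaps is bounded pointwise and integrated over two points of K, whence the
  squared volume.\<close>

locale cancelling_chain = kernel_chain Q b K p \<kappa> r G
  for Q :: "'a::euclidean_space \<Rightarrow> 'a \<Rightarrow> real" and b K p \<kappa> r G +
  fixes \<epsilon> h c \<eta> :: real and \<Lambda> :: ennreal
  assumes Q_support: "\<And>x y. y \<notin> ball x \<epsilon> \<Longrightarrow> Q x y = 0"
    and Q_integral: "\<And>x. (LINT y|lborel. Q x y) = 0"
    and G_ge_1: "\<And>j. 1 \<le> G j"
    and small_gap: "\<And>j (y::'a). r j < h \<Longrightarrow> (\<integral>\<^sup>+z. ennreal (heat_kernel (r j) (z - y)) ^ p \<partial>lborel) \<le> (\<Lambda> * G j) ^ p"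
    and bound_gap: "\<And>j y z. h \<le> r j \<Longrightarrow> \<kappa> j y z \<le> c"
    and osc_left: "\<And>j x w z. h \<le> r j \<Longrightarrow> x \<in> K \<Longrightarrow> w \<in> ball x \<epsilon> \<Longrightarrow> \<bar>\<kappa> j w z - \<kappa> j x z\<bar> \<le> \<eta>"
    and osc_right: "\<And>j x w y. h \<le> r j \<Longrightarrow> x \<in> K \<Longrightarrow> w \<in> ball x \<epsilon> \<Longrightarrow> \<bar>\<kappa> j y w - \<kappa> j y x\<bar> \<le> \<eta>"
    and c_nonneg: "0 \<le> c" and \<eta>_nonneg: "0 \<le> \<eta>"
    and \<Lambda>: "emeasure lborel K ^ 2 * ennreal (2 * c * \<eta>) ^ p \<le> \<Lambda> ^ p"
begin

lemma Q_integrable: "integrable lborel (Q x)"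
  by (rule integrableI_bounded) (use Q_mass[of x] in \<open>auto simp: less_top[symmetric] top_unique\<close>)

lemma bounded_mult_Q_integrable:
  assumes [measurable]: "f \<in> borel_measurable borel" and f: "\<And>w. \<bar>f w\<bar> \<le> B"
  shows "integrable lborel (\<lambda>w. f w * Q x w)"
proof (rule Bochner_Integration.integrable_bound)
  show "integrable lborel (\<lambda>w. B * Q x w)" using Q_integrable by simp
  have "\<bar>f w * Q x w\<bar> \<le> \<bar>B * Q x w\<bar>" for w
    using f[of w] by (auto simp: abs_mult intro!: mult_right_mono)
  then show "AE w in lborel. norm (f w * Q x w) \<le> norm (B * Q x w)" by simp
qed measurable

text \<open>Since Q x has integral 0, the value at x of the product of the two kernels may be
  subtracted. That product varies by at most 2 c \<eta> on the ball, and Q x has mass at most 2.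
  Both kernels depend on w, which is why both gaps must be long.\<close>

lemma cancellation:
  assumes "h \<le> r i" "h \<le> r j" "x \<in> K"
  shows "\<bar>LINT w|lborel. \<kappa> i y w * Q x w * \<kappa> j w z\<bar> \<le> 4 * c * \<eta>"
proof -
  define F where "F w = \<kappa> i y w * \<kappa> j w z" for w
  have [measurable]: "F \<in> borel_measurable borel" unfolding F_def by measurable
  have F_bound: "\<bar>F w\<bar> \<le> c * c" for w
    unfolding F_def abs_mult using \<kappa>_nonneg assms bound_gap c_nonneg by (intro mult_mono) auto
  have osc: "\<bar>F w - F x\<bar> \<le> 2 * c * \<eta>" if "w \<in> ball x \<epsilon>" for w
  proof -
    have "F w - F x = (\<kappa> i y w - \<kappa> i y x) * \<kappa> j w z + \<kappa> i y x * (\<kappa> j w z - \<kappa> j x z)"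
      by (simp add: F_def algebra_simps)
    also have "\<bar>\<dots>\<bar> \<le> \<bar>\<kappa> i y w - \<kappa> i y x\<bar> * \<kappa> j w z + \<kappa> i y x * \<bar>\<kappa> j w z - \<kappa> j x z\<bar>"
      using abs_triangle_ineq \<kappa>_nonneg by (metis abs_mult abs_of_nonneg)
    also have "\<dots> \<le> \<eta> * c + c * \<eta>"
      using that assms \<kappa>_nonneg bound_gap c_nonneg \<eta>_nonneg
      by (intro add_mono mult_mono osc_left osc_right) auto
    finally show ?thesis by (simp add: mult_ac)
  qed
  have int1: "integrable lborel (\<lambda>w. F w * Q x w)"
    by (rule bounded_mult_Q_integrable[OF _ F_bound]) measurable
  have "(LINT w|lborel. \<kappa> i y w * Q x w * \<kappa> j w z) = (LINT w|lborel. F w * Q x w)"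
    by (simp add: F_def mult_ac)
  also have "\<dots> = (LINT w|lborel. F w * Q x w) - (LINT w|lborel. F x * Q x w)"
    using Q_integral by simp
  also have "\<dots> = (LINT w|lborel. F w * Q x w - F x * Q x w)"
    using int1 Q_integrable by (subst Bochner_Integration.integral_diff) auto
  finally have "ennreal \<bar>LINT w|lborel. \<kappa> i y w * Q x w * \<kappa> j w z\<bar>
     \<le> (\<integral>\<^sup>+w. ennreal \<bar>F w * Q x w - F x * Q x w\<bar> \<partial>lborel)"
    using integral_abs_le_nn_integral by simp
  also have "\<dots> \<le> (\<integral>\<^sup>+w. ennreal (2 * c * \<eta>) * ennreal \<bar>Q x w\<bar> \<partial>lborel)"
  proof (intro nn_integral_mono)
    fix w
    have "\<bar>F w * Q x w - F x * Q x w\<bar> = \<bar>F w - F x\<bar> * \<bar>Q x w\<bar>"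
      by (simp add: left_diff_distrib[symmetric] abs_mult)
    also have "\<dots> \<le> (2 * c * \<eta>) * \<bar>Q x w\<bar>"
      using osc[of w] Q_support[of w x] by (cases "w \<in> ball x \<epsilon>") (auto intro!: mult_right_mono)
    finally show "ennreal \<bar>F w * Q x w - F x * Q x w\<bar> \<le> ennreal (2 * c * \<eta>) * ennreal \<bar>Q x w\<bar>"
      using c_nonneg \<eta>_nonneg by (simp add: ennreal_mult'[symmetric] ennreal_leI)
  qed
  also have "\<dots> \<le> ennreal (2 * c * \<eta>) * 2"
    by (subst nn_integral_cmult) (auto intro!: mult_left_mono Q_mass)
  also have "\<dots> = ennreal (4 * c * \<eta>)"
    using c_nonneg \<eta>_nonneg by (simp flip: ennreal_numeral ennreal_mult add: mult_ac)
  finally show ?thesis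
    using c_nonneg \<eta>_nonneg by (subst (asm) ennreal_le_iff) auto
qed

text \<open>If one of the two gaps is short, its heat kernel has a small \<open>L\<^sup>p\<close> norm and no
  cancellation is needed; otherwise \<open>Q\<close> acts on a function that hardly oscillates.\<close>

lemma chain_block:
  assumes S: "\<And>z. (\<integral>\<^sup>+x. ennreal \<bar>chain \<kappa> Q n (j + 2) z x\<bar> ^ p \<partial>PiM {j + 2..<j + 2 + n} (\<lambda>_. on_set K)) \<le> S ^ p"
  shows "(\<integral>\<^sup>+x. ennreal \<bar>chain \<kappa> Q (Suc (Suc n)) j y x\<bar> ^ p \<partial>PiM {j..<j + Suc (Suc n)} (\<lambda>_. on_set K))
     \<le> (\<Lambda> * (2 * G j) * (2 * G (Suc j)) * S) ^ p"
proof -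
  let ?J = "{j + 2..<j + 2 + n}"
  let ?N = "PiM ?J (\<lambda>_. on_set K)"
  interpret N: sigma_finite_measure ?N by (rule KP.sigma_finite) simp
  interpret KN: pair_sigma_finite "on_set K" ?N by standard
  interpret LN: pair_sigma_finite lborel ?N by standard
  define v where "v z x = chain \<kappa> Q n (j + 2) z x" for z x
  have v[measurable]: "case_prod v \<in> borel_measurable (borel \<Otimes>\<^sub>M ?N)"
    using chain_measurable[of "j + 2" n ?J] by (simp add: case_prod_beta' v_def)
  have v_bound: "\<bar>v z x\<bar> \<le> b ^ n" for z x unfolding v_def by (rule chain_bounded)
  have I: "{j..<j + Suc (Suc n)} = insert j (insert (Suc j) ?J)" by auto
  have "(\<lambda>x. chain \<kappa> Q (Suc (Suc n)) j y x) \<in> borel_measurable (PiM (insert j (insert (Suc j) ?J)) (\<lambda>_. on_set K))"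
    by (rule chain_measurable'[where I = "insert j (insert (Suc j) ?J)"]) auto
  then have m: "(\<lambda>x. ennreal \<bar>chain \<kappa> Q (Suc (Suc n)) j y x\<bar> ^ p)
      \<in> borel_measurable (PiM (insert j (insert (Suc j) ?J)) (\<lambda>_. on_set K))"
    by (intro borel_measurable_power_ennreal measurable_compose[OF _ measurable_ennreal] borel_measurable_abs)
  define V where "V a a' x = (LINT w|lborel. \<kappa> j y w * Q a w * (LINT z|lborel. \<kappa> (Suc j) w z * Q a' z * v z x))" for a a' x
  have V: "chain \<kappa> Q (Suc (Suc n)) j y (x(Suc j := a', j := a)) = V a a' x" for a a' x
  proof -
    have "chain \<kappa> Q n (Suc (Suc j)) z (x(Suc j := a', j := a)) = v z x" for z
      unfolding v_def by (subst chain_cong[where x' = x]) auto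
    then show ?thesis by (simp add: V_def)
  qed
  have "(\<integral>\<^sup>+x. ennreal \<bar>chain \<kappa> Q (Suc (Suc n)) j y x\<bar> ^ p \<partial>PiM {j..<j + Suc (Suc n)} (\<lambda>_. on_set K))
    = (\<integral>\<^sup>+a. \<integral>\<^sup>+x. ennreal \<bar>chain \<kappa> Q (Suc (Suc n)) j y (x(j := a))\<bar> ^ p \<partial>PiM (insert (Suc j) ?J) (\<lambda>_. on_set K) \<partial>on_set K)"
    unfolding I by (rule KP.product_nn_integral_insert_rev[OF _ _ m]) auto
  also have "\<dots> = (\<integral>\<^sup>+a. \<integral>\<^sup>+a'. \<integral>\<^sup>+x. ennreal \<bar>V a a' x\<bar> ^ p \<partial>?N \<partial>on_set K \<partial>on_set K)"
  proof (intro nn_integral_cong)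
    fix a :: 'a
    have upd: "(\<lambda>x. x(j := a)) \<in> measurable (PiM (insert (Suc j) ?J) (\<lambda>_. on_set K)) (PiM (insert j (insert (Suc j) ?J)) (\<lambda>_. on_set K))"
      by (rule measurable_fun_upd) (auto intro!: measurable_const)
    show "(\<integral>\<^sup>+x. ennreal \<bar>chain \<kappa> Q (Suc (Suc n)) j y (x(j := a))\<bar> ^ p \<partial>PiM (insert (Suc j) ?J) (\<lambda>_. on_set K))
      = (\<integral>\<^sup>+a'. \<integral>\<^sup>+x. ennreal \<bar>V a a' x\<bar> ^ p \<partial>?N \<partial>on_set K)"
      unfolding V[symmetric]
      by (rule KP.product_nn_integral_insert_rev[OF _ _ measurable_compose[OF upd m]]) auto
  qed
  also have "\<dots> \<le> (\<Lambda> * (2 * G j) * (2 * G (Suc j)) * S) ^ p"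
  proof (cases "h \<le> r j \<and> h \<le> r (Suc j)")
    case True
    define e where "e = 4 * c * \<eta>"
    have e0: "e \<ge> 0" using c_nonneg \<eta>_nonneg by (simp add: e_def)
    \<comment> \<open>The integral over the first position w is moved inside, so that Q a acts on
      the product of the two kernels adjacent to w.\<close>
    have swap: "V a a' x = (LINT z|lborel. (LINT w|lborel. \<kappa> j y w * Q a w * \<kappa> (Suc j) w z) * Q a' z * v z x)"
      if "x \<in> space ?N" for a a' x
    proof -
      have [measurable]: "(\<lambda>z. v z x) \<in> borel_measurable borel"
        using that by measurable
      let ?f = "\<lambda>z w. \<kappa> j y w * Q a w * (\<kappa> (Suc j) w z * Q a' z * v z x)"
      have "integrable (lborel \<Otimes>\<^sub>M lborel) (\<lambda>(w, z). ?f z w)"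
      proof (rule integrable_two_heat_kernels[OF _ r_pos r_pos])
        fix w z
        have "\<bar>?f z w\<bar> = (\<bar>Q a w\<bar> * (\<bar>Q a' z\<bar> * \<bar>v z x\<bar>)) * (\<kappa> j y w * \<kappa> (Suc j) w z)"
          using \<kappa>_nonneg by (simp add: abs_mult)
        also have "\<dots> \<le> (b * (b * b ^ n)) * (heat_kernel (r j) (w - y) * heat_kernel (r (Suc j)) (z - w))"
          using \<kappa>_nonneg b_nonneg by (intro mult_mono \<kappa>_le Q_bound v_bound) auto
        finally show "\<bar>(case (w, z) of (w, z) \<Rightarrow> ?f z w)\<bar>
            \<le> (b * (b * b ^ n)) * (heat_kernel (r j) (w - y) * heat_kernel (r (Suc j)) (z - w))" by simp
      qed measurable
      note int = this
      have "V a a' x = (LINT w|lborel. LINT z|lborel. ?f z w)"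
        by (simp add: V_def)
      also have "\<dots> = (LINT z|lborel. LINT w|lborel. ?f z w)"
        by (rule lborel_pair.Fubini_integral[symmetric]) (rule int)
      also have "\<dots> = (LINT z|lborel. LINT w|lborel. (\<kappa> j y w * Q a w * \<kappa> (Suc j) w z) * (Q a' z * v z x))"
        by (simp add: mult.assoc)
      also have "\<dots> = (LINT z|lborel. (LINT w|lborel. \<kappa> j y w * Q a w * \<kappa> (Suc j) w z) * Q a' z * v z x)"
        by (subst integral_mult_left_zero) (simp add: mult.assoc)
      finally show ?thesis .
    qed
    have V_le: "ennreal \<bar>V a a' x\<bar> ^ p \<le> ennreal e ^ p * (2 ^ (p - 1) * (\<integral>\<^sup>+z. ennreal \<bar>Q a' z\<bar> * ennreal \<bar>v z x\<bar> ^ p \<partial>lborel))"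
      if "a \<in> K" and x: "x \<in> space ?N" for a a' x
    proof -
      have [measurable]: "(\<lambda>z. v z x) \<in> borel_measurable borel"
        using that by measurable
      have "ennreal \<bar>V a a' x\<bar> \<le> (\<integral>\<^sup>+z. ennreal \<bar>(LINT w|lborel. \<kappa> j y w * Q a w * \<kappa> (Suc j) w z) * Q a' z * v z x\<bar> \<partial>lborel)"
        unfolding swap[OF x] by (rule integral_abs_le_nn_integral)
      also have "\<dots> \<le> (\<integral>\<^sup>+z. ennreal e * (ennreal \<bar>Q a' z\<bar> * ennreal \<bar>v z x\<bar>) \<partial>lborel)"
      proof (intro nn_integral_mono)
        fix z
        have "\<bar>(LINT w|lborel. \<kappa> j y w * Q a w * \<kappa> (Suc j) w z) * Q a' z * v z x\<bar> \<le> e * (\<bar>Q a' z\<bar> * \<bar>v z x\<bar>)"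
          unfolding abs_mult e_def mult.assoc[of "\<bar>integral\<^sup>L _ _\<bar>"]
          using True \<open>a \<in> K\<close> by (intro mult_right_mono cancellation) auto
        then show "ennreal \<bar>(LINT w|lborel. \<kappa> j y w * Q a w * \<kappa> (Suc j) w z) * Q a' z * v z x\<bar>
            \<le> ennreal e * (ennreal \<bar>Q a' z\<bar> * ennreal \<bar>v z x\<bar>)"
          using e0 by (simp add: ennreal_mult'[symmetric] ennreal_leI)
      qed
      also have "\<dots> = ennreal e * (\<integral>\<^sup>+z. ennreal \<bar>Q a' z\<bar> * ennreal \<bar>v z x\<bar> \<partial>lborel)"
        by (rule nn_integral_cmult) measurable
      finally have "ennreal \<bar>V a a' x\<bar> ^ p \<le> (ennreal e * (\<integral>\<^sup>+z. ennreal \<bar>Q a' z\<bar> * ennreal \<bar>v z x\<bar> \<partial>lborel)) ^ p"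
        by (intro power_mono) auto
      also have "\<dots> \<le> ennreal e ^ p * ((\<integral>\<^sup>+z. ennreal \<bar>Q a' z\<bar> \<partial>lborel) ^ (p - 1) * (\<integral>\<^sup>+z. ennreal \<bar>Q a' z\<bar> * ennreal \<bar>v z x\<bar> ^ p \<partial>lborel))"
        unfolding power_mult_distrib using p by (intro mult_left_mono nn_integral_mult_power_le) auto
      also have "\<dots> \<le> ennreal e ^ p * (2 ^ (p - 1) * (\<integral>\<^sup>+z. ennreal \<bar>Q a' z\<bar> * ennreal \<bar>v z x\<bar> ^ p \<partial>lborel))"
        by (intro mult_left_mono mult_right_mono power_mono Q_mass) auto
      finally show ?thesis .
    qed
    have inner: "(\<integral>\<^sup>+x. ennreal \<bar>V a a' x\<bar> ^ p \<partial>?N) \<le> ennreal e ^ p * (2 ^ p * S ^ p)" if "a \<in> K" for a a'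
    proof -
      have "(\<integral>\<^sup>+x. ennreal \<bar>V a a' x\<bar> ^ p \<partial>?N)
        \<le> (\<integral>\<^sup>+x. ennreal e ^ p * (2 ^ (p - 1) * (\<integral>\<^sup>+z. ennreal \<bar>Q a' z\<bar> * ennreal \<bar>v z x\<bar> ^ p \<partial>lborel)) \<partial>?N)"
        by (intro nn_integral_mono V_le that)
      also have "\<dots> = ennreal e ^ p * (2 ^ (p - 1) * (\<integral>\<^sup>+x. (\<integral>\<^sup>+z. ennreal \<bar>Q a' z\<bar> * ennreal \<bar>v z x\<bar> ^ p \<partial>lborel) \<partial>?N))"
        unfolding mult.assoc[symmetric] by (rule nn_integral_cmult) measurable
      also have "(\<integral>\<^sup>+x. (\<integral>\<^sup>+z. ennreal \<bar>Q a' z\<bar> * ennreal \<bar>v z x\<bar> ^ p \<partial>lborel) \<partial>?N)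
         = (\<integral>\<^sup>+z. (\<integral>\<^sup>+x. ennreal \<bar>Q a' z\<bar> * ennreal \<bar>v z x\<bar> ^ p \<partial>?N) \<partial>lborel)"
        by (rule LN.Fubini') measurable
      also have "\<dots> = (\<integral>\<^sup>+z. ennreal \<bar>Q a' z\<bar> * (\<integral>\<^sup>+x. ennreal \<bar>v z x\<bar> ^ p \<partial>?N) \<partial>lborel)"
        by (intro nn_integral_cong nn_integral_cmult) measurable
      also have "\<dots> \<le> (\<integral>\<^sup>+z. ennreal \<bar>Q a' z\<bar> * S ^ p \<partial>lborel)"
        unfolding v_def by (intro nn_integral_mono mult_left_mono S) auto
      also have "\<dots> \<le> 2 * S ^ p"
        by (subst nn_integral_multc) (auto intro!: mult_right_mono Q_mass)
      also have "ennreal e ^ p * (2 ^ (p - 1) * (2 * S ^ p)) = ennreal e ^ p * (2 ^ p * S ^ p)"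
        using p by (cases p) (auto simp: mult_ac)
      finally show ?thesis by (simp add: mult_left_mono)
    qed
    have "(\<integral>\<^sup>+a. \<integral>\<^sup>+a'. \<integral>\<^sup>+x. ennreal \<bar>V a a' x\<bar> ^ p \<partial>?N \<partial>on_set K \<partial>on_set K)
      \<le> (\<integral>\<^sup>+a. \<integral>\<^sup>+a'. ennreal e ^ p * (2 ^ p * S ^ p) \<partial>on_set K \<partial>on_set K)"
    proof (rule nn_integral_mono_AE)
      have "AE a in on_set K. a \<in> K"
        unfolding on_set_def by (subst AE_density) (auto split: split_indicator)
      then show "AE a in on_set K. (\<integral>\<^sup>+a'. \<integral>\<^sup>+x. ennreal \<bar>V a a' x\<bar> ^ p \<partial>?N \<partial>on_set K)
         \<le> (\<integral>\<^sup>+a'. ennreal e ^ p * (2 ^ p * S ^ p) \<partial>on_set K)"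
        by eventually_elim (intro nn_integral_mono inner)
    qed
    also have "\<dots> = (emeasure lborel K ^ 2 * ennreal (2 * c * \<eta>) ^ p) * (2 * 2) ^ p * S ^ p"
    proof -
      have "e = 2 * (2 * c * \<eta>)" by (simp add: e_def)
      then have "ennreal e = 2 * ennreal (2 * c * \<eta>)"
        using c_nonneg \<eta>_nonneg by (metis ennreal_mult' ennreal_numeral zero_le_numeral)
      then have eq: "ennreal e ^ p = 2 ^ p * ennreal (2 * c * \<eta>) ^ p"
        by (simp only: power_mult_distrib)
      show ?thesis
        unfolding eq power_mult_distrib by (simp add: emeasure_on_set power2_eq_square mult_ac)
    qed
    also have "\<dots> \<le> \<Lambda> ^ p * (2 * 2) ^ p * S ^ p"
      by (intro mult_right_mono \<Lambda>) auto
    \<comment> \<open>One factor 2 comes from e = 2 (2 c \<eta>), the other from the mass of Q a'.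
      The assumption 1 \<le> G then restores G j and G (Suc j), so that both regimes end in the same
      bound.\<close>
    also have "\<dots> = (\<Lambda> * (2 * 1) * (2 * 1) * S) ^ p"
      by (simp add: power_mult_distrib mult_ac)
    also have "\<dots> \<le> (\<Lambda> * (2 * G j) * (2 * G (Suc j)) * S) ^ p"
      by (intro power_mono mult_mono order_refl G_ge_1) auto
    finally show ?thesis .
  next
    case False
    \<comment> \<open>The gain \<Lambda> is attached to one short gap only, also if both are short;
      the other gap keeps its plain norm bound.\<close>
    obtain A A' where A: "(\<integral>\<^sup>+w. ennreal (heat_kernel (r j) (w - y)) ^ p \<partial>lborel) \<le> A ^ p"
      and A': "\<And>w::'a. (\<integral>\<^sup>+z. ennreal (heat_kernel (r (Suc j)) (z - w)) ^ p \<partial>lborel) \<le> A' ^ p"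
      and AA: "A * A' = \<Lambda> * G j * G (Suc j)"
    proof (cases "h \<le> r j")
      case True
      show ?thesis
        by (rule that[of "G j" "\<Lambda> * G (Suc j)"]) (use True False heat_le small_gap in \<open>auto simp: mult_ac not_le\<close>)
    next
      case False
      show ?thesis
        by (rule that[of "\<Lambda> * G j" "G (Suc j)"]) (use False heat_le small_gap in \<open>auto simp: mult_ac not_le\<close>)
    qed
    \<comment> \<open>The second link together with the tail is itself an admissible tail for the
      first link, in the pair of a' and the remaining points as variable. Hence
      \<open>chain_step\<close> is applied twice, the outer time over the product measure.\<close>
    define W where "W w u = (\<integral>\<^sup>+z. ennreal (heat_kernel (r (Suc j)) (z - w)) * ennreal \<bar>Q (fst u) z\<bar> * ennreal \<bar>v z (snd u)\<bar> \<partial>lborel)"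
      for w and u :: "'a \<times> (nat \<Rightarrow> 'a)"
    have W[measurable]: "case_prod W \<in> borel_measurable (borel \<Otimes>\<^sub>M (on_set K \<Otimes>\<^sub>M ?N))"
      unfolding W_def by measurable
    have W_le: "(\<integral>\<^sup>+u. W w u ^ p \<partial>(on_set K \<Otimes>\<^sub>M ?N)) \<le> 2 ^ p * A' ^ p * S ^ p" for w
    proof -
      have "(\<integral>\<^sup>+u. W w u ^ p \<partial>(on_set K \<Otimes>\<^sub>M ?N)) = (\<integral>\<^sup>+a'. \<integral>\<^sup>+x. W w (a', x) ^ p \<partial>?N \<partial>on_set K)"
        by (rule N.nn_integral_fst[symmetric]) measurable
      also have "\<dots> \<le> 2 ^ p * A' ^ p * S ^ p"
        unfolding W_def fst_conv snd_conv
      proof (rule chain_step[where N = ?N and k = "\<lambda>z. ennreal (heat_kernel (r (Suc j)) (z - w))"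
              and v = "\<lambda>z x. ennreal \<bar>v z x\<bar>" and A = "A' ^ p" and S = "S ^ p"])
        show "sigma_finite_measure ?N" by (rule KP.sigma_finite) simp
        show "(\<integral>\<^sup>+z. ennreal (heat_kernel (r (Suc j)) (z - w)) ^ p \<partial>lborel) \<le> A' ^ p" by (rule A')
        show "(\<integral>\<^sup>+x. ennreal \<bar>v z x\<bar> ^ p \<partial>?N) \<le> S ^ p" for z unfolding v_def by (rule S)
      qed measurable
      finally show ?thesis .
    qed
    have "(\<integral>\<^sup>+a. \<integral>\<^sup>+a'. \<integral>\<^sup>+x. ennreal \<bar>V a a' x\<bar> ^ p \<partial>?N \<partial>on_set K \<partial>on_set K)
      \<le> (\<integral>\<^sup>+a. \<integral>\<^sup>+a'. \<integral>\<^sup>+x. (\<integral>\<^sup>+w. ennreal (heat_kernel (r j) (w - y)) * ennreal \<bar>Q a w\<bar> * W w (a', x) \<partial>lborel) ^ p \<partial>?N \<partial>on_set K \<partial>on_set K)"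
    proof (intro nn_integral_mono power_mono)
      fix a a' x
      have "ennreal \<bar>V a a' x\<bar> \<le> (\<integral>\<^sup>+w. ennreal \<bar>\<kappa> j y w * Q a w * (LINT z|lborel. \<kappa> (Suc j) w z * Q a' z * v z x)\<bar> \<partial>lborel)"
        unfolding V_def by (rule integral_abs_le_nn_integral)
      also have "\<dots> \<le> (\<integral>\<^sup>+w. ennreal (heat_kernel (r j) (w - y)) * ennreal \<bar>Q a w\<bar> * W w (a', x) \<partial>lborel)"
      proof (intro nn_integral_mono)
        fix w
        have "ennreal \<bar>LINT z|lborel. \<kappa> (Suc j) w z * Q a' z * v z x\<bar>
           \<le> (\<integral>\<^sup>+z. ennreal \<bar>\<kappa> (Suc j) w z * Q a' z * v z x\<bar> \<partial>lborel)"
          by (rule integral_abs_le_nn_integral)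
        also have "\<dots> \<le> W w (a', x)"
          unfolding W_def using \<kappa>_nonneg \<kappa>_le
          by (intro nn_integral_mono) (auto simp: abs_mult ennreal_mult'[symmetric] intro!: ennreal_leI mult_right_mono)
        finally have 1: "ennreal \<bar>LINT z|lborel. \<kappa> (Suc j) w z * Q a' z * v z x\<bar> \<le> W w (a', x)" .
        have 2: "ennreal \<bar>\<kappa> j y w\<bar> \<le> ennreal (heat_kernel (r j) (w - y))"
          using \<kappa>_nonneg \<kappa>_le by (auto intro!: ennreal_leI)
        show "ennreal \<bar>\<kappa> j y w * Q a w * (LINT z|lborel. \<kappa> (Suc j) w z * Q a' z * v z x)\<bar>
          \<le> ennreal (heat_kernel (r j) (w - y)) * ennreal \<bar>Q a w\<bar> * W w (a', x)"
          unfolding abs_mult ennreal_mult'[OF abs_ge_zero] using 1 2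
          by (simp add: ennreal_mult' mult_mono)
      qed
      finally show "ennreal \<bar>V a a' x\<bar> \<le> (\<integral>\<^sup>+w. ennreal (heat_kernel (r j) (w - y)) * ennreal \<bar>Q a w\<bar> * W w (a', x) \<partial>lborel)" .
    qed auto
    also have "\<dots> = (\<integral>\<^sup>+a. \<integral>\<^sup>+u. (\<integral>\<^sup>+w. ennreal (heat_kernel (r j) (w - y)) * ennreal \<bar>Q a w\<bar> * W w u \<partial>lborel) ^ p \<partial>(on_set K \<Otimes>\<^sub>M ?N) \<partial>on_set K)"
    proof (intro nn_integral_cong)
      fix a :: 'a
      have "(\<lambda>u. (\<integral>\<^sup>+w. ennreal (heat_kernel (r j) (w - y)) * ennreal \<bar>Q a w\<bar> * W w u \<partial>lborel) ^ p)
          \<in> borel_measurable (on_set K \<Otimes>\<^sub>M ?N)"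
        unfolding W_def by measurable
      from N.nn_integral_fst[OF this]
      show "(\<integral>\<^sup>+a'. \<integral>\<^sup>+x. (\<integral>\<^sup>+w. ennreal (heat_kernel (r j) (w - y)) * ennreal \<bar>Q a w\<bar> * W w (a', x) \<partial>lborel) ^ p \<partial>?N \<partial>on_set K)
        = (\<integral>\<^sup>+u. (\<integral>\<^sup>+w. ennreal (heat_kernel (r j) (w - y)) * ennreal \<bar>Q a w\<bar> * W w u \<partial>lborel) ^ p \<partial>(on_set K \<Otimes>\<^sub>M ?N))" .
    qed
    also have "\<dots> \<le> 2 ^ p * A ^ p * (2 ^ p * A' ^ p * S ^ p)"
    proof (rule chain_step[where N = "on_set K \<Otimes>\<^sub>M ?N" and k = "\<lambda>z. ennreal (heat_kernel (r j) (z - y))"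
            and v = W])
      show "sigma_finite_measure (on_set K \<Otimes>\<^sub>M ?N)" by (rule KN.sigma_finite_measure_axioms)
      show "(\<integral>\<^sup>+z. ennreal (heat_kernel (r j) (z - y)) ^ p \<partial>lborel) \<le> A ^ p" by (rule A)
      show "(\<integral>\<^sup>+u. W z u ^ p \<partial>(on_set K \<Otimes>\<^sub>M ?N)) \<le> 2 ^ p * A' ^ p * S ^ p" for z by (rule W_le)
    qed measurable
    also have "\<dots> = (2 * 2 * (A * A') * S) ^ p"
      unfolding power_mult_distrib by (simp add: mult_ac)
    also have "\<dots> = (\<Lambda> * (2 * G j) * (2 * G (Suc j)) * S) ^ p"
      unfolding AA by (simp add: mult_ac)
    finally show ?thesis .
  qed
  finally show ?thesis .
qed

text \<open>The chain is cut into blocks of two links, each of which gains one factor \<Lambda>.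
  Chains of even length are enough because only even moments are expanded.\<close>

lemma chain_cancel_bound:
  "(\<integral>\<^sup>+x. ennreal \<bar>chain \<kappa> Q (2 * m) j y x\<bar> ^ p \<partial>PiM {j..<j + 2 * m} (\<lambda>_. on_set K))
     \<le> (\<Lambda> ^ m * (\<Prod>l\<in>{j..<j + 2 * m}. 2 * G l)) ^ p"
proof (induction m arbitrary: j y)
  case 0
  then show ?case by (simp add: KP.nn_integral_empty del: nn_integral_const)
next
  case (Suc m)
  have I: "{j..<j + 2 * Suc m} = insert j (insert (Suc j) {j + 2..<j + 2 + 2 * m})" by auto
  have "(\<integral>\<^sup>+x. ennreal \<bar>chain \<kappa> Q (Suc (Suc (2 * m))) j y x\<bar> ^ p \<partial>PiM {j..<j + Suc (Suc (2 * m))} (\<lambda>_. on_set K))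
     \<le> (\<Lambda> * (2 * G j) * (2 * G (Suc j)) * (\<Lambda> ^ m * (\<Prod>l\<in>{j + 2..<j + 2 + 2 * m}. 2 * G l))) ^ p"
    by (intro chain_block Suc.IH)
  also have "\<dots> = (\<Lambda> ^ Suc m * (\<Prod>l\<in>{j..<j + 2 * Suc m}. 2 * G l)) ^ p"
    unfolding I by (simp add: mult_ac)
  finally show ?case by simp
qed

end

section \<open>Finite-dimensional distributions of Brownian motion\<close>

lemma integral_lborel_shift:
  fixes f :: "'a::euclidean_space \<Rightarrow> real"
  assumes "f \<in> borel_measurable borel"
  shows "(LINT z|lborel. f (y + z)) = (LINT z|lborel. f z)"
proof -
  have "(LINT z|lborel. f z) = (LINT z|distr lborel borel ((+) y). f z)"
    by (simp add: lborel_distr_plus)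
  also have "\<dots> = (LINT z|lborel. f (y + z))"
    using assms by (intro integral_distr) auto
  finally show ?thesis ..
qed

text \<open>Given the independent past U, the increment is integrated out against its density. It
  enters in the form \<open>e (W \<omega>)\<close> because independence is available for restricted
  families of increments, of which the new increment is a component.\<close>

lemma (in prob_space) indep_var_density_integral:
  fixes h :: "'s \<times> 'c::euclidean_space \<Rightarrow> real"
  assumes ind: "indep_var S U T W"
    and e[measurable]: "e \<in> borel_measurable T"
    and dist: "distributed M lborel (\<lambda>\<omega>. e (W \<omega>)) (\<lambda>v. ennreal (f v))"
    and f: "f \<in> borel_measurable borel" "\<And>v. f v \<ge> 0"
    and h[measurable]: "h \<in> borel_measurable (S \<Otimes>\<^sub>M borel)"
    and bound: "\<And>u v. u \<in> space S \<Longrightarrow> \<bar>h (u, v)\<bar> \<le> B"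
  shows "expectation (\<lambda>\<omega>. h (U \<omega>, e (W \<omega>))) = expectation (\<lambda>\<omega>. LINT v|lborel. f v * h (U \<omega>, v))"
proof -
  note [measurable] = f(1)
  have U[measurable]: "U \<in> measurable M S" and V[measurable]: "W \<in> measurable M T"
    using ind by (auto dest: indep_var_rv1 indep_var_rv2)
  interpret PU: prob_space "distr M S U" by (rule prob_space_distr) simp
  interpret PV: prob_space "distr M T W" by (rule prob_space_distr) simp
  interpret P: pair_prob_space "distr M S U" "distr M T W" ..
  have dV: "distr M borel (\<lambda>\<omega>. e (W \<omega>)) = density lborel (\<lambda>v. ennreal (f v))"
    using distributed_distr_eq_density[OF dist] by (metis distr_cong sets_lborel)
  let ?h = "\<lambda>(u, w). h (u, e w)"
  have "expectation (\<lambda>\<omega>. h (U \<omega>, e (W \<omega>))) = integral\<^sup>L (distr M (S \<Otimes>\<^sub>M T) (\<lambda>\<omega>. (U \<omega>, W \<omega>))) ?h"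
    by (subst integral_distr) auto
  also have "\<dots> = integral\<^sup>L (distr M S U \<Otimes>\<^sub>M distr M T W) ?h"
    using ind by (simp add: indep_var_distribution_eq)
  also have "\<dots> = (LINT u|distr M S U. LINT w|distr M T W. h (u, e w))"
  proof (subst P.integral_fst'[symmetric])
    show "integrable (distr M S U \<Otimes>\<^sub>M distr M T W) ?h"
      using bound by (intro P.integrable_of_bound[where B = B]) (auto simp: space_pair_measure)
  qed simp
  also have "\<dots> = (LINT u|distr M S U. LINT v|lborel. f v * h (u, v))"
  proof (intro Bochner_Integration.integral_cong refl)
    fix u assume "u \<in> space (distr M S U)"
    then have [measurable]: "(\<lambda>v. h (u, v)) \<in> borel_measurable borel"
      using measurable_compose[OF measurable_Pair1' h, of u] by simp
    have "(LINT w|distr M T W. h (u, e w)) = (LINT v|distr M borel (\<lambda>\<omega>. e (W \<omega>)). h (u, v))"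
      by (simp add: integral_distr)
    also have "\<dots> = (LINT v|lborel. f v * h (u, v))"
      unfolding dV by (subst integral_density) (use f in auto)
    finally show "(LINT w|distr M T W. h (u, e w)) = (LINT v|lborel. f v * h (u, v))" .
  qed
  also have "\<dots> = expectation (\<lambda>\<omega>. LINT v|lborel. f v * h (U \<omega>, v))"
    by (subst integral_distr) auto
  finally show ?thesis .
qed

text \<open>Steps carry time increments instead of times, so that a list can be cut anywhere and its
  tail restarted at the time reached.\<close>

fun path_prod :: "(real \<Rightarrow> 'a) \<Rightarrow> real \<Rightarrow> (real \<times> ('a \<Rightarrow> real)) list \<Rightarrow> real" where
  "path_prod b s [] = 1"
| "path_prod b s ((r, \<psi>) # L) = \<psi> (b (s + r)) * path_prod b (s + r) L"

fun heat_chain :: "(real \<times> ('a::euclidean_space \<Rightarrow> real)) list \<Rightarrow> 'a \<Rightarrow> real" where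
  "heat_chain [] y = 1"
| "heat_chain ((r, \<psi>) # L) y = (LINT z|lborel. heat_kernel r (z - y) * (\<psi> z * heat_chain L z))"

abbreviation total_time :: "(real \<times> 'b) list \<Rightarrow> real" where
  "total_time L \<equiv> sum_list (map fst L)"

lemma path_prod_append: "path_prod b s (L @ L') = path_prod b s L * path_prod b (s + total_time L) L'"
  by (induction L arbitrary: s) (auto simp: add.assoc)

lemma path_prod_eq_prod:
  "path_prod b s L = (\<Prod>i<length L. snd (L ! i) (b (s + total_time (take (Suc i) L))))"
proof (induction L arbitrary: s)
  case (Cons a L)
  then show ?case
    by (cases a) (simp only: path_prod.simps length_Cons prod.lessThan_Suc_shift, simp add: add.assoc comp_def)
qed simp

definition bounded_steps :: "(real \<times> ('a::euclidean_space \<Rightarrow> real)) list \<Rightarrow> bool" where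
  "bounded_steps L \<longleftrightarrow> (\<forall>(r, \<psi>)\<in>set L. 0 < r \<and> \<psi> \<in> borel_measurable borel \<and> (\<exists>B. \<forall>y. \<bar>\<psi> y\<bar> \<le> B))"

lemma bounded_steps_simps [simp]:
  "bounded_steps []"
  "bounded_steps ((r, \<psi>) # L) \<longleftrightarrow> 0 < r \<and> \<psi> \<in> borel_measurable borel \<and> (\<exists>B. \<forall>y. \<bar>\<psi> y\<bar> \<le> B) \<and> bounded_steps L"
  "bounded_steps (L @ L') \<longleftrightarrow> bounded_steps L \<and> bounded_steps L'"
  unfolding bounded_steps_def by (simp_all add: ball_Un)

lemma heat_average_bounded:
  fixes g :: "'a::euclidean_space \<Rightarrow> real"
  assumes "r > 0" "\<And>z. \<bar>g z\<bar> \<le> B"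
  shows "\<bar>LINT z|lborel. heat_kernel r (z - y) * g z\<bar> \<le> B"
proof -
  have B: "B \<ge> 0" using assms(2)[of undefined] by linarith
  have "ennreal \<bar>LINT z|lborel. heat_kernel r (z - y) * g z\<bar> \<le> (\<integral>\<^sup>+z. ennreal \<bar>heat_kernel r (z - y) * g z\<bar> \<partial>lborel)"
    by (rule integral_abs_le_nn_integral)
  also have "\<dots> \<le> (\<integral>\<^sup>+z. ennreal B * ennreal (heat_kernel r (z - y)) \<partial>lborel)"
    using assms B by (intro nn_integral_mono)
      (auto simp: abs_mult ennreal_mult'[symmetric] mult.commute intro!: ennreal_leI mult_right_mono)
  also have "\<dots> = ennreal B"
    using nn_integral_heat_kernel_shift[OF assms(1), of y] by (simp add: nn_integral_cmult)
  finally show ?thesis using B by simp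
qed

lemma heat_chain_measurable_bounded:
  assumes "bounded_steps L"
  shows "heat_chain L \<in> borel_measurable borel \<and> (\<exists>B. \<forall>y. \<bar>heat_chain L y\<bar> \<le> B)"
  using assms
proof (induction L)
  case (Cons a L)
  obtain r \<psi> where a: "a = (r, \<psi>)" by fastforce
  obtain B1 B2 where B: "\<And>y. \<bar>\<psi> y\<bar> \<le> B1" "\<And>y. \<bar>heat_chain L y\<bar> \<le> B2"
    using Cons a by auto
  have [measurable]: "\<psi> \<in> borel_measurable borel" "heat_chain L \<in> borel_measurable borel" and r: "r > 0"
    using Cons a by auto
  have "B1 \<ge> 0" using B(1)[of undefined] by linarith
  then have "\<bar>\<psi> z * heat_chain L z\<bar> \<le> B1 * B2" for z
    unfolding abs_mult by (intro mult_mono B) auto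
  then have "\<bar>heat_chain (a # L) y\<bar> \<le> B1 * B2" for y
    unfolding a heat_chain.simps by (rule heat_average_bounded[OF r])
  moreover have "heat_chain (a # L) \<in> borel_measurable borel"
    unfolding a heat_chain.simps by measurable
  ultimately show ?case by blast
next
  case Nil
  have "heat_chain [] = (\<lambda>y::'a. 1)" by (rule ext) simp
  then show ?case by (auto intro: exI[of _ 1])
qed

lemma path_prod_bounded:
  assumes "bounded_steps L"
  shows "\<exists>B. \<forall>b s. \<bar>path_prod b s L\<bar> \<le> B"
  using assms
proof (induction L)
  case (Cons a L)
  obtain r \<psi> where a: "a = (r, \<psi>)" by fastforce
  obtain B1 B2 where B: "\<And>y. \<bar>\<psi> y\<bar> \<le> B1" "\<And>b s. \<bar>path_prod b s L\<bar> \<le> B2"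
    using Cons a by auto
  have "B1 \<ge> 0" using B(1)[of undefined] by linarith
  then have "\<bar>path_prod b s (a # L)\<bar> \<le> B1 * B2" for b s
    unfolding a path_prod.simps abs_mult by (intro mult_mono B) auto
  then show ?case by blast
qed (auto intro: exI[of _ 1])

lemma brownian_motion_measurable:
  "brownian_motion M x B \<Longrightarrow> 0 \<le> t \<Longrightarrow> B t \<in> borel_measurable M"
  by (simp add: brownian_motion_def)

lemma total_time_nonneg: "bounded_steps L \<Longrightarrow> 0 \<le> total_time L"
  by (induction L) auto

lemma path_prod_measurable:
  assumes "brownian_motion M x B" "bounded_steps L" "0 \<le> s"
  shows "(\<lambda>\<omega>. path_prod (\<lambda>t. B t \<omega>) s L) \<in> borel_measurable M"
  using assms(2,3)
proof (induction L arbitrary: s)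
  case (Cons a L)
  obtain r \<psi> where a: "a = (r, \<psi>)" by fastforce
  have [measurable]: "\<psi> \<in> borel_measurable borel" "B (s + r) \<in> borel_measurable M"
    "(\<lambda>\<omega>. path_prod (\<lambda>t. B t \<omega>) (s + r) L) \<in> borel_measurable M"
    using Cons a brownian_motion_measurable[OF assms(1)] by auto
  show ?case unfolding a path_prod.simps by measurable
qed simp

text \<open>The product over the past is a function of the increments up to
  \<open>total_time L\<close>. The next increment is independent of them and Gaussian, so it can be
  integrated out with the past frozen.\<close>

lemma brownian_Markov_step:
  fixes B :: "real \<Rightarrow> 'w \<Rightarrow> 'a::euclidean_space"
  assumes M: "prob_space M" and BM: "brownian_motion M x B"
    and L: "bounded_steps L" and r: "r > 0"
    and g[measurable]: "g \<in> borel_measurable borel" and g_bound: "\<And>y. \<bar>g y\<bar> \<le> C"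
  shows "(LINT \<omega>|M. path_prod (\<lambda>t. B t \<omega>) 0 L * g (B (total_time L + r) \<omega>))
       = (LINT \<omega>|M. path_prod (\<lambda>t. B t \<omega>) 0 L * (LINT z|lborel. heat_kernel r (z - B (total_time L) \<omega>) * g z))"
proof -
  interpret prob_space M by fact
  define n where "n = length L"
  define s where "s = total_time L"
  \<comment> \<open>Partition times from u 0 = 0 to u n = s, followed by u (Suc n) = s + r: the
    increments with index below n are the past, the one with index n is new.\<close>
  define u where "u i = (if i \<le> n then total_time (take i L) else s + r)" for i
  define D where "D i \<omega> = B (u (Suc i)) \<omega> - B (u i) \<omega>" for i \<omega>
  have s0: "s \<ge> 0" unfolding s_def by (rule total_time_nonneg[OF L])
  have un: "u n = s" "u (Suc n) = s + r" "u 0 = 0" by (auto simp: u_def n_def s_def)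
  have u_mono: "u i \<le> u (Suc i)" if "i < Suc n" for i
  proof (cases "i = n")
    case False
    then have "i < length L" using that by (simp add: n_def)
    moreover have "fst (L ! i) > 0"
      using L \<open>i < length L\<close> nth_mem[of i L] unfolding bounded_steps_def by (auto simp: case_prod_beta')
    ultimately show ?thesis by (simp add: u_def n_def take_Suc_conv_app_nth)
  qed (use r un in auto)
  have u0: "u i \<ge> 0" if "i \<le> Suc n" for i
    using that
  proof (induction i)
    case (Suc i)
    then show ?case using u_mono[of i] by simp
  qed (use un in simp)
  have ind: "indep_vars (\<lambda>_. borel) D {..<Suc n}"
  proof -
    have "\<forall>(n::nat) r. 0 \<le> r 0 \<and> (\<forall>j<n. r j \<le> r (Suc j)) \<longrightarrow>
        indep_vars (\<lambda>_. borel) (\<lambda>j \<omega>. B (r (Suc j)) \<omega> - B (r j) \<omega>) {..<n}"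
      using BM unfolding brownian_motion_def by blast
    from this[rule_format, of u "Suc n"] show ?thesis
      unfolding D_def using un u_mono by auto
  qed
  let ?S = "PiM {..<n} (\<lambda>_. borel :: 'a measure)"
  define U where "U \<omega> = restrict (\<lambda>i. D i \<omega>) {..<n}" for \<omega>
  define V where "V \<omega> = restrict (\<lambda>i. D i \<omega>) {n}" for \<omega>
  have Vn: "V \<omega> n = D n \<omega>" for \<omega> by (simp add: V_def)
  have indUV: "indep_var ?S U (PiM {n} (\<lambda>_. borel)) V"
    unfolding U_def V_def by (rule indep_var_restrict[OF ind]) auto
  have dist: "distributed M lborel (\<lambda>\<omega>. V \<omega> n) (\<lambda>v. ennreal (heat_kernel r v))"
  proof -
    have "\<forall>s t. 0 \<le> s \<and> s < t \<longrightarrow> distributed M lborel (\<lambda>\<omega>. B t \<omega> - B s \<omega>) (\<lambda>v. ennreal (heat_kernel (t - s) v))"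
      using BM unfolding brownian_motion_def heat_kernel_def by blast
    from this[rule_format, of s "s + r"] show ?thesis
      unfolding Vn D_def un using s0 r by simp
  qed
  have B_eq: "B (u i) \<omega> = x + (\<Sum>l<i. U \<omega> l)" if "\<omega> \<in> space M" "i \<le> n" for i \<omega>
    using that(2)
  proof (induction i)
    case 0
    then show ?case using BM that un by (simp add: brownian_motion_def)
  next
    case (Suc i)
    then show ?case by (simp add: U_def D_def algebra_simps)
  qed
  define \<Phi> where "\<Phi> f = (\<Prod>i<n. snd (L ! i) (x + (\<Sum>l<Suc i. f l)))" for f
  have psi[measurable]: "snd (L ! i) \<in> borel_measurable borel" if "i < n" for i
    using L that nth_mem[of i L] unfolding bounded_steps_def n_def by (auto simp: case_prod_beta')
  have comp[measurable]: "(\<lambda>f. f l) \<in> borel_measurable ?S" if "l < n" for l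
    using that by simp
  have \<Phi>_meas[measurable]: "\<Phi> \<in> borel_measurable ?S"
    unfolding \<Phi>_def
    by (intro borel_measurable_prod measurable_compose[OF _ psi] borel_measurable_add
        borel_measurable_sum borel_measurable_const comp) auto
  have path: "path_prod (\<lambda>t. B t \<omega>) 0 L = \<Phi> (U \<omega>)" if "\<omega> \<in> space M" for \<omega>
    unfolding path_prod_eq_prod \<Phi>_def n_def[symmetric]
  proof (intro prod.cong refl)
    fix i assume "i \<in> {..<n}"
    then show "snd (L ! i) (B (0 + total_time (take (Suc i) L)) \<omega>) = snd (L ! i) (x + sum (U \<omega>) {..<Suc i})"
      using B_eq[OF that, of "Suc i"] by (simp add: u_def)
  qed
  have "\<exists>C. \<forall>i<n. \<forall>y. \<bar>snd (L ! i) y\<bar> \<le> C i"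
  proof -
    have "\<exists>c. \<forall>y. \<bar>snd (L ! i) y\<bar> \<le> c" if "i < n" for i
      using L that nth_mem[of i L] unfolding bounded_steps_def n_def by (auto simp: case_prod_beta')
    then show ?thesis by metis
  qed
  then obtain c where c: "\<And>i y. i < n \<Longrightarrow> \<bar>snd (L ! i) y\<bar> \<le> c i" by blast
  define C1 where "C1 = (\<Prod>i<n. c i)"
  have \<Phi>_bound: "\<bar>\<Phi> f\<bar> \<le> C1" for f
    unfolding \<Phi>_def C1_def abs_prod using c by (intro prod_mono) auto
  define h where "h = (\<lambda>(f, v). \<Phi> f * g (x + (\<Sum>l<n. f l) + v))"
  have [measurable]: "(\<lambda>f. x + (\<Sum>l<n. f l)) \<in> borel_measurable ?S"
    by (intro borel_measurable_add borel_measurable_sum borel_measurable_const comp) auto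
  have [measurable]: "h \<in> borel_measurable (?S \<Otimes>\<^sub>M borel)"
    unfolding h_def by measurable
  have h_bound: "\<bar>h (f, v)\<bar> \<le> C1 * C" for f v
  proof -
    have "C1 \<ge> 0" using \<Phi>_bound[of undefined] by linarith
    then show ?thesis
      unfolding h_def by (auto simp: abs_mult intro!: mult_mono \<Phi>_bound g_bound)
  qed
  have "(LINT \<omega>|M. path_prod (\<lambda>t. B t \<omega>) 0 L * g (B (total_time L + r) \<omega>)) = expectation (\<lambda>\<omega>. h (U \<omega>, V \<omega> n))"
  proof (intro Bochner_Integration.integral_cong refl)
    fix \<omega> assume \<omega>: "\<omega> \<in> space M"
    have "B (total_time L + r) \<omega> = x + (\<Sum>l<n. U \<omega> l) + D n \<omega>"
      using B_eq[OF \<omega>, of n] un by (simp add: D_def s_def)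
    then show "path_prod (\<lambda>t. B t \<omega>) 0 L * g (B (total_time L + r) \<omega>) = h (U \<omega>, V \<omega> n)"
      by (simp add: h_def path[OF \<omega>] Vn)
  qed
  also have "\<dots> = expectation (\<lambda>\<omega>. LINT v|lborel. heat_kernel r v * h (U \<omega>, v))"
    by (rule indep_var_density_integral[OF indUV _ dist _ _ _ h_bound]) auto
  also have "\<dots> = (LINT \<omega>|M. path_prod (\<lambda>t. B t \<omega>) 0 L * (LINT z|lborel. heat_kernel r (z - B (total_time L) \<omega>) * g z))"
  proof (intro Bochner_Integration.integral_cong refl)
    fix \<omega> assume \<omega>: "\<omega> \<in> space M"
    have B: "B (total_time L) \<omega> = x + (\<Sum>l<n. U \<omega> l)"
      using B_eq[OF \<omega>, of n] un by (simp add: s_def)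
    have "(LINT v|lborel. heat_kernel r v * h (U \<omega>, v))
       = (LINT v|lborel. \<Phi> (U \<omega>) * (heat_kernel r v * g (B (total_time L) \<omega> + v)))"
      by (simp add: h_def B mult_ac)
    also have "\<dots> = \<Phi> (U \<omega>) * (LINT v|lborel. heat_kernel r v * g (B (total_time L) \<omega> + v))"
      by (rule integral_mult_right_zero)
    also have "(LINT v|lborel. heat_kernel r v * g (B (total_time L) \<omega> + v))
       = (LINT z|lborel. heat_kernel r (z - B (total_time L) \<omega>) * g z)"
      using integral_lborel_shift[of "\<lambda>z. heat_kernel r (z - B (total_time L) \<omega>) * g z" "B (total_time L) \<omega>"]
      by simp
    finally show "(LINT v|lborel. heat_kernel r v * h (U \<omega>, v))
      = path_prod (\<lambda>t. B t \<omega>) 0 L * (LINT z|lborel. heat_kernel r (z - B (total_time L) \<omega>) * g z)"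
      by (simp add: path[OF \<omega>])
  qed
  finally show ?thesis .
qed

lemma brownian_path_prod:
  fixes B :: "real \<Rightarrow> 'w \<Rightarrow> 'a::euclidean_space"
  assumes M: "prob_space M" and BM: "brownian_motion M x B" and L: "bounded_steps L"
  shows "(LINT \<omega>|M. path_prod (\<lambda>t. B t \<omega>) 0 L) = heat_chain L x"
proof -
  interpret prob_space M by fact
  \<comment> \<open>Generalised to a prefix L' of steps already taken, which is the past on which
    the Markov step conditions. The claim is the case of the empty prefix, where the path is at
    x.\<close>
  have "(LINT \<omega>|M. path_prod (\<lambda>t. B t \<omega>) 0 (L' @ L))
      = (LINT \<omega>|M. path_prod (\<lambda>t. B t \<omega>) 0 L' * heat_chain L (B (total_time L') \<omega>))"
    if "bounded_steps L'" for L'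
    using L that
  proof (induction L arbitrary: L')
    case (Cons a L)
    obtain r \<psi> where a: "a = (r, \<psi>)" by fastforce
    have r: "r > 0" and [measurable]: "\<psi> \<in> borel_measurable borel" using Cons a by auto
    obtain B1 B2 where B: "\<And>y. \<bar>\<psi> y\<bar> \<le> B1" "\<And>y. \<bar>heat_chain L y\<bar> \<le> B2"
      using Cons a heat_chain_measurable_bounded[of L] by auto
    have [measurable]: "heat_chain L \<in> borel_measurable borel"
      using Cons a heat_chain_measurable_bounded[of L] by auto
    have "B1 \<ge> 0" using B(1)[of undefined] by linarith
    then have bound: "\<bar>\<psi> z * heat_chain L z\<bar> \<le> B1 * B2" for z
      unfolding abs_mult by (intro mult_mono B) auto
    have "(LINT \<omega>|M. path_prod (\<lambda>t. B t \<omega>) 0 (L' @ a # L)) = (LINT \<omega>|M. path_prod (\<lambda>t. B t \<omega>) 0 ((L' @ [a]) @ L))"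
      by simp
    also have "\<dots> = (LINT \<omega>|M. path_prod (\<lambda>t. B t \<omega>) 0 (L' @ [a]) * heat_chain L (B (total_time (L' @ [a])) \<omega>))"
      by (rule Cons.IH) (use Cons.prems a in auto)
    also have "\<dots> = (LINT \<omega>|M. path_prod (\<lambda>t. B t \<omega>) 0 L' * (\<psi> (B (total_time L' + r) \<omega>) * heat_chain L (B (total_time L' + r) \<omega>)))"
      by (simp add: a path_prod_append mult.assoc)
    also have "\<dots> = (LINT \<omega>|M. path_prod (\<lambda>t. B t \<omega>) 0 L' * (LINT z|lborel. heat_kernel r (z - B (total_time L') \<omega>) * (\<psi> z * heat_chain L z)))"
      by (rule brownian_Markov_step[OF M BM Cons.prems(2) r _ bound]) measurable
    finally show ?case by (simp add: a)
  qed simp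
  from this[of "[]"] have "(LINT \<omega>|M. path_prod (\<lambda>t. B t \<omega>) 0 L) = (LINT \<omega>|M. heat_chain L (B 0 \<omega>))"
    by simp
  also have "\<dots> = (LINT \<omega>|M. heat_chain L x)"
    using BM by (intro Bochner_Integration.integral_cong) (auto simp: brownian_motion_def)
  finally show ?thesis by (simp add: prob_space)
qed

section \<open>Killed Brownian motion as a limit of discretely killed paths\<close>

lemma enn2real_killed_kernel_le:
  assumes "F \<in> sets borel" "r > 0"
  shows "enn2real (killed_kernel F r n y z) \<le> heat_kernel (real (Suc n) * r) (z - y)"
  using enn2real_mono[OF killed_kernel_le[OF assms, of n y z]] by simp

text \<open>The n intermediate positions carry nothing but the indicator of F, so integrating them
  out assembles the killed kernel. Fubini is needed because \<open>heat_chain\<close> has the first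
  position outermost, whereas here it is the endpoint of the block.\<close>

lemma heat_chain_killed_block:
  fixes F :: "'a::euclidean_space set"
  assumes F[measurable]: "F \<in> sets borel" and r: "r > 0"
    and L: "bounded_steps ((r, \<psi>) # L)"
  shows "heat_chain (replicate n (r, indicat_real F) @ (r, \<psi>) # L) y
     = (LINT z|lborel. enn2real (killed_kernel F r n y z) * (\<psi> z * heat_chain L z))"
proof (induction n arbitrary: y)
  case (Suc n)
  note [measurable] = killed_kernel_measurable'[OF F r]
  obtain B1 B2 where B: "\<And>y. \<bar>\<psi> y\<bar> \<le> B1" "\<And>y. \<bar>heat_chain L y\<bar> \<le> B2"
    using L heat_chain_measurable_bounded[of L] by auto
  have [measurable]: "\<psi> \<in> borel_measurable borel" "heat_chain L \<in> borel_measurable borel"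
    using L heat_chain_measurable_bounded[of L] by auto
  have B1: "B1 \<ge> 0" using B(1)[of undefined] by linarith
  let ?k = "\<lambda>v z. enn2real (killed_kernel F r n v z)"
  let ?f = "\<lambda>v z. heat_kernel r (v - y) * indicat_real F v * ?k v z * (\<psi> z * heat_chain L z)"
  have le: "\<bar>case_prod ?f (v, z)\<bar> \<le> (B1 * B2) * (heat_kernel r (v - y) * heat_kernel (real (Suc n) * r) (z - v))" for v z
  proof -
    have "\<bar>case_prod ?f (v, z)\<bar> = (heat_kernel r (v - y) * indicat_real F v * ?k v z) * (\<bar>\<psi> z\<bar> * \<bar>heat_chain L z\<bar>)"
      by (simp add: abs_mult)
    also have "\<dots> \<le> (heat_kernel r (v - y) * 1 * heat_kernel (real (Suc n) * r) (z - v)) * (B1 * B2)"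
      using enn2real_killed_kernel_le[OF F r, of n v z] B1
      by (intro mult_mono B) (auto split: split_indicator)
    finally show ?thesis by (simp add: mult_ac)
  qed
  have int: "integrable (lborel \<Otimes>\<^sub>M lborel) (case_prod ?f)"
    by (rule integrable_two_heat_kernels[OF _ r _ le]) (use r in \<open>auto\<close>)
  have "heat_chain (replicate (Suc n) (r, indicat_real F) @ (r, \<psi>) # L) y
     = (LINT v|lborel. heat_kernel r (v - y) * (indicat_real F v * (LINT z|lborel. ?k v z * (\<psi> z * heat_chain L z))))"
    by (simp only: replicate_Suc append_Cons heat_chain.simps Suc)
  also have "\<dots> = (LINT v|lborel. LINT z|lborel. ?f v z)"
    by (simp add: mult.assoc)
  also have "\<dots> = (LINT z|lborel. LINT v|lborel. ?f v z)"
    by (rule lborel_pair.Fubini_integral[symmetric]) (rule int)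
  also have "\<dots> = (LINT z|lborel. enn2real (killed_kernel F r (Suc n) y z) * (\<psi> z * heat_chain L z))"
  proof (intro Bochner_Integration.integral_cong refl)
    fix z
    have "(LINT v|lborel. ?f v z) = (LINT v|lborel. heat_kernel r (v - y) * indicat_real F v * ?k v z) * (\<psi> z * heat_chain L z)"
      by (rule integral_mult_left_zero)
    also have "(LINT v|lborel. heat_kernel r (v - y) * indicat_real F v * ?k v z)
       = enn2real (\<integral>\<^sup>+v. ennreal (heat_kernel r (v - y) * indicat_real F v * ?k v z) \<partial>lborel)"
      by (rule integral_eq_nn_integral) auto
    also have "(\<integral>\<^sup>+v. ennreal (heat_kernel r (v - y) * indicat_real F v * ?k v z) \<partial>lborel) = killed_kernel F r (Suc n) y z"
      unfolding killed_kernel.simps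
    proof (intro nn_integral_cong)
      fix v
      have "ennreal (?k v z) = killed_kernel F r n v z"
        using killed_kernel_finite[OF F r, of n v z] by (intro ennreal_enn2real) simp
      then show "ennreal (heat_kernel r (v - y) * indicat_real F v * ?k v z)
        = ennreal (heat_kernel r (v - y)) * indicator F v * killed_kernel F r n v z"
        by (simp add: ennreal_mult' ennreal_indicator[symmetric])
    qed
    finally show "(LINT v|lborel. ?f v z) = enn2real (killed_kernel F r (Suc n) y z) * (\<psi> z * heat_chain L z)" .
  qed
  finally show ?case .
qed simp

text \<open>The n intermediate times of \<open>killed_kernel\<close> cut the gap r into n + 1 equal
  steps. The endpoint carries \<psi> and is not tested for killing.\<close>

definition killed_step :: "'a::euclidean_space set \<Rightarrow> nat \<Rightarrow> real \<Rightarrow> ('a \<Rightarrow> real) \<Rightarrow> (real \<times> ('a \<Rightarrow> real)) list" where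
  "killed_step F n r \<psi> = replicate n (r / real (Suc n), indicat_real F) @ [(r / real (Suc n), \<psi>)]"

lemma steps_add_up: "real n * (r / real (Suc n)) + r / real (Suc n) = r"
proof -
  have "real n * (r / real (Suc n)) + r / real (Suc n) = real (Suc n) * (r / real (Suc n))"
    unfolding of_nat_Suc by (simp only: distrib_right mult_1 add.commute)
  then show ?thesis by simp
qed

lemma total_time_killed_step: "total_time (killed_step F n r \<psi>) = r"
  using steps_add_up[of n r] unfolding killed_step_def by (simp add: sum_list_replicate del: of_nat_Suc)

lemma bounded_steps_killed_step:
  assumes "F \<in> sets borel" "r > 0" "\<psi> \<in> borel_measurable borel" "\<And>y. \<bar>\<psi> y\<bar> \<le> b"
  shows "bounded_steps (killed_step F n r \<psi>)"
  using assms unfolding killed_step_def bounded_steps_def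
  by (auto simp: indicator_def dest!: in_set_replicate[THEN iffD1])

lemma path_prod_replicate:
  "path_prod b s (replicate n (\<rho>, \<psi>)) = (\<Prod>i<n. \<psi> (b (s + real (Suc i) * \<rho>)))"
  unfolding path_prod_eq_prod by (auto simp: sum_list_replicate distrib_right intro!: prod.cong)

lemma path_prod_killed_step:
  "path_prod b s (killed_step F n r \<psi>)
    = (\<Prod>i<n. indicat_real F (b (s + real (Suc i) * (r / real (Suc n))))) * \<psi> (b (s + r))"
  using steps_add_up[of n r] unfolding killed_step_def path_prod_append path_prod_replicate
  by (simp add: sum_list_replicate add.assoc del: of_nat_Suc)

lemma path_prod_killed_steps:
  "path_prod b 0 (concat (map (\<lambda>l. killed_step F n (r l) (\<psi> l)) [0..<k]))
    = (\<Prod>l<k. (\<Prod>i<n. indicat_real F (b (sum r {..<l} + real (Suc i) * (r l / real (Suc n)))))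
         * \<psi> l (b (sum r {..<Suc l})))"
proof (induction k)
  case (Suc k)
  have "total_time (concat (map (\<lambda>l. killed_step F n (r l) (\<psi> l)) [0..<k])) = sum r {..<k}"
    by (induction k) (auto simp: total_time_killed_step)
  with Suc show ?case
    by (simp add: path_prod_append path_prod_killed_step del: of_nat_Suc)
qed simp

lemma heat_chain_killed_steps:
  fixes F :: "'a::euclidean_space set"
  assumes F: "F \<in> sets borel" and r: "\<And>l. r l > 0"
    and Q: "\<And>x. Q x \<in> borel_measurable borel" "\<And>x y. \<bar>Q x y\<bar> \<le> b"
  shows "heat_chain (concat (map (\<lambda>l. killed_step F n (r l) (Q (x l))) [j..<j + k])) y
    = chain (\<lambda>l y z. enn2real (killed_kernel F (r l / real (Suc n)) n y z)) Q k j y x"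
proof (induction k arbitrary: j y)
  case (Suc k)
  let ?L = "concat (map (\<lambda>l. killed_step F n (r l) (Q (x l))) [Suc j..<Suc j + k])"
  have L: "bounded_steps ?L"
    unfolding bounded_steps_def
  proof
    fix a assume "a \<in> set ?L"
    then obtain l where "a \<in> set (killed_step F n (r l) (Q (x l)))" by auto
    then show "case a of (r, \<psi>) \<Rightarrow> 0 < r \<and> \<psi> \<in> borel_measurable borel \<and> (\<exists>B. \<forall>y. \<bar>\<psi> y\<bar> \<le> B)"
      using bounded_steps_killed_step[OF F r Q, of n l "x l"] unfolding bounded_steps_def by blast
  qed
  have "[j..<j + Suc k] = j # [Suc j..<Suc j + k]" by (simp add: upt_conv_Cons)
  then have "heat_chain (concat (map (\<lambda>l. killed_step F n (r l) (Q (x l))) [j..<j + Suc k])) y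
    = heat_chain (replicate n (r j / real (Suc n), indicat_real F) @ (r j / real (Suc n), Q (x j)) # ?L) y"
    by (simp add: killed_step_def)
  also have "\<dots> = (LINT z|lborel. enn2real (killed_kernel F (r j / real (Suc n)) n y z) * (Q (x j) z * heat_chain ?L z))"
    using r[of j] L Q by (intro heat_chain_killed_block F) (auto intro!: exI[of _ b])
  also have "\<dots> = chain (\<lambda>l y z. enn2real (killed_kernel F (r l / real (Suc n)) n y z)) Q (Suc k) j y x"
    unfolding Suc.IH by (simp add: mult.assoc)
  finally show ?case .
qed simp

text \<open>If the path is outside F at time u, closedness of F and continuity keep it outside near
  u, and a fine grid meets that neighbourhood. For a set that is not closed this can fail: a path
  may touch the complement at a single time that no grid contains.\<close>

lemma killing_limit:
  fixes b :: "real \<Rightarrow> 'a::euclidean_space"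
  assumes F: "closed F" and b: "continuous_on {0..} b" and s: "s \<ge> 0" "r > 0"
  shows "(\<lambda>n. \<Prod>i<n. indicat_real F (b (s + real (Suc i) * (r / real (Suc n)))))
     \<longlonglongrightarrow> of_bool (\<forall>u\<in>{s..s + r}. b u \<in> F)"
proof (cases "\<forall>u\<in>{s..s + r}. b u \<in> F")
  case True
  have "indicat_real F (b (s + real (Suc i) * (r / real (Suc n)))) = 1" if "i < n" for i n
  proof -
    have "real (Suc i) * r \<le> real (Suc n) * r" using that s by (intro mult_right_mono) auto
    then have "real (Suc i) * (r / real (Suc n)) \<le> r" by (simp add: field_simps)
    moreover have "0 \<le> real (Suc i) * (r / real (Suc n))" using s by simp
    ultimately show ?thesis using True by (auto simp: indicator_def)
  qed
  then have "(\<Prod>i<n. indicat_real F (b (s + real (Suc i) * (r / real (Suc n))))) = 1" for n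
    by (intro prod.neutral) auto
  then show ?thesis using True by simp
next
  case False
  then obtain u where u: "u \<in> {s..s + r}" "b u \<notin> F" by auto
  have "\<exists>d>0. \<forall>u'\<in>{0..}. dist u' u < d \<longrightarrow> b u' \<notin> F"
  proof -
    obtain e where e: "e > 0" "ball (b u) e \<subseteq> - F"
      using F u(2) open_contains_ball[of "- F"] by (auto simp: closed_open)
    obtain d where "d > 0" "\<forall>u'\<in>{0..}. dist u' u < d \<longrightarrow> dist (b u') (b u) < e"
      using b u s e(1) unfolding continuous_on_iff by fastforce
    then show ?thesis using e(2) by (intro exI[of _ d]) (auto simp: dist_commute subset_eq)
  qed
  then obtain d where d: "d > 0" "\<And>u'. u' \<ge> 0 \<Longrightarrow> dist u' u < d \<Longrightarrow> b u' \<notin> F" by auto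
  have "(\<lambda>n. r / real (Suc n)) \<longlonglongrightarrow> 0"
    by (rule LIMSEQ_Suc[OF lim_const_over_n])
  then have "eventually (\<lambda>n. r / real (Suc n) < d) sequentially"
    using d(1) by (rule order_tendstoD)
  then have "eventually (\<lambda>n. (\<Prod>i<n. indicat_real F (b (s + real (Suc i) * (r / real (Suc n))))) = 0) sequentially"
    using eventually_ge_at_top[of 1]
  proof eventually_elim
    case (elim n)
    define \<rho> where "\<rho> = r / real (Suc n)"
    have \<rho>: "\<rho> > 0" "\<rho> < d" "real (Suc n) * \<rho> = r" using elim s by (auto simp: \<rho>_def)
    define \<tau> where "\<tau> = u - s"
    have \<tau>: "0 \<le> \<tau>" "\<tau> \<le> real (Suc n) * \<rho>" using u \<rho> by (auto simp: \<tau>_def)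
    define m where "m = nat \<lfloor>\<tau> / \<rho>\<rfloor>"
    have m: "real m * \<rho> \<le> \<tau>" "\<tau> < (real m + 1) * \<rho>"
    proof -
      have "real m = of_int \<lfloor>\<tau> / \<rho>\<rfloor>" unfolding m_def using \<tau> \<rho> by simp
      then have "real m \<le> \<tau> / \<rho>" "\<tau> / \<rho> < real m + 1" by linarith+
      then show "real m * \<rho> \<le> \<tau>" "\<tau> < (real m + 1) * \<rho>" using \<rho> by (auto simp: field_simps)
    qed
    have "real m * \<rho> \<le> real (Suc n) * \<rho>" using m \<tau> by linarith
    then have "real m \<le> real (Suc n)" by (rule mult_right_le_imp_le[OF _ \<rho>(1)])
    then have mn: "m \<le> Suc n" by (simp only: of_nat_le_iff)
    \<comment> \<open>The tested points are the interior grid points 1, ..., n. If u lies in the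
      first cell or at the right end of the gap, the nearest interior point is still within one mesh
      width; n \<ge> 1 ensures that there is one.\<close>
    obtain i where i: "i < n" "\<bar>real (Suc i) * \<rho> - \<tau>\<bar> \<le> \<rho>"
    proof (cases "m = 0 \<or> m = Suc n")
      case True
      then show ?thesis
      proof
        assume "m = 0"
        then show ?thesis using that[of 0] elim m \<tau> \<rho> by auto
      next
        assume "m = Suc n"
        then have "\<tau> = real (Suc n) * \<rho>" using m \<tau> by simp
        then show ?thesis using that[of "n - 1"] elim \<rho> by (auto simp: algebra_simps)
      qed
    next
      case False
      then show ?thesis using that[of "m - 1"] mn m by (auto simp: algebra_simps)
    qed
    have "b (s + real (Suc i) * \<rho>) \<notin> F"
    proof (rule d(2))
      show "0 \<le> s + real (Suc i) * \<rho>" using s \<rho> by simp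
      show "dist (s + real (Suc i) * \<rho>) u < d"
        using i(2) \<rho> by (auto simp: dist_real_def \<tau>_def abs_le_iff algebra_simps)
    qed
    then show ?case
      unfolding \<rho>_def[symmetric] using i(1) by (intro prod_zero) (auto intro!: bexI[of _ i])
  qed
  then have "(\<lambda>n. \<Prod>i<n. indicat_real F (b (s + real (Suc i) * (r / real (Suc n))))) \<longlonglongrightarrow> 0"
    by (rule tendsto_eventually)
  then show ?thesis
    using False by (simp only: of_bool_eq)
qed

text \<open>A closed exhaustion of D from inside: the limit of grid killing needs closed sets, and
  by compactness a path segment within D lies in a single one of them.\<close>

definition inner_part :: "'a::euclidean_space set \<Rightarrow> nat \<Rightarrow> 'a set" where
  "inner_part D N = {x. \<forall>z. z \<notin> D \<longrightarrow> 1 / real (Suc N) \<le> dist x z}"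

lemma closed_inner_part: "closed (inner_part D N)"
proof -
  have "inner_part D N = (\<Inter>z\<in>- D. {x. 1 / real (Suc N) \<le> dist x z})"
    by (auto simp: inner_part_def)
  also have "closed \<dots>"
    by (intro closed_INT ballI closed_Collect_le continuous_intros)
  finally show ?thesis .
qed

lemma inner_part_subset: "inner_part D N \<subseteq> D"
proof
  fix x assume "x \<in> inner_part D N"
  then have "x \<notin> D \<longrightarrow> 1 / real (Suc N) \<le> 0" by (force simp: inner_part_def)
  then show "x \<in> D" by (auto simp: field_simps)
qed

lemma compact_subset_inner_part:
  assumes "compact C" "C \<subseteq> D" "open D"
  shows "eventually (\<lambda>N. C \<subseteq> inner_part D N) sequentially"
proof -
  obtain d where d: "d > 0" "\<And>x y. x \<in> C \<Longrightarrow> y \<in> - D \<Longrightarrow> d \<le> dist x y"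
    using separate_compact_closed[of C "- D"] assms by (force simp: closed_Compl)
  have "(\<lambda>n. 1 / real (Suc n)) \<longlonglongrightarrow> 0"
    by (rule LIMSEQ_Suc[OF lim_const_over_n])
  then have "eventually (\<lambda>N. 1 / real (Suc N) < d) sequentially"
    using d(1) by (rule order_tendstoD)
  then show ?thesis
    by eventually_elim (use d in \<open>fastforce simp: inner_part_def\<close>)
qed

text \<open>The strict inequality comes from openness: a path that is in D up to time s stays there
  a little longer. Time 0 does not count for the exit time, so it is covered by the assumption on b
  0.\<close>

lemma less_exit_time_iff:
  fixes b :: "real \<Rightarrow> 'a::euclidean_space"
  assumes D: "open D" and b: "continuous_on {0..} b" "b 0 \<in> D" and s: "s \<ge> 0"
  shows "ereal s < exit_time D b \<longleftrightarrow> (\<forall>u\<in>{0..s}. b u \<in> D)"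
proof
  assume less: "ereal s < exit_time D b"
  show "\<forall>u\<in>{0..s}. b u \<in> D"
  proof
    fix u assume u: "u \<in> {0..s}"
    show "b u \<in> D"
    proof (rule ccontr)
      assume "b u \<notin> D"
      then have "u > 0" using u b by (cases "u = 0") auto
      then have "exit_time D b \<le> ereal u"
        unfolding exit_time_def using \<open>b u \<notin> D\<close> by (intro Inf_lower) auto
      also have "\<dots> \<le> ereal s" using u by simp
      finally show False using less by simp
    qed
  qed
next
  assume in_D: "\<forall>u\<in>{0..s}. b u \<in> D"
  obtain e where e: "e > 0" "ball (b s) e \<subseteq> D"
    using D in_D s open_contains_ball by (metis atLeastAtMost_iff order_refl)
  obtain d where d: "d > 0" "\<forall>u\<in>{0..}. dist u s < d \<longrightarrow> dist (b u) (b s) < e"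
    using b(1) s e(1) unfolding continuous_on_iff by fastforce
  have "ereal (s + d) \<le> exit_time D b"
    unfolding exit_time_def
  proof (rule Inf_greatest)
    fix y assume "y \<in> {ereal t |t. 0 < t \<and> b t \<notin> D}"
    then obtain t where t: "y = ereal t" "0 < t" "b t \<notin> D" by auto
    have "\<not> t < s + d"
    proof
      assume "t < s + d"
      then have "t > s" using in_D t by (force simp: not_le[symmetric])
      then have "dist (b t) (b s) < e"
        using d(2) \<open>t < s + d\<close> t(2) by (auto simp: dist_real_def)
      then show False using e(2) t(3) by (auto simp: dist_commute subset_eq)
    qed
    then show "ereal (s + d) \<le> y" using t by simp
  qed
  moreover have "ereal s < ereal (s + d)" using d(1) by simp
  ultimately show "ereal s < exit_time D b" by (rule order_less_le_trans[rotated])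
qed

section \<open>Transfer of bounds from discretely killed paths to the killed process\<close>

definition lift_killed :: "('a \<Rightarrow> 'a \<Rightarrow> real) \<Rightarrow> 'a \<Rightarrow> 'a option \<Rightarrow> real" where
  "lift_killed Q x z = (case z of None \<Rightarrow> 0 | Some y \<Rightarrow> Q x y)"

lemma lift_killed_simps [simp]: "lift_killed Q x None = 0" "lift_killed Q x (Some y) = Q x y"
  by (simp_all add: lift_killed_def)

lemma nn_integral_le_of_tendsto:
  fixes u :: "nat \<Rightarrow> 'b \<Rightarrow> ennreal"
  assumes [measurable]: "\<And>n. u n \<in> borel_measurable M"
    and lim: "\<And>x. x \<in> space M \<Longrightarrow> (\<lambda>n. u n x) \<longlonglongrightarrow> v x"
    and le: "eventually (\<lambda>n. (\<integral>\<^sup>+x. u n x \<partial>M) \<le> C) sequentially"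
  shows "(\<integral>\<^sup>+x. v x \<partial>M) \<le> C"
proof -
  have "(\<integral>\<^sup>+x. v x \<partial>M) = (\<integral>\<^sup>+x. liminf (\<lambda>n. u n x) \<partial>M)"
    by (intro nn_integral_cong lim_imp_Liminf[symmetric] lim) auto
  also have "\<dots> \<le> liminf (\<lambda>n. \<integral>\<^sup>+x. u n x \<partial>M)"
    by (rule nn_integral_liminf) simp
  also have "\<dots> \<le> liminf (\<lambda>n::nat. C)"
    by (rule Liminf_mono) (rule le)
  also have "\<dots> = C" by (simp add: Liminf_const)
  finally show ?thesis .
qed

text \<open>As n tends to infinity, killing on the grid becomes survival in
  \<open>inner_part D N\<close>; as N tends to infinity, this becomes survival in D. Bounded
  convergence is used inside the expectation and Fatou's lemma for the integral over the space
  points. The bound is required for large N only, since cancellation needs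
  \<open>inner_part D N\<close> to reach far enough into D.\<close>

lemma killed_moment_bound:
  fixes D :: "'a::euclidean_space set"
  assumes M: "prob_space M" and D: "open D" and x0: "x0 \<in> D"
    and X: "killed_brownian_motion M D x0 X"
    and Q: "mollifier Q b K p" and r: "\<And>l. r l > 0"
    and bound: "eventually (\<lambda>N. \<forall>n. (\<integral>\<^sup>+x. ennreal \<bar>chain (\<lambda>l y z. enn2real
        (killed_kernel (inner_part D N) (r l / real (Suc n)) n y z)) Q k 0 x0 x\<bar> ^ p
        \<partial>PiM {0..<k} (\<lambda>_. on_set K)) \<le> C) sequentially"
  shows "(\<integral>\<^sup>+x. ennreal \<bar>LINT \<omega>|M. (\<Prod>l<k. lift_killed Q (x l) (X (sum r {..<Suc l}) \<omega>))\<bar> ^ p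
        \<partial>PiM {0..<k} (\<lambda>_. on_set K)) \<le> C"
proof -
  interpret prob_space M by fact
  interpret mollifier Q b K p by fact
  obtain B where BM: "brownian_motion M x0 B"
    and XB: "\<And>\<omega> t. \<omega> \<in> space M \<Longrightarrow> t \<ge> 0 \<Longrightarrow> X t \<omega> = killed_path D (\<lambda>s. B s \<omega>) t"
    using X unfolding killed_brownian_motion_def by blast
  have cont: "continuous_on {0..} (\<lambda>t. B t \<omega>)" and B0: "B 0 \<omega> = x0" if "\<omega> \<in> space M" for \<omega>
    using BM that by (auto simp: brownian_motion_def)
  define s where "s l = sum r {..<l}" for l
  have s0: "s l \<ge> 0" for l unfolding s_def using r by (intro sum_nonneg) (auto simp: less_imp_le)
  have sS: "s (Suc l) = s l + r l" for l by (simp add: s_def)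
  have F_borel: "inner_part D N \<in> sets borel" for N
    by (simp add: borel_closed closed_inner_part)
  define \<kappa> where "\<kappa> N n l y z = enn2real (killed_kernel (inner_part D N) (r l / real (Suc n)) n y z)" for N n l y z
  \<comment> \<open>Three stages of the same product: killing on a grid (\<open>G\<close>), killing
    on whole gaps outside the inner set (\<open>H\<close>), and killing outside D
    (\<open>Y\<close>).\<close>
  define G where "G N n x \<omega> = (\<Prod>l<k. (\<Prod>i<n. indicat_real (inner_part D N) (B (s l + real (Suc i) * (r l / real (Suc n))) \<omega>))
         * Q (x l) (B (s (Suc l)) \<omega>))" for N n x \<omega>
  define H where "H N x \<omega> = (\<Prod>l<k. of_bool (\<forall>u\<in>{s l..s l + r l}. B u \<omega> \<in> inner_part D N)
         * Q (x l) (B (s (Suc l)) \<omega>))" for N x \<omega>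
  define Y where "Y x \<omega> = (\<Prod>l<k. lift_killed Q (x l) (X (s (Suc l)) \<omega>))" for x \<omega>
  have Q_meas: "Q x \<in> borel_measurable borel" for x by measurable
  have G_eq: "G N n x \<omega> = path_prod (\<lambda>t. B t \<omega>) 0 (concat (map (\<lambda>l. killed_step (inner_part D N) n (r l) (Q (x l))) [0..<k]))" for N n x \<omega>
    unfolding path_prod_killed_steps G_def s_def ..
  have steps: "bounded_steps (concat (map (\<lambda>l. killed_step (inner_part D N) n (r l) (Q (x l))) [0..<k]))" for N n x
    by (induction k) (use bounded_steps_killed_step[OF F_borel r Q_meas Q_bound] in auto)
  have EG: "(LINT \<omega>|M. G N n x \<omega>) = chain (\<kappa> N n) Q k 0 x0 x" for N n x
    unfolding G_eq brownian_path_prod[OF M BM steps]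
    using heat_chain_killed_steps[where F = "inner_part D N" and n = n and x = x and j = 0 and k = k and y = x0
          and r = r and Q = Q,
        OF F_borel r Q_meas Q_bound] by (simp add: \<kappa>_def[abs_def])
  have G_meas: "G N n x \<in> borel_measurable M" for N n x
    unfolding G_eq by (rule path_prod_measurable[OF BM steps]) simp
  have prod_bound: "\<bar>\<Prod>l<k. a l * Q (x l) (y l)\<bar> \<le> b ^ k" if "\<And>l. \<bar>a l\<bar> \<le> 1" for a x y
  proof -
    have "\<bar>\<Prod>l<k. a l * Q (x l) (y l)\<bar> = (\<Prod>l<k. \<bar>a l\<bar> * \<bar>Q (x l) (y l)\<bar>)"
      by (simp add: abs_prod abs_mult)
    also have "\<dots> \<le> (\<Prod>l<k. 1 * b)"
      using that Q_bound by (intro prod_mono conjI mult_mono) auto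
    finally show ?thesis by simp
  qed
  have G_bound: "\<bar>G N n x \<omega>\<bar> \<le> b ^ k" for N n x \<omega>
    unfolding G_def
  proof (rule prod_bound)
    fix l
    show "\<bar>\<Prod>i<n. indicat_real (inner_part D N) (B (s l + real (Suc i) * (r l / real (Suc n))) \<omega>)\<bar> \<le> 1"
      unfolding abs_prod by (intro prod_le_1) (auto simp: indicator_def)
  qed
  have H_bound: "\<bar>H N x \<omega>\<bar> \<le> b ^ k" for N x \<omega>
    unfolding H_def by (rule prod_bound) simp
  have GH: "(\<lambda>n. G N n x \<omega>) \<longlonglongrightarrow> H N x \<omega>" if "\<omega> \<in> space M" for N x \<omega>
    unfolding G_def H_def
    by (intro tendsto_intros killing_limit closed_inner_part cont[OF that] s0 r)
  have H_meas: "H N x \<in> borel_measurable M" for N x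
    by (rule borel_measurable_LIMSEQ_real[OF GH G_meas])
  have HY: "(\<lambda>N. H N x \<omega>) \<longlonglongrightarrow> Y x \<omega>" if \<omega>: "\<omega> \<in> space M" for x \<omega>
  proof -
    have alive: "X t \<omega> = (if \<forall>u\<in>{0..t}. B u \<omega> \<in> D then Some (B t \<omega>) else None)" if "t \<ge> 0" for t
      using XB[OF \<omega> that] less_exit_time_iff[OF D cont[OF \<omega>] _ that] B0[OF \<omega>] x0
      by (simp add: killed_path_def)
    have "(\<lambda>N. H N x \<omega>) \<longlonglongrightarrow> (\<Prod>l<k. of_bool (\<forall>u\<in>{s l..s l + r l}. B u \<omega> \<in> D) * Q (x l) (B (s (Suc l)) \<omega>))"
      unfolding H_def
    proof (intro tendsto_intros)
      fix l
      show "(\<lambda>N. of_bool (\<forall>u\<in>{s l..s l + r l}. B u \<omega> \<in> inner_part D N)) \<longlonglongrightarrow> (of_bool (\<forall>u\<in>{s l..s l + r l}. B u \<omega> \<in> D) :: real)"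
      proof (cases "\<forall>u\<in>{s l..s l + r l}. B u \<omega> \<in> D")
        case True
        have "continuous_on {s l..s l + r l} (\<lambda>t. B t \<omega>)"
          by (rule continuous_on_subset[OF cont[OF \<omega>]]) (use s0[of l] in auto)
        then have "compact ((\<lambda>t. B t \<omega>) ` {s l..s l + r l})"
          by (rule compact_continuous_image) simp
        then have "eventually (\<lambda>N. (\<lambda>t. B t \<omega>) ` {s l..s l + r l} \<subseteq> inner_part D N) sequentially"
          by (rule compact_subset_inner_part) (use True D in auto)
        then have "eventually (\<lambda>N. of_bool (\<forall>u\<in>{s l..s l + r l}. B u \<omega> \<in> inner_part D N) = (1::real)) sequentially"
          by eventually_elim auto
        then show ?thesis using True by (simp add: tendsto_eventually)
      next
        case False
        then have "\<not> (\<forall>u\<in>{s l..s l + r l}. B u \<omega> \<in> inner_part D N)" for N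
          using inner_part_subset[of D N] by blast
        then show ?thesis using False by (simp only: of_bool_eq if_False tendsto_const)
      qed
    qed
    also have "(\<Prod>l<k. of_bool (\<forall>u\<in>{s l..s l + r l}. B u \<omega> \<in> D) * Q (x l) (B (s (Suc l)) \<omega>)) = Y x \<omega>"
    proof (cases "\<forall>l<k. \<forall>u\<in>{s l..s l + r l}. B u \<omega> \<in> D")
      case True
      have in_D: "\<forall>u\<in>{0..s l}. B u \<omega> \<in> D" if "l \<le> k" for l
        using that
      proof (induction l)
        case 0
        then show ?case using B0[OF \<omega>] x0 by (simp add: s_def)
      next
        case (Suc l)
        show ?case
        proof
          fix u assume "u \<in> {0..s (Suc l)}"
          moreover have "\<forall>u\<in>{s l..s l + r l}. B u \<omega> \<in> D" using True Suc_le_lessD[OF Suc.prems] by blast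
          moreover have "\<forall>u\<in>{0..s l}. B u \<omega> \<in> D" using Suc by simp
          ultimately show "B u \<omega> \<in> D"
            by (cases "u \<le> s l") (auto simp: sS)
        qed
      qed
      have "X (s (Suc l)) \<omega> = Some (B (s (Suc l)) \<omega>)" if "l < k" for l
        using in_D[OF Suc_leI[OF that]] unfolding alive[OF s0] by (rule if_P)
      then show ?thesis using True by (auto simp: Y_def intro!: prod.cong)
    next
      \<comment> \<open>The path leaves D during some gap. Its position at the end of that gap is
        the cemetery, where \<open>lift_killed\<close> is 0, so both products vanish.\<close>
      case False
      then obtain l where l: "l < k" "\<not> (\<forall>u\<in>{s l..s l + r l}. B u \<omega> \<in> D)" by auto
      have "X (s (Suc l)) \<omega> = None"
      proof -
        have "\<not> (\<forall>u\<in>{0..s (Suc l)}. B u \<omega> \<in> D)"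
          using l(2) s0[of l] unfolding sS by (meson atLeastAtMost_iff order_trans)
        then show ?thesis unfolding alive[OF s0] by (rule if_not_P)
      qed
      then have "Y x \<omega> = 0"
        unfolding Y_def using l(1) by (intro prod_zero) (auto intro!: bexI[of _ l])
      moreover have "(\<Prod>l<k. of_bool (\<forall>u\<in>{s l..s l + r l}. B u \<omega> \<in> D) * Q (x l) (B (s (Suc l)) \<omega>)) = 0"
        using l by (intro prod_zero) (auto intro!: bexI[of _ l])
      ultimately show ?thesis by simp
    qed
    finally show ?thesis .
  qed
  have Y_meas: "Y x \<in> borel_measurable M" for x
    by (rule borel_measurable_LIMSEQ_real[OF HY H_meas])
  have lim1: "(\<lambda>n. chain (\<kappa> N n) Q k 0 x0 x) \<longlonglongrightarrow> (LINT \<omega>|M. H N x \<omega>)" for N x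
    unfolding EG[symmetric]
    by (rule integral_dominated_convergence[where w = "\<lambda>_. b ^ k"]) (use GH G_bound H_meas G_meas in auto)
  have lim2: "(\<lambda>N. LINT \<omega>|M. H N x \<omega>) \<longlonglongrightarrow> (LINT \<omega>|M. Y x \<omega>)" for x
    by (rule integral_dominated_convergence[where w = "\<lambda>_. b ^ k"]) (use HY H_bound H_meas Y_meas in auto)
  have chain_meas: "(\<lambda>x. chain (\<kappa> N n) Q k 0 x0 x) \<in> borel_measurable (PiM {0..<k} (\<lambda>_. on_set K))" for N n
  proof -
    have pos: "r j / real (Suc n) > 0" for j using r by simp
    \<comment> \<open>Only measurability of the chain is extracted, so the trivial norm bound
      \<infinity> will do.\<close>
    interpret kernel_chain Q b K p "\<kappa> N n" r "\<lambda>_. \<infinity>"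
    proof
      fix j and y z :: 'a
      note [measurable] = killed_kernel_measurable'[OF F_borel pos]
      show "case_prod (\<kappa> N n j) \<in> borel_measurable (borel \<Otimes>\<^sub>M borel)"
        unfolding \<kappa>_def by measurable
      show "\<kappa> N n j y z \<le> heat_kernel (r j) (z - y)"
        using enn2real_killed_kernel_le[OF F_borel[of N] pos[of j], of n y z] by (simp add: \<kappa>_def del: of_nat_Suc)
      show "(\<integral>\<^sup>+z. ennreal (heat_kernel (r j) (z - y)) ^ p \<partial>lborel) \<le> \<infinity> ^ p"
        using p by (simp add: power_eq_top_ennreal top_power_ennreal)
    qed (use r in \<open>auto simp: \<kappa>_def[abs_def]\<close>)
    show ?thesis by (rule chain_measurable'[where I = "{0..<k}"]) auto
  qed
  have meas: "(\<lambda>x. LINT \<omega>|M. H N x \<omega>) \<in> borel_measurable (PiM {0..<k} (\<lambda>_. on_set K))" for N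
    by (rule borel_measurable_LIMSEQ_real[OF lim1 chain_meas])
  have tend: "(\<lambda>n. ennreal \<bar>f n\<bar> ^ p) \<longlonglongrightarrow> ennreal \<bar>l\<bar> ^ p" if "f \<longlonglongrightarrow> l" for f l
  proof -
    have "(\<lambda>n. ennreal (\<bar>f n\<bar> ^ p)) \<longlonglongrightarrow> ennreal (\<bar>l\<bar> ^ p)"
      by (intro tendsto_ennrealI tendsto_intros that)
    then show ?thesis by (simp add: ennreal_power)
  qed
  have step1: "eventually (\<lambda>N. (\<integral>\<^sup>+x. ennreal \<bar>LINT \<omega>|M. H N x \<omega>\<bar> ^ p \<partial>PiM {0..<k} (\<lambda>_. on_set K)) \<le> C) sequentially"
    using bound
  proof eventually_elim
    case (elim N)
    show ?case
      by (rule nn_integral_le_of_tendsto[where u = "\<lambda>n x. ennreal \<bar>chain (\<kappa> N n) Q k 0 x0 x\<bar> ^ p"])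
        (use elim chain_meas tend[OF lim1] in \<open>auto simp: \<kappa>_def[abs_def]\<close>)
  qed
  have "(\<integral>\<^sup>+x. ennreal \<bar>LINT \<omega>|M. Y x \<omega>\<bar> ^ p \<partial>PiM {0..<k} (\<lambda>_. on_set K)) \<le> C"
    by (rule nn_integral_le_of_tendsto[OF _ _ step1]) (use meas tend[OF lim2] in auto)
  then show ?thesis unfolding Y_def s_def .
qed

section \<open>Moment bounds at fixed times\<close>

text \<open>The power of 1/r in the L^p norm of the heat kernel at time r: d/2 from the supremum,
  times the fraction (p - 1)/p of factors replaced by it. It is below 1 exactly if d (p - 1) < 2
  p.\<close>

definition critical_exponent :: "'a::euclidean_space itself \<Rightarrow> nat \<Rightarrow> real" where
  "critical_exponent _ p = real (DIM('a) * (p - 1)) / (2 * real p)"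

text \<open>The value at \<open>0\<close> makes bounds in terms of \<open>gap_weight\<close> trivial when two times coincide,
  and the value on negative arguments restricts time integrals to ordered times.\<close>

definition gap_weight :: "real \<Rightarrow> real \<Rightarrow> ennreal" where
  "gap_weight \<gamma> r = (if r < 0 then 0 else if r = 0 then \<infinity> else ennreal (1 + r powr (- \<gamma>)))"

lemma gap_weight_measurable [measurable]: "gap_weight \<gamma> \<in> borel_measurable borel"
  unfolding gap_weight_def by measurable

lemma gap_weight_ge_1: "r \<ge> 0 \<Longrightarrow> 1 \<le> gap_weight \<gamma> r"
  by (auto simp: gap_weight_def simp flip: ennreal_1 intro!: ennreal_leI)

lemma heat_kernel_Lp:
  fixes y :: "'a::euclidean_space"
  assumes r: "r > 0" and p: "p \<ge> 1"
  shows "(\<integral>\<^sup>+z. ennreal (heat_kernel r (z - y)) ^ p \<partial>lborel)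
      \<le> ennreal (r powr (- critical_exponent TYPE('a) p)) ^ p"
proof -
  define m where "m = DIM('a) * (p - 1)"
  have "1 / sqrt (2 * pi * r) \<le> 1 / sqrt r"
    using r pi_ge_two by (intro divide_left_mono) (auto simp: mult_le_cancel_right1)
  also have "1 / sqrt r = r powr (- 1 / 2)"
    using r by (simp add: powr_half_sqrt[symmetric] powr_minus_divide)
  finally have "(1 / sqrt (2 * pi * r)) ^ m \<le> (r powr (- 1 / 2)) ^ m"
    using r by (intro power_mono) auto
  also have "\<dots> = (r powr (- critical_exponent TYPE('a) p)) ^ p"
    using r p by (simp add: powr_realpow[symmetric] powr_powr critical_exponent_def m_def)
  finally have "((1 / sqrt (2 * pi * r)) ^ DIM('a)) ^ (p - 1) \<le> (r powr (- critical_exponent TYPE('a) p)) ^ p"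
    by (simp add: m_def power_mult[symmetric])
  then have "ennreal (((1 / sqrt (2 * pi * r)) ^ DIM('a)) ^ (p - 1)) \<le> ennreal (r powr (- critical_exponent TYPE('a) p)) ^ p"
    by (subst ennreal_power) (auto intro!: ennreal_leI)
  with nn_integral_heat_kernel_power[OF r p, of y] show ?thesis by (rule order_trans)
qed

lemma powr_le_gap_weight:
  assumes "r > 0" "0 \<le> \<beta>" "\<beta> \<le> \<gamma>"
  shows "ennreal (r powr (- \<beta>)) \<le> gap_weight \<gamma> r"
proof -
  have "r powr (- \<beta>) \<le> 1 + r powr (- \<gamma>)"
  proof (cases "r \<le> 1")
    case True
    then have "r powr (- \<beta>) \<le> r powr (- \<gamma>)" using assms by (intro powr_mono') auto
    then show ?thesis by simp
  next
    case False
    then have "r powr (- \<beta>) \<le> r powr 0" using assms by (intro powr_mono) auto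
    then show ?thesis using assms by (simp add: add_increasing2)
  qed
  then show ?thesis using assms by (simp add: gap_weight_def ennreal_leI del: ennreal_plus)
qed

text \<open>The surplus of \<gamma> over \<beta> is traded for smallness: in r^(-\<beta>) =
  r^(\<gamma> - \<beta>) r^(-\<gamma>) the first factor is at most h^(\<gamma> - \<beta>).\<close>

lemma powr_le_small_gap_weight:
  assumes "0 < r" "r < h" "\<beta> \<le> \<gamma>"
  shows "ennreal (r powr (- \<beta>)) \<le> ennreal (h powr (\<gamma> - \<beta>)) * gap_weight \<gamma> r"
proof -
  have "r powr (- \<beta>) = r powr (\<gamma> - \<beta>) * r powr (- \<gamma>)"
    using assms by (simp add: powr_add[symmetric])
  also have "\<dots> \<le> h powr (\<gamma> - \<beta>) * (1 + r powr (- \<gamma>))"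
    using assms by (intro mult_mono powr_mono2) auto
  finally show ?thesis
    using assms by (simp add: gap_weight_def ennreal_mult'[symmetric] ennreal_leI del: ennreal_plus)
qed

lemma killed_kernel_chain:
  fixes F :: "nat \<Rightarrow> 'a::euclidean_space set"
  assumes Q: "mollifier Q b K p" and F: "\<And>N. F N \<in> sets borel" and r: "\<And>l. r l > 0"
    and \<gamma>: "critical_exponent TYPE('a) p \<le> \<gamma>"
  shows "kernel_chain Q b K p (\<lambda>l y z. enn2real (killed_kernel (F N) (r l / real (Suc n)) n y z)) r
     (\<lambda>l. gap_weight \<gamma> (r l))"
proof -
  interpret mollifier Q b K p by fact
  have pos: "r l / real (Suc n) > 0" for l using r by simp
  show ?thesis
  proof
    fix l and y z :: 'a
    note [measurable] = killed_kernel_measurable'[OF F pos]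
    show "(\<lambda>(y, z). enn2real (killed_kernel (F N) (r l / real (Suc n)) n y z)) \<in> borel_measurable (borel \<Otimes>\<^sub>M borel)"
      by measurable
    show "enn2real (killed_kernel (F N) (r l / real (Suc n)) n y z) \<le> heat_kernel (r l) (z - y)"
      using enn2real_killed_kernel_le[OF F[of N] pos[of l], of n y z] by (simp del: of_nat_Suc)
    have "(\<integral>\<^sup>+z. ennreal (heat_kernel (r l) (z - y)) ^ p \<partial>lborel)
      \<le> ennreal (r l powr (- critical_exponent TYPE('a) p)) ^ p"
      by (rule heat_kernel_Lp[OF r p])
    also have "\<dots> \<le> gap_weight \<gamma> (r l) ^ p"
      using r \<gamma> by (intro power_mono powr_le_gap_weight) (auto simp: critical_exponent_def)
    finally show "(\<integral>\<^sup>+z. ennreal (heat_kernel (r l) (z - y)) ^ p \<partial>lborel) \<le> gap_weight \<gamma> (r l) ^ p" .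
  qed (use r in auto)
qed

text \<open>The k-point function of one process, seen through Q. Times and space points are separate
  arguments because Hoelder's inequality acts on the points while the times are frozen.\<close>

definition joint_moment :: "'w measure \<Rightarrow> (real \<Rightarrow> 'w \<Rightarrow> 'a option) \<Rightarrow> ('a \<Rightarrow> 'a \<Rightarrow> real)
    \<Rightarrow> nat \<Rightarrow> (nat \<Rightarrow> real) \<Rightarrow> (nat \<Rightarrow> 'a) \<Rightarrow> real" where
  "joint_moment M X Q k s x = (LINT \<omega>|M. (\<Prod>l<k. lift_killed Q (x l) (X (s l) \<omega>)))"

text \<open>The bound without cancellation. It serves the processes that carry a plain ball density
  in the telescoping sum, and also the difference of two densities when \<epsilon> is not
  small.\<close>

lemma joint_moment_abs_bound:
  fixes D :: "'a::euclidean_space set"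
  assumes "prob_space M" "open D" "x0 \<in> D" "killed_brownian_motion M D x0 X"
    and Q: "mollifier Q b K p" and r: "\<And>l. r l > 0"
    and \<gamma>: "critical_exponent TYPE('a) p \<le> \<gamma>"
  shows "(\<integral>\<^sup>+x. ennreal \<bar>joint_moment M X Q k (\<lambda>l. sum r {..<Suc l}) x\<bar> ^ p \<partial>PiM {0..<k} (\<lambda>_. on_set K))
     \<le> (2 ^ k * (\<Prod>l<k. gap_weight \<gamma> (r l))) ^ p"
  unfolding joint_moment_def
proof (rule killed_moment_bound[OF assms(1-4) Q r], intro always_eventually allI)
  fix N n
  have F: "inner_part D N \<in> sets borel" for N by (simp add: borel_closed closed_inner_part)
  interpret kernel_chain Q b K p "\<lambda>l y z. enn2real (killed_kernel (inner_part D N) (r l / real (Suc n)) n y z)" r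
    "\<lambda>l. gap_weight \<gamma> (r l)"
    by (rule killed_kernel_chain[OF Q F r \<gamma>])
  show "(\<integral>\<^sup>+x. ennreal \<bar>chain (\<lambda>l y z. enn2real (killed_kernel (inner_part D N) (r l / real (Suc n)) n y z)) Q k 0 x0 x\<bar> ^ p
      \<partial>PiM {0..<k} (\<lambda>_. on_set K)) \<le> (2 ^ k * (\<Prod>l<k. gap_weight \<gamma> (r l))) ^ p"
    using chain_abs_bound[where n = k and j = 0 and y = x0] by (simp add: prod.distrib atLeast0LessThan)
qed

text \<open>Of the distance 3 \<rho>, one third is spent on the way from x to w and another on the
  way from v to a point outside D.\<close>

lemma inner_part_distance:
  fixes D :: "'a::euclidean_space set"
  assumes far: "\<And>x z. x \<in> K \<Longrightarrow> z \<notin> D \<Longrightarrow> 3 * \<rho> \<le> dist x z"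
    and "x \<in> K" "dist x w < \<rho>" "v \<notin> inner_part D N" "1 / real (Suc N) < \<rho>"
  shows "\<rho> \<le> dist w v"
proof -
  obtain z where z: "z \<notin> D" "dist v z < 1 / real (Suc N)"
    using assms(4) by (auto simp: inner_part_def not_le)
  have "3 * \<rho> \<le> dist x z" using far assms(2) z(1) by blast
  also have "\<dots> \<le> dist x w + (dist w v + dist v z)"
    using dist_triangle[of x z w] dist_triangle[of w z v] by linarith
  finally show ?thesis using assms(3,5) z(2) by linarith
qed

text \<open>The last two assumptions say that \<Lambda> dominates the gain of a gap shorter than h
  and the oscillation across gaps of length at least h. Once h is fixed, the latter is linear in
  \<epsilon>.\<close>

lemma joint_moment_small_bound:
  fixes D :: "'a::euclidean_space set"
  assumes MX: "prob_space M" "open D" "x0 \<in> D" "killed_brownian_motion M D x0 X"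
    and Q: "mollifier Q b K p" and p2: "p \<ge> 2" and r: "\<And>l. r l > 0"
    and \<gamma>: "critical_exponent TYPE('a) p < \<gamma>"
    and \<rho>: "\<rho> > 0" and far: "\<And>x z. x \<in> K \<Longrightarrow> z \<notin> D \<Longrightarrow> 3 * \<rho> \<le> dist x z"
    and \<epsilon>: "0 < \<epsilon>" "\<epsilon> < \<rho>" and h: "0 < h" 
    and supp: "\<And>x y. y \<notin> ball x \<epsilon> \<Longrightarrow> Q x y = 0" and zero: "\<And>x. (LINT y|lborel. Q x y) = 0"
    and hL: "h powr (\<gamma> - critical_exponent TYPE('a) p) \<le> \<Lambda>"
    and eL: "(measure lborel K + 1) * (2 * (1 / sqrt (2 * pi * h)) ^ DIM('a) *
        (((1 / sqrt h) * (1 / sqrt (2 * pi * h)) ^ DIM('a)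
          + (2 / \<rho> * (1 / \<rho>) ^ DIM('a) * (exp 1 * fact (Suc DIM('a))))) * \<epsilon>)) \<le> \<Lambda>"
  shows "(\<integral>\<^sup>+x. ennreal \<bar>joint_moment M X Q (2 * m) (\<lambda>l. sum r {..<Suc l}) x\<bar> ^ p \<partial>PiM {0..<2 * m} (\<lambda>_. on_set K))
     \<le> (ennreal \<Lambda> ^ m * 2 ^ (2 * m) * (\<Prod>l<2 * m. gap_weight \<gamma> (r l))) ^ p"
proof -
  interpret mollifier Q b K p by fact
  \<comment> \<open>Supremum \<open>c\<close> and Lipschitz constant \<open>ch\<close> of the heat
    kernels at times \<ge> h, and the Lipschitz constant \<open>cr\<close> of the part removed by
    killing. Together they control the oscillation over an \<epsilon>-ball.\<close>
  define c where "c = (1 / sqrt (2 * pi * h)) ^ DIM('a)"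
  define ch where "ch = (1 / sqrt h) * (1 / sqrt (2 * pi * h)) ^ DIM('a)"
  define cr where "cr = (2 / \<rho> * (1 / \<rho>) ^ DIM('a) * (exp 1 * fact (Suc DIM('a))))"
  define \<eta> where "\<eta> = (ch + cr) * \<epsilon>"
  have c0: "c \<ge> 0" "ch \<ge> 0" "cr \<ge> 0" using h \<rho> by (auto simp: c_def ch_def cr_def)
  have \<eta>0: "\<eta> \<ge> 0" using c0 \<epsilon> by (simp add: \<eta>_def)
  have \<Lambda>: "(measure lborel K + 1) * (2 * c * \<eta>) \<le> \<Lambda>"
    using eL by (simp add: c_def \<eta>_def ch_def cr_def)
  have \<Lambda>0: "\<Lambda> \<ge> 0" using hL powr_ge_zero order_trans by blast
  have F: "inner_part D N \<in> sets borel" for N by (simp add: borel_closed closed_inner_part)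
  have "eventually (\<lambda>N. 1 / real (Suc N) < \<rho>) sequentially"
    using LIMSEQ_Suc[OF lim_const_over_n] \<rho> by (rule order_tendstoD)
  then have ev: "eventually (\<lambda>N. \<forall>n. (\<integral>\<^sup>+x. ennreal \<bar>chain (\<lambda>l y z. enn2real
        (killed_kernel (inner_part D N) (r l / real (Suc n)) n y z)) Q (2 * m) 0 x0 x\<bar> ^ p
        \<partial>PiM {0..<2 * m} (\<lambda>_. on_set K)) \<le> (ennreal \<Lambda> ^ m * 2 ^ (2 * m) * (\<Prod>l<2 * m. gap_weight \<gamma> (r l))) ^ p) sequentially"
  proof (eventually_elim, intro allI)
    fix N n assume N: "1 / real (Suc N) < \<rho>"
    define \<kappa> where "\<kappa> l y z = enn2real (killed_kernel (inner_part D N) (r l / real (Suc n)) n y z)" for l y z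
    interpret kernel_chain Q b K p \<kappa> r "\<lambda>l. gap_weight \<gamma> (r l)"
      unfolding \<kappa>_def[abs_def] by (rule killed_kernel_chain[OF Q F r less_imp_le[OF \<gamma>]])
    have pos: "r l / real (Suc n) > 0" and tot: "real (Suc n) * (r l / real (Suc n)) = r l" for l
      using r by auto
    have osc: "\<bar>\<kappa> l w z - \<kappa> l x z\<bar> \<le> \<eta>" if hr: "h \<le> r l" and x: "x \<in> K" and w: "w \<in> ball x \<epsilon>" for l x w z
    proof -
      have w': "dist x w < \<epsilon>" using w by simp
      have "\<bar>\<kappa> l w z - \<kappa> l x z\<bar> \<le> \<bar>heat_kernel (r l) (z - w) - heat_kernel (r l) (z - x)\<bar> + cr * dist w x"
        unfolding \<kappa>_def cr_def
        using killed_kernel_oscillation[OF F pos \<rho>, of N w x l n z] inner_part_distance[of K D \<rho> x, OF far x] w' \<epsilon> N \<rho>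
        by (simp add: tot del: of_nat_Suc)
      also have "\<dots> \<le> ch * norm (z - w - (z - x)) + cr * dist w x"
        unfolding ch_def by (intro add_mono order_refl heat_kernel_Lipschitz_of_ge h hr)
      also have "norm (z - w - (z - x)) = dist w x" by (simp add: dist_norm norm_minus_commute)
      also have "ch * dist w x + cr * dist w x \<le> \<eta>"
        unfolding \<eta>_def using w' c0
        by (auto simp: distrib_right[symmetric] dist_commute intro!: mult_left_mono)
      finally show ?thesis .
    qed
    have sym: "\<kappa> l y z = \<kappa> l z y" for l y z
      unfolding \<kappa>_def by (simp only: killed_kernel_commute[OF F pos, of N l n y z])
    interpret cancelling_chain Q b K p \<kappa> r "\<lambda>l. gap_weight \<gamma> (r l)" \<epsilon> h c \<eta> "ennreal \<Lambda>"
    proof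
      fix l and x y z w :: 'a
      show "1 \<le> gap_weight \<gamma> (r l)" using r[of l] by (intro gap_weight_ge_1) simp
      show "(\<integral>\<^sup>+z. ennreal (heat_kernel (r l) (z - y)) ^ p \<partial>lborel) \<le> (ennreal \<Lambda> * gap_weight \<gamma> (r l)) ^ p"
        if "r l < h"
      proof -
        have "(\<integral>\<^sup>+z. ennreal (heat_kernel (r l) (z - y)) ^ p \<partial>lborel)
          \<le> ennreal (r l powr (- critical_exponent TYPE('a) p)) ^ p"
          using p by (intro heat_kernel_Lp r) simp
        also have "\<dots> \<le> (ennreal (h powr (\<gamma> - critical_exponent TYPE('a) p)) * gap_weight \<gamma> (r l)) ^ p"
          using that r \<gamma> by (intro power_mono powr_le_small_gap_weight) auto
        also have "\<dots> \<le> (ennreal \<Lambda> * gap_weight \<gamma> (r l)) ^ p"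
          using hL by (intro power_mono mult_right_mono ennreal_leI) auto
        finally show ?thesis .
      qed
      show "\<kappa> l y z \<le> c" if "h \<le> r l"
        using \<kappa>_le[of l y z] heat_kernel_le_of_ge[OF h that, of "z - y"] unfolding c_def by (rule order_trans)
      show "emeasure lborel K ^ 2 * ennreal (2 * c * \<eta>) ^ p \<le> ennreal \<Lambda> ^ p"
      proof -
        define X where "X = 2 * c * \<eta>"
        define V where "V = measure lborel K"
        have X0: "X \<ge> 0" "V \<ge> 0" using c0 \<eta>0 by (auto simp: X_def V_def)
        \<comment> \<open>The squared volume must be absorbed into a p-th power. Adding 1 makes the
          base at least 1, so that p \<ge> 2 suffices, however small the volume is.\<close>
        have "V ^ 2 \<le> (V + 1) ^ 2" using X0 by (intro power_mono) auto
        also have "\<dots> \<le> (V + 1) ^ p" using p2 X0 by (intro power_increasing) auto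
        finally have "V ^ 2 * X ^ p \<le> ((V + 1) * X) ^ p"
          using X0 by (simp add: power_mult_distrib mult_right_mono)
        also have "\<dots> \<le> \<Lambda> ^ p"
          using \<Lambda> X0 by (intro power_mono) (auto simp: X_def V_def)
        finally have "ennreal (V ^ 2 * X ^ p) \<le> ennreal (\<Lambda> ^ p)" by (rule ennreal_leI)
        moreover have "emeasure lborel K = ennreal V"
          using K_finite by (simp add: V_def emeasure_eq_ennreal_measure)
        ultimately show ?thesis
          using X0 \<Lambda>0 by (simp add: ennreal_power ennreal_mult'[symmetric] X_def[symmetric])
      qed
      show "\<bar>\<kappa> l w z - \<kappa> l x z\<bar> \<le> \<eta>" if "h \<le> r l" "x \<in> K" "w \<in> ball x \<epsilon>"
        by (rule osc[OF that])
      show "\<bar>\<kappa> l y w - \<kappa> l y x\<bar> \<le> \<eta>" if "h \<le> r l" "x \<in> K" "w \<in> ball x \<epsilon>"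
        unfolding sym[of l y] by (rule osc[OF that])
    qed (use supp zero c0 \<eta>0 in auto)
    show "(\<integral>\<^sup>+x. ennreal \<bar>chain (\<lambda>l y z. enn2real
        (killed_kernel (inner_part D N) (r l / real (Suc n)) n y z)) Q (2 * m) 0 x0 x\<bar> ^ p
        \<partial>PiM {0..<2 * m} (\<lambda>_. on_set K)) \<le> (ennreal \<Lambda> ^ m * 2 ^ (2 * m) * (\<Prod>l<2 * m. gap_weight \<gamma> (r l))) ^ p"
      using chain_cancel_bound[where m = m and j = 0 and y = x0] unfolding \<kappa>_def[abs_def]
      by (simp add: prod.distrib atLeast0LessThan mult.assoc)
  qed
  show ?thesis
    unfolding joint_moment_def by (rule killed_moment_bound[OF MX Q r ev])
qed

section \<open>Integration over the times\<close>

lemma nn_integral_PiM_permute: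
  fixes f :: "('i \<Rightarrow> 'b) \<Rightarrow> ennreal"
  assumes \<mu>: "sigma_finite_measure \<mu>" and I: "finite I" and \<sigma>: "\<sigma> permutes I"
    and f: "f \<in> borel_measurable (PiM I (\<lambda>_. \<mu>))"
  shows "(\<integral>\<^sup>+x. f (restrict (x \<circ> \<sigma>) I) \<partial>PiM I (\<lambda>_. \<mu>)) = (\<integral>\<^sup>+x. f x \<partial>PiM I (\<lambda>_. \<mu>))"
proof -
  interpret product_sigma_finite "\<lambda>_::'i. \<mu>"
    using \<mu> by (simp add: product_sigma_finite_def)
  let ?P = "PiM I (\<lambda>_. \<mu>)"
  have T[measurable]: "(\<lambda>x. restrict (x \<circ> \<sigma>) I) \<in> measurable ?P ?P"
  proof (rule measurable_restrict)
    fix i assume "i \<in> I"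
    then show "(\<lambda>x. (x \<circ> \<sigma>) i) \<in> measurable ?P \<mu>"
      using permutes_in_image[OF \<sigma>, of i] by simp
  qed
  have "distr ?P ?P (\<lambda>x. restrict (x \<circ> \<sigma>) I) = ?P"
  proof (rule PiM_eqI[OF I])
    fix A assume A: "\<And>i. i \<in> I \<Longrightarrow> A i \<in> sets \<mu>"
    have inv: "inv \<sigma> permutes I" by (rule permutes_inv[OF \<sigma>])
    have "(\<lambda>x. restrict (x \<circ> \<sigma>) I) -` Pi\<^sub>E I A \<inter> space ?P = Pi\<^sub>E I (A \<circ> inv \<sigma>)"
    proof (intro set_eqI iffI)
      fix x assume x: "x \<in> (\<lambda>x. restrict (x \<circ> \<sigma>) I) -` Pi\<^sub>E I A \<inter> space ?P"
      show "x \<in> Pi\<^sub>E I (A \<circ> inv \<sigma>)"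
      proof (rule PiE_I)
        fix i assume "i \<in> I"
        then have "inv \<sigma> i \<in> I" using permutes_in_image[OF inv] by simp
        then have "x (\<sigma> (inv \<sigma> i)) \<in> A (inv \<sigma> i)" using x by (simp add: PiE_iff)
        then show "x i \<in> (A \<circ> inv \<sigma>) i" by (simp only: permutes_inverses[OF \<sigma>] comp_def)
      next
        fix i assume "i \<notin> I"
        then show "x i = undefined" using x by (simp add: space_PiM PiE_iff extensional_def)
      qed
    next
      fix x assume x: "x \<in> Pi\<^sub>E I (A \<circ> inv \<sigma>)"
      have "x (\<sigma> i) \<in> A i" if "i \<in> I" for i
      proof -
        have "\<sigma> i \<in> I" using permutes_in_image[OF \<sigma>] that by simp
        then have "x (\<sigma> i) \<in> A (inv \<sigma> (\<sigma> i))" using x by (simp add: PiE_iff)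
        then show ?thesis by (simp only: permutes_inverses[OF \<sigma>])
      qed
      moreover have "x \<in> space ?P"
        unfolding space_PiM
      proof (rule PiE_I)
        fix i assume "i \<in> I"
        then have "x i \<in> A (inv \<sigma> i)" "inv \<sigma> i \<in> I"
          using x permutes_in_image[OF inv, of i] by (simp_all add: PiE_iff)
        then show "x i \<in> space \<mu>" using sets.sets_into_space[OF A] by blast
      next
        fix i assume "i \<notin> I"
        then show "x i = undefined" using x by (simp add: PiE_iff extensional_def)
      qed
      ultimately show "x \<in> (\<lambda>x. restrict (x \<circ> \<sigma>) I) -` Pi\<^sub>E I A \<inter> space ?P"
        by (simp add: PiE_iff)
    qed
    then have "emeasure (distr ?P ?P (\<lambda>x. restrict (x \<circ> \<sigma>) I)) (Pi\<^sub>E I A) = emeasure ?P (Pi\<^sub>E I (A \<circ> inv \<sigma>))"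
      by (subst emeasure_distr[OF T sets_PiM_I_finite[OF I A]]) simp_all
    also have "\<dots> = (\<Prod>i\<in>I. emeasure \<mu> ((A \<circ> inv \<sigma>) i))"
      by (rule emeasure_PiM[OF I]) (use permutes_in_image[OF inv] A in simp)
    also have "\<dots> = (\<Prod>i\<in>I. emeasure \<mu> (A i))"
      using prod.permute[OF inv, of "\<lambda>i. emeasure \<mu> (A i)"] by (simp add: comp_def)
    finally show "emeasure (distr ?P ?P (\<lambda>x. restrict (x \<circ> \<sigma>) I)) (Pi\<^sub>E I A) = (\<Prod>i\<in>I. emeasure \<mu> (A i))" .
  qed simp
  then have "(\<integral>\<^sup>+x. f x \<partial>?P) = (\<integral>\<^sup>+x. f x \<partial>distr ?P ?P (\<lambda>x. restrict (x \<circ> \<sigma>) I))" by simp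
  also have "\<dots> = (\<integral>\<^sup>+x. f (restrict (x \<circ> \<sigma>) I) \<partial>?P)"
    using f by (intro nn_integral_distr) auto
  finally show ?thesis ..
qed

lemma exists_sorting_permutation:
  fixes s :: "nat \<Rightarrow> 'b::linorder"
  shows "\<exists>\<sigma>. \<sigma> permutes {0..<k} \<and> (\<forall>i j. i \<le> j \<longrightarrow> j < k \<longrightarrow> s (\<sigma> i) \<le> s (\<sigma> j))"
proof -
  define xs where "xs = sort_key s [0..<k]"
  define \<sigma> where "\<sigma> i = (if i < k then xs ! i else i)" for i
  have xs: "distinct xs" "set xs = {0..<k}" "length xs = k" "sorted (map s xs)"
    by (auto simp: xs_def)
  have "bij_betw \<sigma> {0..<k} {0..<k}"
  proof -
    have "bij_betw (\<lambda>i. xs ! i) {0..<k} {0..<k}"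
      using bij_betw_nth[OF xs(1), of "{0..<k}" "{0..<k}"] xs by (simp add: atLeast0LessThan)
    then show ?thesis
      by (rule bij_betw_cong[THEN iffD1, rotated]) (simp add: \<sigma>_def)
  qed
  then have "\<sigma> permutes {0..<k}"
    by (rule bij_imp_permutes) (simp add: \<sigma>_def)
  moreover have "s (\<sigma> i) \<le> s (\<sigma> j)" if "i \<le> j" "j < k" for i j
    using sorted_nth_mono[OF xs(4), of i j] that xs(3) by (simp add: \<sigma>_def)
  ultimately show ?thesis by blast
qed

text \<open>The measures \<open>on_set {0..t}\<close> are carried by all of the real line, so
  negative times are moved to 0, as in \<open>X (max 0 s)\<close>. The first gap is counted from the
  starting time 0.\<close>

definition time_gap :: "(nat \<Rightarrow> real) \<Rightarrow> nat \<Rightarrow> real" where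
  "time_gap s l = max 0 (s l) - (if l = 0 then 0 else max 0 (s (l - 1)))"

definition time_weight :: "real \<Rightarrow> nat \<Rightarrow> (nat \<Rightarrow> real) \<Rightarrow> ennreal" where
  "time_weight \<gamma> k s = (\<Prod>l<k. gap_weight \<gamma> (time_gap s l))"

text \<open>\<open>time_weight\<close> vanishes at unordered times. Summing over all reorderings
  dominates the weight of the sorted times without any measurable choice of a sorting
  permutation.\<close>

definition symmetrized_weight :: "real \<Rightarrow> nat \<Rightarrow> (nat \<Rightarrow> real) \<Rightarrow> ennreal" where
  "symmetrized_weight \<gamma> k s = (\<Sum>\<sigma> | \<sigma> permutes {0..<k}. time_weight \<gamma> k (s \<circ> \<sigma>))"

text \<open>Contribution of one time gap after exponential damping. It is bounded by the sum of two
  Gamma integrals, 1 + Gamma(1 - \<gamma>), and so finite for \<gamma> < 1.\<close>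

definition time_constant :: "real \<Rightarrow> ennreal" where
  "time_constant \<gamma> = (\<integral>\<^sup>+r. gap_weight \<gamma> r * ennreal (exp (- r)) \<partial>lborel)"

lemma time_constant_finite:
  assumes "\<gamma> < 1"
  shows "time_constant \<gamma> < \<infinity>"
proof -
  have "time_constant \<gamma> \<le> (\<integral>\<^sup>+r. ennreal (indicator {0..} r * r powr (1 - 1) / exp r)
      + ennreal (indicator {0..} r * r powr ((1 - \<gamma>) - 1) / exp r) \<partial>lborel)"
    unfolding time_constant_def
  proof (rule nn_integral_mono_AE)
    have "AE r in lborel. r \<noteq> (0::real)" by (rule AE_lborel_singleton)
    then show "AE r in lborel. gap_weight \<gamma> r * ennreal (exp (- r))
      \<le> ennreal (indicator {0..} r * r powr (1 - 1) / exp r)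
      + ennreal (indicator {0..} r * r powr ((1 - \<gamma>) - 1) / exp r)"
    proof eventually_elim
      case (elim r)
      show ?case
      proof (cases "r < 0")
        case False
        then have r: "r > 0" using elim by simp
        then have "gap_weight \<gamma> r * ennreal (exp (- r)) = ennreal ((1 + r powr (- \<gamma>)) * exp (- r))"
          by (simp add: gap_weight_def ennreal_mult'[symmetric] del: ennreal_plus)
        also have "(1 + r powr (- \<gamma>)) * exp (- r) = r powr (1 - 1) / exp r + r powr ((1 - \<gamma>) - 1) / exp r"
          using r by (simp add: exp_minus field_simps)
        also have "ennreal \<dots> = ennreal (r powr (1 - 1) / exp r) + ennreal (r powr ((1 - \<gamma>) - 1) / exp r)"
          by (intro ennreal_plus) auto
        finally show ?thesis using r by simp
      qed (simp add: gap_weight_def)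
    qed
  qed
  also have "\<dots> = ennreal (Gamma 1) + ennreal (Gamma (1 - \<gamma>))"
    using assms by (subst nn_integral_add) (auto simp only: Gamma_conv_nn_integral_real zero_less_one diff_gt_0_iff_gt, measurable)
  also have "\<dots> < \<infinity>" by simp
  finally show ?thesis .
qed

lemma component_measurable:
  "l \<in> I \<Longrightarrow> (\<lambda>s. s l) \<in> borel_measurable (PiM I (\<lambda>_. on_set K))"
  using measurable_component_singleton[of l I "\<lambda>_. on_set K"]
  by (subst (asm) measurable_cong_sets[OF refl sets_on_set])

context
  fixes t :: real and \<gamma> :: real
  assumes t: "t \<ge> 0"
begin

interpretation T: finite_measure "on_set {0..t}"
  by (rule finite_measure_on_set) (use t in simp_all)

interpretation TP: product_sigma_finite "\<lambda>_::nat. on_set {0..t}"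
  by standard



lemma time_gap_measurable:
  assumes "{0..<k} \<subseteq> I" "l < k"
  shows "(\<lambda>s. time_gap s l) \<in> borel_measurable (PiM I (\<lambda>_. on_set {0..t}))"
proof -
  have "l \<in> I" "l - 1 \<in> I" using assms by auto
  note [measurable] = component_measurable[OF \<open>l \<in> I\<close>, of "{0..t}"]
      component_measurable[OF \<open>l - 1 \<in> I\<close>, of "{0..t}"]
  show ?thesis unfolding time_gap_def by measurable
qed

lemma time_weight_measurable:
  "(\<lambda>s. time_weight \<gamma> k s) \<in> borel_measurable (PiM {0..<k} (\<lambda>_. on_set {0..t}))"
  unfolding time_weight_def
  by (intro borel_measurable_prod_ennreal measurable_compose[OF time_gap_measurable[OF order_refl] gap_weight_measurable]) simp

lemma time_gap_cong: "(\<And>i. i \<le> l \<Longrightarrow> s i = s' i) \<Longrightarrow> time_gap s l = time_gap s' l"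
  by (simp add: time_gap_def)

lemma time_weight_cong: "(\<And>i. i < k \<Longrightarrow> s i = s' i) \<Longrightarrow> time_weight \<gamma> k s = time_weight \<gamma> k s'"
  unfolding time_weight_def
proof (rule prod.cong[OF refl])
  fix l assume eq: "\<And>i. i < k \<Longrightarrow> s i = s' i" and "l \<in> {..<k}"
  then have "time_gap s l = time_gap s' l" by (intro time_gap_cong eq) simp
  then show "gap_weight \<gamma> (time_gap s l) = gap_weight \<gamma> (time_gap s' l)" by simp
qed

lemma damped_time_weight_integral:
  "(\<integral>\<^sup>+s. (\<Prod>l<k. gap_weight \<gamma> (time_gap s l) * ennreal (exp (- time_gap s l))) \<partial>PiM {0..<k} (\<lambda>_. on_set {0..t}))
     \<le> time_constant \<gamma> ^ k"
proof (induction k)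
  case 0
  then show ?case by (simp add: TP.nn_integral_empty del: nn_integral_const)
next
  case (Suc k)
  let ?w = "\<lambda>s l. gap_weight \<gamma> (time_gap s l) * ennreal (exp (- time_gap s l))"
  let ?P = "PiM {0..<k} (\<lambda>_. on_set {0..t})"
  have I: "{0..<Suc k} = insert k {0..<k}" by auto
  have m: "(\<lambda>s. ?w s l) \<in> borel_measurable (PiM I (\<lambda>_. on_set {0..t}))" if "{0..<n} \<subseteq> I" "l < n" for l n I
  proof -
    note [measurable] = time_gap_measurable[OF that]
    show ?thesis by measurable
  qed
  have "(\<integral>\<^sup>+s. (\<Prod>l<Suc k. ?w s l) \<partial>PiM {0..<Suc k} (\<lambda>_. on_set {0..t}))
    = (\<integral>\<^sup>+s. \<integral>\<^sup>+y. (\<Prod>l<Suc k. ?w (s(k := y)) l) \<partial>on_set {0..t} \<partial>?P)"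
    unfolding I
    by (intro TP.product_nn_integral_insert borel_measurable_prod_ennreal m[of "Suc k"]) auto
  also have "\<dots> \<le> (\<integral>\<^sup>+s. (\<Prod>l<k. ?w s l) * time_constant \<gamma> \<partial>?P)"
  proof (intro nn_integral_mono)
    fix s :: "nat \<Rightarrow> real"
    define a where "a = (if k = 0 then 0 else max 0 (s (k - 1)))"
    have "(\<Prod>l<Suc k. ?w (s(k := y)) l) = (\<Prod>l<k. ?w s l) * (gap_weight \<gamma> (max 0 y - a) * ennreal (exp (- (max 0 y - a))))" for y
    proof -
      have "time_gap (s(k := y)) l = time_gap s l" if "l < k" for l
        using that by (intro time_gap_cong) auto
      moreover have "time_gap (s(k := y)) k = max 0 y - a" by (simp add: time_gap_def a_def)
      ultimately show ?thesis by simp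
    qed
    then have "(\<integral>\<^sup>+y. (\<Prod>l<Suc k. ?w (s(k := y)) l) \<partial>on_set {0..t})
      = (\<integral>\<^sup>+y. (\<Prod>l<k. ?w s l) * (gap_weight \<gamma> (max 0 y - a) * ennreal (exp (- (max 0 y - a)))) \<partial>on_set {0..t})"
      by (rule nn_integral_cong)
    also have "\<dots> = (\<Prod>l<k. ?w s l) * (\<integral>\<^sup>+y. gap_weight \<gamma> (max 0 y - a) * ennreal (exp (- (max 0 y - a))) \<partial>on_set {0..t})"
      by (rule nn_integral_cmult) measurable
    also have "\<dots> \<le> (\<Prod>l<k. ?w s l) * time_constant \<gamma>"
    proof (rule mult_left_mono)
      have "(\<integral>\<^sup>+y. gap_weight \<gamma> (max 0 y - a) * ennreal (exp (- (max 0 y - a))) \<partial>on_set {0..t})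
        = (\<integral>\<^sup>+y. gap_weight \<gamma> (max 0 y - a) * ennreal (exp (- (max 0 y - a))) * indicator {0..t} y \<partial>lborel)"
        by (rule nn_integral_on_set) measurable
      also have "\<dots> \<le> (\<integral>\<^sup>+y. gap_weight \<gamma> (y - a) * ennreal (exp (- (y - a))) \<partial>lborel)"
      proof (rule nn_integral_mono)
        fix y
        show "gap_weight \<gamma> (max 0 y - a) * ennreal (exp (- (max 0 y - a))) * indicator {0..t} y
            \<le> gap_weight \<gamma> (y - a) * ennreal (exp (- (y - a)))"
          by (cases "y \<in> {0..t}") (auto simp: max_def)
      qed
      also have "\<dots> = time_constant \<gamma>"
        unfolding time_constant_def by (rule nn_integral_lborel_shift) measurable
      finally show "(\<integral>\<^sup>+y. gap_weight \<gamma> (max 0 y - a) * ennreal (exp (- (max 0 y - a))) \<partial>on_set {0..t}) \<le> time_constant \<gamma>" .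
    qed simp
    finally show "(\<integral>\<^sup>+y. (\<Prod>l<Suc k. ?w (s(k := y)) l) \<partial>on_set {0..t}) \<le> (\<Prod>l<k. ?w s l) * time_constant \<gamma>" .
  qed
  also have "\<dots> = (\<integral>\<^sup>+s. (\<Prod>l<k. ?w s l) \<partial>?P) * time_constant \<gamma>"
    using m[of k "{0..<k}"] by (intro nn_integral_multc borel_measurable_prod_ennreal) auto
  also have "\<dots> \<le> time_constant \<gamma> ^ k * time_constant \<gamma>"
    by (intro mult_right_mono Suc) auto
  finally show ?case by (simp add: mult.commute)
qed

text \<open>The gaps telescope to the last time, which is at most t almost everywhere. Inserting the
  damping therefore costs a single factor exp t, not one for each time.\<close>

lemma time_weight_integral:
  "(\<integral>\<^sup>+s. time_weight \<gamma> k s \<partial>PiM {0..<k} (\<lambda>_. on_set {0..t})) \<le> ennreal (exp t) * time_constant \<gamma> ^ k"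
proof -
  let ?w = "\<lambda>s l. gap_weight \<gamma> (time_gap s l) * ennreal (exp (- time_gap s l))"
  let ?P = "PiM {0..<k} (\<lambda>_. on_set {0..t})"
  \<comment> \<open>The product measure lives on all real sequences; a coordinate beyond t describes
    a rectangle with one side of measure 0.\<close>
  have ae: "AE s in ?P. \<forall>l<k. s l \<le> t"
  proof -
    have "AE s in ?P. s l \<le> t" if "l < k" for l
    proof -
      have "AE y in on_set {0..t}. y \<le> t"
        unfolding on_set_def by (subst AE_density) (auto split: split_indicator)
      then have "emeasure (on_set {0..t}) {y. \<not> y \<le> t} = 0"
        by (subst (asm) AE_iff_measurable[OF _ refl]) auto
      moreover have "{s \<in> space ?P. \<not> s l \<le> t} = Pi\<^sub>E {0..<k} (\<lambda>i. if i = l then {y. \<not> y \<le> t} else UNIV)"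
        using that by (auto simp: space_PiM PiE_iff extensional_def split: if_splits)
      moreover have "emeasure ?P (Pi\<^sub>E {0..<k} (\<lambda>i. if i = l then {y. \<not> y \<le> t} else UNIV))
          = (\<Prod>i\<in>{0..<k}. emeasure (on_set {0..t}) (if i = l then {y. \<not> y \<le> t} else UNIV))"
        by (rule TP.emeasure_PiM) auto
      moreover have "(\<Prod>i\<in>{0..<k}. emeasure (on_set {0..t}) (if i = l then {y. \<not> y \<le> t} else UNIV)) = 0"
        using that calculation(1) by (intro prod_zero) (auto intro!: bexI[of _ l])
      ultimately have "emeasure ?P {s \<in> space ?P. \<not> s l \<le> t} = 0" by simp
      moreover have "{s \<in> space ?P. \<not> s l \<le> t} \<in> sets ?P"
      proof -
        have [measurable]: "(\<lambda>s. s l) \<in> borel_measurable ?P" using that by (intro component_measurable) auto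
        show ?thesis by measurable
      qed
      ultimately show ?thesis by (subst AE_iff_measurable[OF _ refl]) auto
    qed
    then show ?thesis by (auto simp: AE_all_countable)
  qed
  have "(\<integral>\<^sup>+s. time_weight \<gamma> k s \<partial>?P) \<le> (\<integral>\<^sup>+s. ennreal (exp t) * (\<Prod>l<k. ?w s l) \<partial>?P)"
  proof (rule nn_integral_mono_AE)
    show "AE s in ?P. time_weight \<gamma> k s \<le> ennreal (exp t) * (\<Prod>l<k. ?w s l)"
      using ae
    proof eventually_elim
      case (elim s)
      have tele: "(\<Sum>l<n. time_gap s l) = (if n = 0 then 0 else max 0 (s (n - 1)))" for n
        by (induction n) (auto simp: time_gap_def)
      have "(\<Sum>l<k. time_gap s l) \<le> t"
      proof (cases "k = 0")
        case False
        then have "s (k - 1) \<le> t" using elim by simp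
        then show ?thesis unfolding tele using t False by simp
      qed (use t in simp)
      then have "1 \<le> exp (t + - (\<Sum>l<k. time_gap s l))" by simp
      then have "ennreal 1 \<le> ennreal (exp t * exp (- (\<Sum>l<k. time_gap s l)))"
        unfolding exp_add by (rule ennreal_leI)
      then have "1 \<le> ennreal (exp t) * ennreal (exp (- (\<Sum>l<k. time_gap s l)))"
        by (simp only: ennreal_mult'[OF exp_ge_zero] ennreal_1)
      also have "ennreal (exp (- (\<Sum>l<k. time_gap s l))) = (\<Prod>l<k. ennreal (exp (- time_gap s l)))"
        by (simp add: prod_ennreal exp_sum[symmetric] sum_negf)
      finally have "time_weight \<gamma> k s * 1 \<le> time_weight \<gamma> k s * (ennreal (exp t) * (\<Prod>l<k. ennreal (exp (- time_gap s l))))"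
        by (rule mult_left_mono) simp
      then show ?case
        by (simp only: time_weight_def prod.distrib mult_1_right mult.left_commute)
    qed
  qed
  also have "\<dots> = ennreal (exp t) * (\<integral>\<^sup>+s. (\<Prod>l<k. ?w s l) \<partial>?P)"
  proof (intro nn_integral_cmult borel_measurable_prod_ennreal)
    fix l assume "l \<in> {..<k}"
    then have [measurable]: "(\<lambda>s. time_gap s l) \<in> borel_measurable ?P"
      by (intro time_gap_measurable[OF order_refl]) auto
    show "(\<lambda>s. ?w s l) \<in> borel_measurable ?P" by measurable
  qed
  also have "\<dots> \<le> ennreal (exp t) * time_constant \<gamma> ^ k"
    by (intro mult_left_mono damped_time_weight_integral) auto
  finally show ?thesis .
qed

lemma permuted_time_weight:
  "time_weight \<gamma> k (s \<circ> \<sigma>) = time_weight \<gamma> k (restrict (s \<circ> \<sigma>) {0..<k})"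
  by (rule time_weight_cong) auto

lemma permuted_time_weight_measurable:
  assumes \<sigma>: "\<sigma> permutes {0..<k}"
  shows "(\<lambda>s. time_weight \<gamma> k (s \<circ> \<sigma>)) \<in> borel_measurable (PiM {0..<k} (\<lambda>_. on_set {0..t}))"
proof -
  let ?P = "PiM {0..<k} (\<lambda>_. on_set {0..t})"
  have T: "(\<lambda>x. restrict (x \<circ> \<sigma>) {0..<k}) \<in> measurable ?P ?P"
  proof (rule measurable_restrict)
    fix i assume "i \<in> {0..<k}"
    then show "(\<lambda>x. (x \<circ> \<sigma>) i) \<in> measurable ?P (on_set {0..t})"
      using permutes_in_image[OF \<sigma>, of i] measurable_component_singleton[of "\<sigma> i" "{0..<k}" "\<lambda>_. on_set {0..t}"]
      by (simp only: comp_def)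
  qed
  show ?thesis
    unfolding permuted_time_weight by (rule measurable_compose[OF T time_weight_measurable])
qed

lemma symmetrized_weight_measurable:
  "(\<lambda>s. symmetrized_weight \<gamma> k s) \<in> borel_measurable (PiM {0..<k} (\<lambda>_. on_set {0..t}))"
  unfolding symmetrized_weight_def by (intro borel_measurable_sum permuted_time_weight_measurable) simp

text \<open>All k! reorderings have the same integral, since the product measure is invariant under
  permutations of its coordinates.\<close>

lemma symmetrized_weight_integral:
  "(\<integral>\<^sup>+s. symmetrized_weight \<gamma> k s \<partial>PiM {0..<k} (\<lambda>_. on_set {0..t}))
     \<le> fact k * (ennreal (exp t) * time_constant \<gamma> ^ k)"
proof -
  let ?P = "PiM {0..<k} (\<lambda>_. on_set {0..t})"
  have "(\<integral>\<^sup>+s. time_weight \<gamma> k (s \<circ> \<sigma>) \<partial>?P) \<le> ennreal (exp t) * time_constant \<gamma> ^ k"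
    if \<sigma>: "\<sigma> permutes {0..<k}" for \<sigma>
  proof -
    have "(\<integral>\<^sup>+s. time_weight \<gamma> k (s \<circ> \<sigma>) \<partial>?P) = (\<integral>\<^sup>+s. time_weight \<gamma> k s \<partial>?P)"
      unfolding permuted_time_weight
      by (rule nn_integral_PiM_permute[OF T.sigma_finite_measure_axioms _ \<sigma> time_weight_measurable]) simp
    also have "\<dots> \<le> ennreal (exp t) * time_constant \<gamma> ^ k" by (rule time_weight_integral)
    finally show "(\<integral>\<^sup>+s. time_weight \<gamma> k (s \<circ> \<sigma>) \<partial>?P) \<le> ennreal (exp t) * time_constant \<gamma> ^ k" .
  qed
  then have "(\<integral>\<^sup>+s. symmetrized_weight \<gamma> k s \<partial>?P)
     \<le> (\<Sum>\<sigma> | \<sigma> permutes {0..<k}. ennreal (exp t) * time_constant \<gamma> ^ k)"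
    unfolding symmetrized_weight_def
    by (subst nn_integral_sum) (auto simp del: sum_constant intro!: sum_mono permuted_time_weight_measurable)
  also have "\<dots> = fact k * (ennreal (exp t) * time_constant \<gamma> ^ k)"
    by (simp add: card_permutations)
  finally show ?thesis .
qed

end

section \<open>Measurability and independence\<close>

text \<open>By continuity of paths, a limit of step processes on the grids of mesh 1/(n + 1). The
  definition constrains the process at nonnegative times only, hence \<open>max 0\<close>.\<close>

lemma brownian_jointly_measurable:
  fixes B :: "real \<Rightarrow> 'w \<Rightarrow> 'a::euclidean_space"
  assumes BM: "brownian_motion M x B"
  shows "(\<lambda>u. B (max 0 (fst u)) (snd u)) \<in> borel_measurable (borel \<Otimes>\<^sub>M M)"
proof (rule borel_measurable_LIMSEQ_metric)
  fix n :: nat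
  have m: "(\<lambda>u. B (real i / real (Suc n)) (snd u)) \<in> borel_measurable ((borel :: real measure) \<Otimes>\<^sub>M M)" for i
    using brownian_motion_measurable[OF BM, of "real i / real (Suc n)"]
    by (intro measurable_compose[OF measurable_snd]) simp
  have g: "(\<lambda>u. nat \<lfloor>max 0 (fst u) * real (Suc n)\<rfloor>) \<in> measurable ((borel :: real measure) \<Otimes>\<^sub>M M) (count_space UNIV)"
    by measurable
  show "(\<lambda>u. B (real (nat \<lfloor>max 0 (fst u) * real (Suc n)\<rfloor>) / real (Suc n)) (snd u)) \<in> borel_measurable (borel \<Otimes>\<^sub>M M)"
    by (rule measurable_compose_countable[OF m g])
next
  fix u :: "real \<times> 'w" assume "u \<in> space (borel \<Otimes>\<^sub>M M)"
  then have cont: "continuous_on {0..} (\<lambda>t. B t (snd u))"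
    using BM by (auto simp: brownian_motion_def space_pair_measure)
  define a where "a = max 0 (fst u)"
  have a: "a \<ge> 0" by (simp add: a_def)
  have "(\<lambda>n. real (nat \<lfloor>a * real (Suc n)\<rfloor>) / real (Suc n)) \<longlonglongrightarrow> a"
  proof (rule tendsto_sandwich)
    have 1: "real (nat \<lfloor>a * real (Suc n)\<rfloor>) = of_int \<lfloor>a * real (Suc n)\<rfloor>" for n using a by simp
    show "eventually (\<lambda>n. a - 1 / real (Suc n) \<le> real (nat \<lfloor>a * real (Suc n)\<rfloor>) / real (Suc n)) sequentially"
    proof (rule always_eventually, rule allI)
      fix n
      have "(a - 1 / real (Suc n)) * real (Suc n) = a * real (Suc n) - 1" by (simp add: left_diff_distrib)
      also have "\<dots> \<le> real (nat \<lfloor>a * real (Suc n)\<rfloor>)" unfolding 1 by linarith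
      finally show "a - 1 / real (Suc n) \<le> real (nat \<lfloor>a * real (Suc n)\<rfloor>) / real (Suc n)"
        by (simp add: pos_le_divide_eq del: of_nat_Suc)
    qed
    show "eventually (\<lambda>n. real (nat \<lfloor>a * real (Suc n)\<rfloor>) / real (Suc n) \<le> a) sequentially"
      unfolding 1 by (rule always_eventually) (simp add: pos_divide_le_eq del: of_nat_Suc)
    have "(\<lambda>n. a - 1 / real (Suc n)) \<longlonglongrightarrow> a - 0"
      by (intro tendsto_intros LIMSEQ_Suc[OF lim_const_over_n])
    then show "(\<lambda>n. a - 1 / real (Suc n)) \<longlonglongrightarrow> a" by simp
  qed simp
  then have "(\<lambda>n. B (real (nat \<lfloor>a * real (Suc n)\<rfloor>) / real (Suc n)) (snd u)) \<longlonglongrightarrow> B a (snd u)"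
    by (rule continuous_on_tendsto_compose[OF cont]) (use a in auto)
  then show "(\<lambda>n. B (real (nat \<lfloor>max 0 (fst u) * real (Suc n)\<rfloor>) / real (Suc n)) (snd u)) \<longlonglongrightarrow> B (max 0 (fst u)) (snd u)"
    by (simp add: a_def)
qed

text \<open>Survival up to t is an uncountable condition. For a continuous path it holds if and only
  if some \<open>inner_part D N\<close> contains the positions at all times min q t with q rational:
  compactness yields a single N, and closedness makes rational times sufficient.\<close>

lemma killed_process_measurable:
  fixes D :: "'a::euclidean_space set"
    and M :: "'w measure"
  assumes X: "killed_brownian_motion M D x0 X" and D: "open D" and x0: "x0 \<in> D"
    and Q[measurable]: "case_prod Q \<in> borel_measurable (borel \<Otimes>\<^sub>M borel)"
  shows "(\<lambda>u. lift_killed Q (fst u) (X (max 0 (fst (snd u))) (snd (snd u)))) \<in> borel_measurable (borel \<Otimes>\<^sub>M (borel \<Otimes>\<^sub>M M))"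
proof -
  obtain B :: "real \<Rightarrow> 'w \<Rightarrow> 'a" where BM: "brownian_motion M x0 B"
    and XB: "\<And>\<omega> t. \<omega> \<in> space M \<Longrightarrow> t \<ge> 0 \<Longrightarrow> X t \<omega> = killed_path D (\<lambda>s. B s \<omega>) t"
    using X unfolding killed_brownian_motion_def by blast
  have Bm: "(\<lambda>u. B (max 0 (g u)) (h u)) \<in> borel_measurable N"
    if "g \<in> borel_measurable N" "h \<in> measurable N M" for g h and N :: "('a \<times> real \<times> 'w) measure"
    using measurable_compose[OF measurable_Pair[OF that] brownian_jointly_measurable[OF BM]] by simp
  define alive where "alive u \<longleftrightarrow> (\<exists>N. \<forall>q::rat. B (max 0 (min (of_rat q) (max 0 (fst (snd u))))) (snd (snd u)) \<in> inner_part D N)"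
    for u :: "'a \<times> real \<times> 'w"
  let ?N = "borel \<Otimes>\<^sub>M (borel \<Otimes>\<^sub>M M) :: ('a \<times> real \<times> 'w) measure"
  have F: "inner_part D N \<in> sets borel" for N by (simp add: borel_closed closed_inner_part)
  have [measurable]: "Measurable.pred ?N (\<lambda>u. B (max 0 (min q (max 0 (fst (snd u))))) (snd (snd u)) \<in> inner_part D N)" for q N
    using F by (intro pred_sets2[OF F] Bm) measurable
  have alive_meas[measurable]: "Measurable.pred ?N alive"
    unfolding alive_def[abs_def] by measurable
  have [measurable]: "(\<lambda>u. B (max 0 (fst (snd u))) (snd (snd u))) \<in> borel_measurable ?N"
    by (rule Bm) measurable
  have alive: "alive u \<longleftrightarrow> ereal t < exit_time D (\<lambda>s. B s \<omega>)"
    if u: "u = (x, t', \<omega>)" "t = max 0 t'" "\<omega> \<in> space M" for u x t t' \<omega>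
  proof -
    have cont: "continuous_on {0..} (\<lambda>t. B t \<omega>)" and B0: "B 0 \<omega> = x0"
      using BM u by (auto simp: brownian_motion_def)
    have t: "t \<ge> 0" using u by simp
    have iff: "ereal t < exit_time D (\<lambda>s. B s \<omega>) \<longleftrightarrow> (\<forall>u\<in>{0..t}. B u \<omega> \<in> D)"
      by (rule less_exit_time_iff[OF D cont _ t]) (simp add: B0 x0)
    define \<phi> where "\<phi> q = B (max 0 (min q t)) \<omega>" for q
    have \<phi>: "continuous_on UNIV \<phi>"
      unfolding \<phi>_def by (rule continuous_on_compose2[OF cont]) (auto intro!: continuous_intros)
    have "alive u \<longleftrightarrow> (\<exists>N. \<phi> ` \<rat> \<subseteq> inner_part D N)"
      unfolding alive_def \<phi>_def by (simp add: u image_subset_iff Rats_def)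
    also have "\<dots> \<longleftrightarrow> (\<exists>N. \<phi> ` UNIV \<subseteq> inner_part D N)"
    proof (intro iff_exI iffI)
      fix N assume "\<phi> ` \<rat> \<subseteq> inner_part D N"
      then have "\<phi> ` closure \<rat> \<subseteq> inner_part D N"
        using \<phi> closed_inner_part by (intro image_closure_subset) (auto intro: continuous_on_subset)
      then show "\<phi> ` UNIV \<subseteq> inner_part D N" by (simp add: Rats_closure_real)
    qed auto
    also have "\<dots> \<longleftrightarrow> (\<exists>N. (\<lambda>u. B u \<omega>) ` {0..t} \<subseteq> inner_part D N)"
    proof -
      have "\<phi> ` UNIV = (\<lambda>u. B u \<omega>) ` {0..t}"
      proof (intro equalityI subsetI)
        fix y assume "y \<in> (\<lambda>u. B u \<omega>) ` {0..t}"
        then obtain u where "u \<in> {0..t}" "y = B u \<omega>" by auto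
        then have "y = \<phi> u" by (simp add: \<phi>_def)
        then show "y \<in> \<phi> ` UNIV" by simp
      qed (use t in \<open>auto simp: \<phi>_def\<close>)
      then show ?thesis by simp
    qed
    also have "\<dots> \<longleftrightarrow> (\<forall>u\<in>{0..t}. B u \<omega> \<in> D)"
    proof
      assume "\<forall>u\<in>{0..t}. B u \<omega> \<in> D"
      moreover have "compact ((\<lambda>u. B u \<omega>) ` {0..t})"
        by (intro compact_continuous_image continuous_on_subset[OF cont]) auto
      ultimately have "eventually (\<lambda>N. (\<lambda>u. B u \<omega>) ` {0..t} \<subseteq> inner_part D N) sequentially"
        by (intro compact_subset_inner_part D) auto
      then show "\<exists>N. (\<lambda>u. B u \<omega>) ` {0..t} \<subseteq> inner_part D N"
        by (auto simp: eventually_sequentially)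
    qed (use inner_part_subset[of D] in blast)
    finally show ?thesis using iff by simp
  qed
  have "(\<lambda>u. if alive u then Q (fst u) (B (max 0 (fst (snd u))) (snd (snd u))) else 0) \<in> borel_measurable ?N"
    by measurable
  also have "?this \<longleftrightarrow> ?thesis"
  proof (rule measurable_cong)
    fix u assume "u \<in> space ?N"
    then obtain x t' \<omega> where u: "u = (x, t', \<omega>)" "\<omega> \<in> space M"
      by (metis space_pair_measure SigmaE)
    show "(if alive u then Q (fst u) (B (max 0 (fst (snd u))) (snd (snd u))) else 0)
      = lift_killed Q (fst u) (X (max 0 (fst (snd u))) (snd (snd u)))"
      using alive[OF u(1) refl u(2)] XB[OF u(2), of "max 0 t'"] by (simp add: u killed_path_def)
  qed
  finally show ?thesis .
qed

lemma killed_process_measurable':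
  fixes D :: "'a::euclidean_space set"
  assumes "killed_brownian_motion M D x0 X" "open D" "x0 \<in> D"
    "case_prod Q \<in> borel_measurable (borel \<Otimes>\<^sub>M borel)"
    "f \<in> borel_measurable N" "g \<in> borel_measurable N" "h \<in> measurable N M"
  shows "(\<lambda>u. lift_killed Q (f u) (X (max 0 (g u)) (h u))) \<in> borel_measurable N"
  using measurable_compose[OF measurable_Pair[OF assms(5) measurable_Pair[OF assms(6,7)]]
      killed_process_measurable[OF assms(1-4)]] by simp

text \<open>Independence is formulated with the Borel sets of the one-point compactification. Open
  subsets of D remain open there, and the cemetery is the complement of D, hence a Borel
  set.\<close>

lemma lift_killed_measurable:
  fixes D :: "'a::euclidean_space set"
  assumes D: "open D" and \<phi>[measurable]: "Q x \<in> borel_measurable borel"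
  shows "lift_killed Q x \<in> borel_measurable (topology_borel (Alexandroff_compactification (top_of_set D)))"
proof -
  let ?S = "topology_borel (Alexandroff_compactification (top_of_set D))"
  have sub: "{V. openin (Alexandroff_compactification (top_of_set D)) V} \<subseteq> Pow (topspace (Alexandroff_compactification (top_of_set D)))"
    using openin_subset by blast
  have space: "space ?S = insert None (Some ` D)"
    unfolding topology_borel_def space_measure_of[OF sub] by simp
  have open_sets: "V \<in> sets ?S" if "openin (Alexandroff_compactification (top_of_set D)) V" for V
    unfolding topology_borel_def sets_measure_of[OF sub] using that by auto
  have D_sets: "Some ` U \<in> sets ?S" if "open U" "U \<subseteq> D" for U
    using that D by (intro open_sets) (auto simp: openin_Alexandroff_compactification openin_open_eq)
  have None_sets: "{None} \<in> sets ?S"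
  proof -
    have "space ?S - Some ` D \<in> sets ?S" using D_sets[OF D] by auto
    also have "space ?S - Some ` D = {None}" by (auto simp: space)
    finally show ?thesis .
  qed
  define e where "e z = (case z of None \<Rightarrow> undefined | Some y \<Rightarrow> y)" for z :: "'a option"
  have [measurable]: "e \<in> borel_measurable ?S"
  proof (rule borel_measurableI)
    fix U :: "'a set" assume U: "open U"
    have "e -` U \<inter> space ?S = Some ` (U \<inter> D) \<union> (if undefined \<in> U then {None} else {})"
      by (auto simp: space e_def split: option.splits)
    also have "\<dots> \<in> sets ?S"
      by (rule sets.Un) (use D_sets[of "U \<inter> D"] None_sets U D in auto)
    finally show "e -` U \<inter> space ?S \<in> sets ?S" .
  qed
  have [measurable]: "Measurable.pred ?S (\<lambda>z. z = None)"
  proof -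
    have "{z \<in> space ?S. z = None} = {None}" by (auto simp: space)
    then show ?thesis using None_sets by (simp add: pred_def)
  qed
  have "lift_killed Q x = (\<lambda>z. if z = None then 0 else Q x (e z))"
    by (auto simp: lift_killed_def e_def fun_eq_iff split: option.splits)
  then show ?thesis by simp
qed

text \<open>For fixed times and points each factor is a measurable functional of the path of a
  single process, so independence of the paths factorises the expectation.\<close>

lemma independent_joint_moments:
  fixes D :: "'a::euclidean_space set" and X :: "nat \<Rightarrow> real \<Rightarrow> 'w \<Rightarrow> 'a option"
  assumes M: "prob_space M" and D: "open D"
    and ind: "independent_killed_processes M D p X"
    and Q: "\<And>i x. i \<in> {1..p} \<Longrightarrow> Q i x \<in> borel_measurable borel"
    and b: "\<And>i x y. i \<in> {1..p} \<Longrightarrow> \<bar>Q i x y\<bar> \<le> b"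
    and s: "\<And>i l. 0 \<le> s i l"
  shows "(LINT \<omega>|M. (\<Prod>i\<in>{1..p}. \<Prod>l<k. lift_killed (Q i) (x l) (X i (s i l) \<omega>)))
     = (\<Prod>i\<in>{1..p}. joint_moment M (X i) (Q i) k (s i) x)"
proof -
  interpret prob_space M by fact
  let ?S = "topology_borel (Alexandroff_compactification (top_of_set D))"
  let ?P = "PiM {0..} (\<lambda>_::real. ?S)"
  define \<Phi> where "\<Phi> i path = (\<Prod>l<k. lift_killed (Q i) (x l) (path (s i l)))" for i and path :: "real \<Rightarrow> 'a option"
  have \<Phi>_meas: "\<Phi> i \<in> borel_measurable ?P" if "i \<in> {1..p}" for i
    unfolding \<Phi>_def
  proof (rule borel_measurable_prod)
    fix l
    show "(\<lambda>path. lift_killed (Q i) (x l) (path (s i l))) \<in> borel_measurable ?P"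
      using s by (intro measurable_compose[OF measurable_component_singleton[of "s i l" "{0..}"]
            lift_killed_measurable[where Q = "Q i" and x = "x l", OF D Q[OF that]]]) auto
  qed
  have "indep_vars (\<lambda>_. borel) (\<lambda>i \<omega>. \<Phi> i (\<lambda>t\<in>{0..}. X i t \<omega>)) {1..p}"
    using ind unfolding independent_killed_processes_def
    by (rule indep_vars_compose2) (rule \<Phi>_meas)
  moreover have eq: "\<Phi> i (\<lambda>t\<in>{0..}. X i t \<omega>) = (\<Prod>l<k. lift_killed (Q i) (x l) (X i (s i l) \<omega>))" for i \<omega>
    using s by (simp add: \<Phi>_def)
  ultimately have iv: "indep_vars (\<lambda>_. borel) (\<lambda>i \<omega>. \<Prod>l<k. lift_killed (Q i) (x l) (X i (s i l) \<omega>)) {1..p}"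
    by simp
  have int: "integrable M (\<lambda>\<omega>. \<Prod>l<k. lift_killed (Q i) (x l) (X i (s i l) \<omega>))" if i: "i \<in> {1..p}" for i
  proof (rule integrable_of_bound)
    show "(\<lambda>\<omega>. \<Prod>l<k. lift_killed (Q i) (x l) (X i (s i l) \<omega>)) \<in> borel_measurable M"
      using iv i unfolding indep_vars_def by blast
    fix \<omega>
    have b0: "0 \<le> b" using b[OF i, of undefined undefined] by linarith
    have "\<bar>\<Prod>l<k. lift_killed (Q i) (x l) (X i (s i l) \<omega>)\<bar> \<le> (\<Prod>l<k. b)"
      unfolding abs_prod using b[OF i] b0
      by (intro prod_mono conjI) (auto simp: lift_killed_def split: option.splits)
    then show "\<bar>\<Prod>l<k. lift_killed (Q i) (x l) (X i (s i l) \<omega>)\<bar> \<le> b ^ k" by simp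
  qed
  show ?thesis
    unfolding joint_moment_def by (rule indep_vars_lebesgue_integral[OF _ iv int]) simp
qed

section \<open>From ordered to arbitrary times\<close>

lemma joint_moment_permute:
  assumes "\<sigma> permutes {0..<k}"
  shows "joint_moment M X Q k s x = joint_moment M X Q k (s \<circ> \<sigma>) (restrict (x \<circ> \<sigma>) {0..<k})"
  unfolding joint_moment_def
proof (intro Bochner_Integration.integral_cong refl)
  fix \<omega>
  have "(\<Prod>l\<in>{0..<k}. lift_killed Q (x l) (X (s l) \<omega>)) = (\<Prod>l\<in>{0..<k}. lift_killed Q (x (\<sigma> l)) (X (s (\<sigma> l)) \<omega>))"
    using prod.permute[OF assms, of "\<lambda>l. lift_killed Q (x l) (X (s l) \<omega>)"] by (simp add: comp_def)
  then show "(\<Prod>l<k. lift_killed Q (x l) (X (s l) \<omega>)) = (\<Prod>l<k. lift_killed Q (restrict (x \<circ> \<sigma>) {0..<k} l) (X ((s \<circ> \<sigma>) l) \<omega>))"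
    by (simp add: atLeast0LessThan)
qed

lemma joint_moment_cong:
  assumes "\<And>l. l < k \<Longrightarrow> X (s l) = X' (s' l)"
  shows "joint_moment M X Q k s x = joint_moment M X' Q k s' x"
  unfolding joint_moment_def using assms by simp

lemma joint_moment_measurable:
  fixes D :: "'a::euclidean_space set"
  assumes M: "prob_space M" and X: "killed_brownian_motion M D x0 X" "open D" "x0 \<in> D"
    "case_prod Q \<in> borel_measurable (borel \<Otimes>\<^sub>M borel)"
    and f: "\<And>l. l < k \<Longrightarrow> f l \<in> borel_measurable N" and g: "\<And>l. l < k \<Longrightarrow> g l \<in> borel_measurable N"
  shows "(\<lambda>u. joint_moment M (\<lambda>s. X (max 0 s)) Q k (\<lambda>l. g l u) (\<lambda>l. f l u)) \<in> borel_measurable N"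
proof -
  interpret prob_space M by fact
  have "(\<lambda>(u, \<omega>). \<Prod>l<k. lift_killed Q (f l u) (X (max 0 (g l u)) \<omega>)) \<in> borel_measurable (N \<Otimes>\<^sub>M M)"
    unfolding case_prod_beta'
    by (intro borel_measurable_prod killed_process_measurable'[OF X])
      (auto intro!: measurable_compose[OF measurable_fst f] measurable_compose[OF measurable_fst g])
  then show ?thesis
    unfolding joint_moment_def by (rule borel_measurable_lebesgue_integral)
qed

text \<open>Sorting the times permutes the space points along with them, which does not affect the
  integral over all points. Where two times coincide, or a time is 0, the weight is \<infinity>, and
  c \<noteq> 0 keeps the right side infinite.\<close>

lemma joint_moment_unordered_bound:
  fixes D :: "'a::euclidean_space set"
  assumes M: "prob_space M" and X: "killed_brownian_motion M D x0 X" "open D" "x0 \<in> D"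
    and Q: "mollifier Q b K p" and c: "c \<noteq> 0"
    and ordered: "\<And>r. (\<And>l. r l > 0) \<Longrightarrow>
      (\<integral>\<^sup>+x. ennreal \<bar>joint_moment M X Q k (\<lambda>l. sum r {..<Suc l}) x\<bar> ^ p \<partial>PiM {0..<k} (\<lambda>_. on_set K))
        \<le> (c * (\<Prod>l<k. gap_weight \<gamma> (r l))) ^ p"
  shows "(\<integral>\<^sup>+x. ennreal \<bar>joint_moment M (\<lambda>s. X (max 0 s)) Q k s x\<bar> ^ p \<partial>PiM {0..<k} (\<lambda>_. on_set K))
     \<le> (c * symmetrized_weight \<gamma> k s) ^ p"
proof -
  interpret mollifier Q b K p by fact
  obtain \<sigma> where \<sigma>: "\<sigma> permutes {0..<k}" and sorted: "\<And>i j. i \<le> j \<Longrightarrow> j < k \<Longrightarrow> max 0 (s (\<sigma> i)) \<le> max 0 (s (\<sigma> j))"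
    using exists_sorting_permutation[of k "\<lambda>l. max 0 (s l)"] by blast
  define r where "r l = time_gap (s \<circ> \<sigma>) l" for l
  have r0: "r l \<ge> 0" if "l < k" for l
    using sorted[of "l - 1" l] that by (simp add: r_def time_gap_def)
  have weight_le: "time_weight \<gamma> k (s \<circ> \<sigma>) \<le> symmetrized_weight \<gamma> k s"
    unfolding symmetrized_weight_def using \<sigma> by (intro member_le_sum) (auto simp: finite_permutations)
  show ?thesis
  proof (cases "\<exists>l<k. r l = 0")
    case True
    then obtain l where l: "l < k" "r l = 0" by auto
    have "gap_weight \<gamma> (r j) \<noteq> 0" if "j < k" for j
      using gap_weight_ge_1[OF r0[OF that], of \<gamma>] by auto
    moreover have "gap_weight \<gamma> (r l) = top" using l by (simp add: gap_weight_def)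
    ultimately have "time_weight \<gamma> k (s \<circ> \<sigma>) = top"
      unfolding time_weight_def r_def[symmetric] using l(1) by (subst ennreal_prod_eq_top) auto
    then have "symmetrized_weight \<gamma> k s = top" using weight_le by (simp add: top_unique)
    then have "c * symmetrized_weight \<gamma> k s = top" using c by (simp add: ennreal_mult_eq_top_iff)
    then show ?thesis using p by (simp add: power_eq_top_ennreal top_unique)
  next
    case False
    \<comment> \<open>The ordered bound asks for positive gaps at every index, so the gaps are
      continued by 1 from index k on.\<close>
    define r' where "r' l = (if l < k then r l else 1)" for l
    have r'0: "r' l > 0" for l using False r0[of l] by (auto simp: r'_def less_le)
    have sums: "sum r' {..<Suc l} = max 0 (s (\<sigma> l))" if "l < k" for l
      using that by (induction l) (auto simp: r'_def r_def time_gap_def)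
    have "(\<integral>\<^sup>+x. ennreal \<bar>joint_moment M (\<lambda>s. X (max 0 s)) Q k s x\<bar> ^ p \<partial>PiM {0..<k} (\<lambda>_. on_set K))
      = (\<integral>\<^sup>+x. ennreal \<bar>joint_moment M (\<lambda>s. X (max 0 s)) Q k (s \<circ> \<sigma>) (restrict (x \<circ> \<sigma>) {0..<k})\<bar> ^ p \<partial>PiM {0..<k} (\<lambda>_. on_set K))"
      by (subst joint_moment_permute[OF \<sigma>]) (rule refl)
    also have "\<dots> = (\<integral>\<^sup>+x. ennreal \<bar>joint_moment M (\<lambda>s. X (max 0 s)) Q k (s \<circ> \<sigma>) x\<bar> ^ p \<partial>PiM {0..<k} (\<lambda>_. on_set K))"
    proof (rule nn_integral_PiM_permute[OF KM.sigma_finite_measure_axioms _ \<sigma>])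
      have [measurable]: "(\<lambda>x. joint_moment M (\<lambda>s. X (max 0 s)) Q k (s \<circ> \<sigma>) x) \<in> borel_measurable (PiM {0..<k} (\<lambda>_. on_set K))"
        using joint_moment_measurable[OF M X Q_measurable, of k "\<lambda>l x. x l" "PiM {0..<k} (\<lambda>_. on_set K)" "\<lambda>l x. (s \<circ> \<sigma>) l"]
        by (simp add: component_measurable comp_def)
      show "(\<lambda>x. ennreal \<bar>joint_moment M (\<lambda>s. X (max 0 s)) Q k (s \<circ> \<sigma>) x\<bar> ^ p) \<in> borel_measurable (PiM {0..<k} (\<lambda>_. on_set K))"
        by measurable
    qed simp
    also have "\<dots> = (\<integral>\<^sup>+x. ennreal \<bar>joint_moment M X Q k (\<lambda>l. sum r' {..<Suc l}) x\<bar> ^ p \<partial>PiM {0..<k} (\<lambda>_. on_set K))"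
      by (intro nn_integral_cong arg_cong[where f = "\<lambda>z. ennreal \<bar>z\<bar> ^ p"] joint_moment_cong) (simp only: sums comp_def)
    also have "\<dots> \<le> (c * (\<Prod>l<k. gap_weight \<gamma> (r' l))) ^ p"
      by (rule ordered) (rule r'0)
    also have "(\<Prod>l<k. gap_weight \<gamma> (r' l)) = time_weight \<gamma> k (s \<circ> \<sigma>)"
      unfolding time_weight_def by (intro prod.cong) (auto simp: r'_def r_def)
    also have "(c * time_weight \<gamma> k (s \<circ> \<sigma>)) ^ p \<le> (c * symmetrized_weight \<gamma> k s) ^ p"
      by (intro power_mono mult_left_mono weight_le) auto
    finally show ?thesis .
  qed
qed

section \<open>Moments of mixed intersection functionals\<close>

lemma ennreal_power_le_imp_le:
  fixes a b :: ennreal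
  assumes "a ^ p \<le> b ^ p" "p \<ge> 1"
  shows "a \<le> b"
proof (cases "a = top \<or> b = top")
  case True
  then show ?thesis
    using assms by (auto simp: power_eq_top_ennreal top_unique)
next
  case False
  then obtain x y where xy: "a = ennreal x" "b = ennreal y" "x \<ge> 0" "y \<ge> 0"
    by (metis ennreal_cases)
  then have "x ^ p \<le> y ^ p" using assms(1) by (simp add: ennreal_power)
  then have "x \<le> y" using assms(2) xy by (simp add: power_mono_iff)
  then show ?thesis using xy by (simp add: ennreal_leI)
qed

lemma finite_measure_PiM:
  assumes I: "finite I" and \<mu>: "finite_measure \<mu>"
  shows "finite_measure (PiM I (\<lambda>_. \<mu>))"
proof -
  interpret finite_measure \<mu> by fact
  interpret product_sigma_finite "\<lambda>_. \<mu>" by standard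
  show ?thesis
  proof
    have "emeasure (PiM I (\<lambda>_. \<mu>)) (space (PiM I (\<lambda>_. \<mu>))) = (\<Prod>i\<in>I. emeasure \<mu> (space \<mu>))"
      unfolding space_PiM by (rule emeasure_PiM[OF I]) simp
    also have "\<dots> \<noteq> \<infinity>"
      using I by (simp add: power_eq_top_ennreal)
    finally show "emeasure (PiM I (\<lambda>_. \<mu>)) (space (PiM I (\<lambda>_. \<mu>))) \<noteq> \<infinity>" .
  qed
qed

lemma integral_on_set:
  fixes f :: "'a::euclidean_space \<Rightarrow> real"
  assumes "K \<in> sets borel" "f \<in> borel_measurable borel"
  shows "(LINT x|on_set K. f x) = (LINT x|lborel. indicat_real K x * f x)"
proof -
  have "on_set K = density lborel (\<lambda>x. ennreal (indicat_real K x))"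
    by (simp add: on_set_def ennreal_indicator)
  then show ?thesis using assms by (simp add: integral_density)
qed

text \<open>One kernel for each process: equal ball densities give the approximated intersection
  measure, while the terms of the telescoping sum need different kernels.\<close>

definition mixed_functional :: "nat \<Rightarrow> (nat \<Rightarrow> 'a::euclidean_space \<Rightarrow> 'a \<Rightarrow> real) \<Rightarrow> (nat \<Rightarrow> real \<Rightarrow> 'w \<Rightarrow> 'a option)
    \<Rightarrow> real \<Rightarrow> ('a \<Rightarrow> real) \<Rightarrow> 'w \<Rightarrow> real" where
  "mixed_functional p Q X t f \<omega> =
     (LINT x|lborel. f x * (\<Prod>i\<in>{1..p}. LINT s|on_set {0..t}. lift_killed (Q i) x (X i (max 0 s) \<omega>)))"

text \<open>The number p is both the number of processes and the Hoelder exponent, so the assumed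
  p-th power bound for each process is exactly what Hoelder's inequality consumes. The remaining
  times then separate between the processes. Measurability and integrability in x do not involve k
  and are also extracted with k = 0.\<close>

lemma mixed_moment_bound:
  fixes D :: "'a::euclidean_space set" and X :: "nat \<Rightarrow> real \<Rightarrow> 'w \<Rightarrow> 'a option"
  assumes M: "prob_space M" and D: "open D" and x0: "\<And>i. i \<in> {1..p} \<Longrightarrow> x0 i \<in> D"
    and X: "\<And>i. i \<in> {1..p} \<Longrightarrow> killed_brownian_motion M D (x0 i) (X i)"
    and ind: "independent_killed_processes M D p X"
    and Q: "\<And>i. i \<in> {1..p} \<Longrightarrow> mollifier (Q i) b K p"
    and p: "p \<ge> 1" and t: "t \<ge> 0" and k: "even k"
    and f[measurable]: "f \<in> borel_measurable borel" and f_bound: "\<And>x. \<bar>f x\<bar> \<le> C" and f_supp: "\<And>x. x \<notin> K \<Longrightarrow> f x = 0"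
    and bound: "\<And>i s. i \<in> {1..p} \<Longrightarrow>
      (\<integral>\<^sup>+x. ennreal \<bar>joint_moment M (\<lambda>s. X i (max 0 s)) (Q i) k s x\<bar> ^ p \<partial>PiM {0..<k} (\<lambda>_. on_set K))
        \<le> (c i * symmetrized_weight \<gamma> k s) ^ p"
  shows "mixed_functional p Q X t f \<in> borel_measurable M" (is ?meas)
    and "(\<integral>\<^sup>+\<omega>. ennreal (mixed_functional p Q X t f \<omega> ^ k) \<partial>M)
      \<le> ennreal C ^ k * (\<Prod>i\<in>{1..p}. c i * (fact k * (ennreal (exp t) * time_constant \<gamma> ^ k)))"
    and "\<And>\<omega>. \<omega> \<in> space M \<Longrightarrow> integrable lborel
      (\<lambda>x. f x * (\<Prod>i\<in>{1..p}. LINT s|on_set {0..t}. lift_killed (Q i) x (X i (max 0 s) \<omega>)))"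
proof -
  interpret prob_space M by fact
  have "1 \<in> {1..p}" using p by simp
  interpret Q1: mollifier "Q 1" b K p by (rule Q) fact
  note [measurable] = Q1.K
  interpret T: finite_measure "on_set {0..t}"
    by (rule finite_measure_on_set) (use t in simp_all)
  interpret TP: product_sigma_finite "\<lambda>_::nat. on_set {0..t}" by standard
  let ?P = "PiM {0..<k} (\<lambda>_. on_set K)"
  let ?S = "PiM {0..<k} (\<lambda>_. on_set {0..t})"
  let ?R = "PiM {1..p} (\<lambda>_. ?S)"
  interpret P: finite_measure ?P by (rule finite_measure_PiM) (auto intro: Q1.KM.finite_measure_axioms)
  interpret S: finite_measure ?S by (rule finite_measure_PiM) (auto intro: T.finite_measure_axioms)
  interpret SP: product_sigma_finite "\<lambda>_::nat. ?S" by standard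
  interpret R: finite_measure ?R by (rule finite_measure_PiM) (auto intro: S.finite_measure_axioms)
  interpret PR: pair_sigma_finite ?P ?R by standard
  interpret PRf: finite_measure "?P \<Otimes>\<^sub>M ?R"
    by (rule finite_measure_pair_measure) (rule P.finite_measure_axioms R.finite_measure_axioms)+
  interpret PRM: pair_sigma_finite "?P \<Otimes>\<^sub>M ?R" M by standard
  interpret PRMf: finite_measure "(?P \<Otimes>\<^sub>M ?R) \<Otimes>\<^sub>M M"
    by (rule finite_measure_pair_measure) (rule PRf.finite_measure_axioms finite_measure_axioms)+
  define Y where "Y i x s \<omega> = lift_killed (Q i) x (X i (max 0 s) \<omega>)" for i x s \<omega>
  have b0: "b \<ge> 0" by (rule Q1.b_nonneg)
  have C0: "C \<ge> 0" using f_bound[of undefined] by linarith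
  have Y_bound: "\<bar>Y i x s \<omega>\<bar> \<le> b" if "i \<in> {1..p}" for i x s \<omega>
    using mollifier.Q_bound[OF Q[OF that]] b0 by (auto simp: Y_def lift_killed_def split: option.splits)
  define A where "A i x \<omega> = (LINT s|on_set {0..t}. Y i x s \<omega>)" for i x \<omega>
  have A_meas: "(\<lambda>u. A i (fst u) (snd u)) \<in> borel_measurable (borel \<Otimes>\<^sub>M M)" if i: "i \<in> {1..p}" for i
  proof -
    have "(\<lambda>u. Y i (fst (fst u)) (snd u) (snd (fst u))) \<in> borel_measurable ((borel \<Otimes>\<^sub>M M) \<Otimes>\<^sub>M on_set {0..t})"
      unfolding Y_def by (rule killed_process_measurable'[OF X[OF i] D x0[OF i] mollifier.Q_measurable[OF Q[OF i]]]) measurable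
    then have "(\<lambda>(v, s). Y i (fst v) s (snd v)) \<in> borel_measurable ((borel \<Otimes>\<^sub>M M) \<Otimes>\<^sub>M on_set {0..t})"
      by (simp add: case_prod_beta')
    then show ?thesis unfolding A_def by (rule T.borel_measurable_lebesgue_integral)
  qed
  define a where "a = b * measure (on_set {0..t}) (space (on_set {0..t}))"
  have A_bound: "\<bar>A i x \<omega>\<bar> \<le> a" if i: "i \<in> {1..p}" and \<omega>: "\<omega> \<in> space M" for i x \<omega>
  proof -
    have "(\<lambda>s. Y i x s \<omega>) \<in> borel_measurable (on_set {0..t})"
      unfolding Y_def by (rule killed_process_measurable'[OF X[OF i] D x0[OF i] mollifier.Q_measurable[OF Q[OF i]]]) (use \<omega> in measurable)
    then have int: "integrable (on_set {0..t}) (\<lambda>s. Y i x s \<omega>)"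
      by (rule T.integrable_of_bound) (rule Y_bound[OF i])
    have "\<bar>A i x \<omega>\<bar> \<le> (LINT s|on_set {0..t}. \<bar>Y i x s \<omega>\<bar>)"
      unfolding A_def by (rule integral_abs_bound)
    also have "\<dots> \<le> (LINT s|on_set {0..t}. b)"
      by (rule integral_mono) (use int Y_bound[OF i] in auto)
    finally show ?thesis by (simp add: a_def mult.commute)
  qed
  define Z where "Z \<omega> = mixed_functional p Q X t f \<omega>" for \<omega>
  have AP_meas: "(\<lambda>u. f (fst u) * (\<Prod>i\<in>{1..p}. A i (fst u) (snd u))) \<in> borel_measurable (borel \<Otimes>\<^sub>M M)"
    by (intro borel_measurable_times borel_measurable_prod A_meas) auto
  have AP_meas_x: "(\<lambda>x. f x * (\<Prod>i\<in>{1..p}. A i x \<omega>)) \<in> borel_measurable borel" if "\<omega> \<in> space M" for \<omega>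
    using measurable_compose[OF measurable_Pair2'[OF that, of borel] AP_meas] by simp
  have AP_bound: "\<bar>f x * (\<Prod>i\<in>{1..p}. A i x \<omega>)\<bar> \<le> C * a ^ p" if "\<omega> \<in> space M" for x \<omega>
  proof -
    have "\<bar>\<Prod>i\<in>{1..p}. A i x \<omega>\<bar> \<le> (\<Prod>i\<in>{1..p}. a)"
      unfolding abs_prod using A_bound[OF _ that] by (intro prod_mono) auto
    then show ?thesis
      unfolding abs_mult using C0 by (intro mult_mono f_bound) auto
  qed
  have Z_eq: "Z \<omega> = (LINT x|on_set K. f x * (\<Prod>i\<in>{1..p}. A i x \<omega>))" if "\<omega> \<in> space M" for \<omega>
  proof -
    have "Z \<omega> = (LINT x|lborel. f x * (\<Prod>i\<in>{1..p}. A i x \<omega>))"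
      by (simp add: Z_def mixed_functional_def A_def Y_def)
    also have "\<dots> = (LINT x|lborel. indicat_real K x * (f x * (\<Prod>i\<in>{1..p}. A i x \<omega>)))"
      using f_supp by (intro Bochner_Integration.integral_cong) (auto simp: indicator_def)
    also have "\<dots> = (LINT x|on_set K. f x * (\<Prod>i\<in>{1..p}. A i x \<omega>))"
      by (rule integral_on_set[symmetric]) (use AP_meas_x[OF that] in auto)
    finally show ?thesis .
  qed
  show "integrable lborel (\<lambda>x. f x * (\<Prod>i\<in>{1..p}. LINT s|on_set {0..t}. lift_killed (Q i) x (X i (max 0 s) \<omega>)))"
    if \<omega>: "\<omega> \<in> space M" for \<omega>
  proof -
    have "integrable (on_set K) (\<lambda>x. f x * (\<Prod>i\<in>{1..p}. A i x \<omega>))"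
      by (rule Q1.KM.integrable_of_bound[OF _ AP_bound[OF \<omega>]]) (use AP_meas_x[OF \<omega>] in auto)
    moreover have "on_set K = density lborel (\<lambda>x. ennreal (indicat_real K x))"
      by (simp add: on_set_def ennreal_indicator)
    ultimately have "integrable lborel (\<lambda>x. indicat_real K x * (f x * (\<Prod>i\<in>{1..p}. A i x \<omega>)))"
      using AP_meas_x[OF \<omega>]
      by (simp only:) (subst (asm) integrable_density, auto)
    moreover have "indicat_real K x * (f x * (\<Prod>i\<in>{1..p}. A i x \<omega>)) = f x * (\<Prod>i\<in>{1..p}. A i x \<omega>)" for x
      using f_supp[of x] by (cases "x \<in> K") auto
    ultimately show ?thesis by (simp only: A_def Y_def)
  qed
  have Z_meas: "Z \<in> borel_measurable M"
  proof -
    have "(\<lambda>(\<omega>, x). f x * (\<Prod>i\<in>{1..p}. A i x \<omega>)) \<in> borel_measurable (M \<Otimes>\<^sub>M on_set K)"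
    proof -
      have "(\<lambda>v. (snd v, fst v)) \<in> measurable (M \<Otimes>\<^sub>M on_set K) (borel \<Otimes>\<^sub>M M)"
        by measurable
      from measurable_compose[OF this AP_meas] show ?thesis by (simp add: case_prod_beta')
    qed
    then have "(\<lambda>\<omega>. LINT x|on_set K. f x * (\<Prod>i\<in>{1..p}. A i x \<omega>)) \<in> borel_measurable M"
      by (rule Q1.KM.borel_measurable_lebesgue_integral)
    then show ?thesis by (subst measurable_cong[OF Z_eq])
  qed
  then show ?meas by (simp add: Z_def[abs_def])
  have Z_bound: "\<bar>Z \<omega>\<bar> \<le> C * a ^ p * measure (on_set K) (space (on_set K))" if "\<omega> \<in> space M" for \<omega>
  proof -
    have int: "integrable (on_set K) (\<lambda>x. f x * (\<Prod>i\<in>{1..p}. A i x \<omega>))"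
      by (rule Q1.KM.integrable_of_bound[OF _ AP_bound[OF that]]) (use AP_meas_x[OF that] in auto)
    have "\<bar>Z \<omega>\<bar> \<le> (LINT x|on_set K. \<bar>f x * (\<Prod>i\<in>{1..p}. A i x \<omega>)\<bar>)"
      unfolding Z_eq[OF that] by (rule integral_abs_bound)
    also have "\<dots> \<le> (LINT x|on_set K. C * a ^ p)"
      by (rule integral_mono) (use int AP_bound[OF that] in auto)
    finally show ?thesis by (simp add: mult_ac)
  qed
  \<comment> \<open>z consists of k space points shared by all processes and of k times for each
    process. The k-th power of the functional is the integral of W over z.\<close>
  define W where "W z \<omega> = (\<Prod>l<k. f (fst z l)) * (\<Prod>i\<in>{1..p}. \<Prod>l<k. Y i (fst z l) (snd z i l) \<omega>)"
    for z :: "(nat \<Rightarrow> 'a) \<times> (nat \<Rightarrow> nat \<Rightarrow> real)" and \<omega>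
  have comp1: "(\<lambda>u. fst u l) \<in> borel_measurable (?P \<Otimes>\<^sub>M ?R)" if "l < k" for l
    by (rule measurable_compose[OF measurable_fst component_measurable]) (use that in auto)
  have comp2: "(\<lambda>u. snd u i l) \<in> borel_measurable (?P \<Otimes>\<^sub>M ?R)" if "i \<in> {1..p}" "l < k" for i l
  proof -
    have "(\<lambda>u. snd u i) \<in> measurable (?P \<Otimes>\<^sub>M ?R) ?S"
      by (rule measurable_compose[OF measurable_snd measurable_component_singleton]) (rule that)
    then show ?thesis
      by (rule measurable_compose[OF _ component_measurable]) (use that in auto)
  qed
  have W_meas: "case_prod W \<in> borel_measurable ((?P \<Otimes>\<^sub>M ?R) \<Otimes>\<^sub>M M)"
    unfolding W_def Y_def case_prod_beta'
  proof (intro borel_measurable_times borel_measurable_prod)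
    fix l assume "l \<in> {..<k}"
    then show "(\<lambda>u. f (fst (fst u) l)) \<in> borel_measurable ((?P \<Otimes>\<^sub>M ?R) \<Otimes>\<^sub>M M)"
      by (intro measurable_compose[OF measurable_compose[OF measurable_fst comp1] f]) simp
  next
    fix i l assume il: "i \<in> {1..p}" "l \<in> {..<k}"
    show "(\<lambda>u. lift_killed (Q i) (fst (fst u) l) (X i (max 0 (snd (fst u) i l)) (snd u))) \<in> borel_measurable ((?P \<Otimes>\<^sub>M ?R) \<Otimes>\<^sub>M M)"
      using il by (intro killed_process_measurable'[OF X[OF il(1)] D x0[OF il(1)] mollifier.Q_measurable[OF Q[OF il(1)]]]
          measurable_compose[OF measurable_fst comp1] measurable_compose[OF measurable_fst comp2]) auto
  qed
  have W_bound: "\<bar>W z \<omega>\<bar> \<le> C ^ k * (b ^ k) ^ p" for z \<omega>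
  proof -
    have "\<bar>\<Prod>l<k. f (fst z l)\<bar> \<le> (\<Prod>l<k. C)"
      unfolding abs_prod using f_bound by (intro prod_mono) auto
    moreover have "\<bar>\<Prod>i\<in>{1..p}. \<Prod>l<k. Y i (fst z l) (snd z i l) \<omega>\<bar> \<le> (\<Prod>i\<in>{1..p}. \<Prod>l<k. b)"
      unfolding abs_prod using Y_bound b0 by (intro prod_mono conjI prod_nonneg) auto
    ultimately show ?thesis
      unfolding W_def abs_mult using C0 by (intro mult_mono) (auto simp: power_mult)
  qed
  have W_int: "integrable ((?P \<Otimes>\<^sub>M ?R) \<Otimes>\<^sub>M M) (case_prod W)"
    by (rule PRMf.integrable_of_bound[OF W_meas, where B = "C ^ k * (b ^ k) ^ p"]) (use W_bound in auto)
  have Z_power: "Z \<omega> ^ k = (LINT z|(?P \<Otimes>\<^sub>M ?R). W z \<omega>)" if \<omega>: "\<omega> \<in> space M" for \<omega>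
  proof -
    have m: "(\<lambda>z. W z \<omega>) \<in> borel_measurable (?P \<Otimes>\<^sub>M ?R)"
      using measurable_compose[OF measurable_Pair2'[OF \<omega>] W_meas] by simp
    have int: "integrable (?P \<Otimes>\<^sub>M ?R) (\<lambda>z. W z \<omega>)"
      by (rule PRf.integrable_of_bound[OF m W_bound])
    have Y_s: "(\<lambda>s. Y i x s \<omega>) \<in> borel_measurable (on_set {0..t})" if i: "i \<in> {1..p}" for i x
      unfolding Y_def by (rule killed_process_measurable'[OF X[OF i] D x0[OF i] mollifier.Q_measurable[OF Q[OF i]]]) (use \<omega> in measurable)
    have "(LINT z|(?P \<Otimes>\<^sub>M ?R). W z \<omega>) = (LINT x|?P. LINT \<tau>|?R. W (x, \<tau>) \<omega>)"
      by (rule PR.integral_fst'[OF int, symmetric])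
    also have "\<dots> = (LINT x|?P. (\<Prod>l\<in>{0..<k}. f (x l) * (\<Prod>i\<in>{1..p}. A i (x l) \<omega>)))"
    proof (intro Bochner_Integration.integral_cong refl)
      fix x :: "nat \<Rightarrow> 'a"
      have YP: "integrable ?S (\<lambda>s. \<Prod>l\<in>{0..<k}. Y i (x l) (s l) \<omega>)" if i: "i \<in> {1..p}" for i
        by (rule TP.product_integrable_prod) (auto intro!: T.integrable_of_bound[OF Y_s[OF i] Y_bound[OF i]])
      have "(LINT \<tau>|?R. W (x, \<tau>) \<omega>) = (\<Prod>l<k. f (x l)) * (LINT \<tau>|?R. (\<Prod>i\<in>{1..p}. \<Prod>l\<in>{0..<k}. Y i (x l) (\<tau> i l) \<omega>))"
        by (simp add: W_def atLeast0LessThan)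
      also have "(LINT \<tau>|?R. (\<Prod>i\<in>{1..p}. \<Prod>l\<in>{0..<k}. Y i (x l) (\<tau> i l) \<omega>))
         = (\<Prod>i\<in>{1..p}. LINT s|?S. (\<Prod>l\<in>{0..<k}. Y i (x l) (s l) \<omega>))"
        by (rule SP.product_integral_prod) (simp, rule YP)
      also have "\<dots> = (\<Prod>i\<in>{1..p}. \<Prod>l\<in>{0..<k}. A i (x l) \<omega>)"
        unfolding A_def
      proof (rule prod.cong[OF refl])
        fix i assume i: "i \<in> {1..p}"
        show "(LINT s|?S. (\<Prod>l\<in>{0..<k}. Y i (x l) (s l) \<omega>)) = (\<Prod>l\<in>{0..<k}. LINT s|on_set {0..t}. Y i (x l) s \<omega>)"
          by (rule TP.product_integral_prod) (auto intro!: T.integrable_of_bound[OF Y_s[OF i] Y_bound[OF i]])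
      qed
      also have "\<dots> = (\<Prod>l\<in>{0..<k}. \<Prod>i\<in>{1..p}. A i (x l) \<omega>)"
        by (rule prod.swap)
      finally show "(LINT \<tau>|?R. W (x, \<tau>) \<omega>) = (\<Prod>l\<in>{0..<k}. f (x l) * (\<Prod>i\<in>{1..p}. A i (x l) \<omega>))"
        by (simp add: prod.distrib atLeast0LessThan)
    qed
    also have "\<dots> = (\<Prod>l\<in>{0..<k}. (LINT x|on_set K. f x * (\<Prod>i\<in>{1..p}. A i x \<omega>)))"
    proof (rule Q1.KP.product_integral_prod)
      show "integrable (on_set K) (\<lambda>x. f x * (\<Prod>i\<in>{1..p}. A i x \<omega>))"
        by (rule Q1.KM.integrable_of_bound[OF _ AP_bound[OF \<omega>]]) (use AP_meas_x[OF \<omega>] in auto)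
    qed simp
    also have "\<dots> = Z \<omega> ^ k" by (simp add: Z_eq[OF \<omega>])
    finally show ?thesis ..
  qed
  define J where "J i s x = joint_moment M (\<lambda>s. X i (max 0 s)) (Q i) k s x" for i s x
  have EW: "(LINT \<omega>|M. W (x, \<tau>) \<omega>) = (\<Prod>l<k. f (x l)) * (\<Prod>i\<in>{1..p}. J i (\<tau> i) x)" for x \<tau>
  proof -
    have "(LINT \<omega>|M. W (x, \<tau>) \<omega>) = (\<Prod>l<k. f (x l)) *
        (LINT \<omega>|M. (\<Prod>i\<in>{1..p}. \<Prod>l<k. lift_killed (Q i) (x l) (X i (max 0 (\<tau> i l)) \<omega>)))"
      by (simp add: W_def Y_def)
    also have "(LINT \<omega>|M. (\<Prod>i\<in>{1..p}. \<Prod>l<k. lift_killed (Q i) (x l) (X i (max 0 (\<tau> i l)) \<omega>)))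
      = (\<Prod>i\<in>{1..p}. joint_moment M (X i) (Q i) k (\<lambda>l. max 0 (\<tau> i l)) x)"
    proof (rule independent_joint_moments[OF M D ind])
      fix i x assume i: "i \<in> {1..p}"
      show "Q i x \<in> borel_measurable borel"
      proof -
        note [measurable] = mollifier.Q_measurable[OF Q[OF i]]
        show ?thesis by measurable
      qed
      show "\<bar>Q i x y\<bar> \<le> b" for y by (rule mollifier.Q_bound[OF Q[OF i]])
    qed simp
    also have "\<dots> = (\<Prod>i\<in>{1..p}. J i (\<tau> i) x)"
      unfolding J_def by (intro prod.cong refl joint_moment_cong)
    finally show ?thesis .
  qed
  have J_meas: "(\<lambda>u. J i (snd u i) (fst u)) \<in> borel_measurable (?P \<Otimes>\<^sub>M ?R)" if i: "i \<in> {1..p}" for i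
    using joint_moment_measurable[OF M X[OF i] D x0[OF i] mollifier.Q_measurable[OF Q[OF i]],
        of k "\<lambda>l u. fst u l" "?P \<Otimes>\<^sub>M ?R" "\<lambda>l u. snd u i l"] comp1 comp2[OF i]
    unfolding J_def by simp
  have J_meas_x: "(\<lambda>x. J i s x) \<in> borel_measurable ?P" if i: "i \<in> {1..p}" for i s
    using joint_moment_measurable[OF M X[OF i] D x0[OF i] mollifier.Q_measurable[OF Q[OF i]],
        of k "\<lambda>l x. x l" ?P "\<lambda>l x. s l"] component_measurable[of _ "{0..<k}" K]
    unfolding J_def by simp
  have Zk_int: "integrable M (\<lambda>\<omega>. Z \<omega> ^ k)"
  proof (rule integrable_of_bound)
    show "(\<lambda>\<omega>. Z \<omega> ^ k) \<in> borel_measurable M" using Z_meas by simp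
    show "\<bar>Z \<omega> ^ k\<bar> \<le> (C * a ^ p * measure (on_set K) (space (on_set K))) ^ k" if "\<omega> \<in> space M" for \<omega>
      unfolding power_abs by (intro power_mono Z_bound[OF that]) simp
  qed
  have "(\<integral>\<^sup>+\<omega>. ennreal (Z \<omega> ^ k) \<partial>M) = ennreal (LINT \<omega>|M. Z \<omega> ^ k)"
    by (rule nn_integral_eq_integral[OF Zk_int]) (simp add: zero_le_even_power[OF k])
  also have "(LINT \<omega>|M. Z \<omega> ^ k) = (LINT \<omega>|M. LINT z|(?P \<Otimes>\<^sub>M ?R). W z \<omega>)"
    by (intro Bochner_Integration.integral_cong refl Z_power)
  also have "\<dots> = (LINT z|(?P \<Otimes>\<^sub>M ?R). LINT \<omega>|M. W z \<omega>)"
    by (rule PRM.Fubini_integral[OF W_int])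
  also have "ennreal \<dots> \<le> ennreal \<bar>LINT z|(?P \<Otimes>\<^sub>M ?R). LINT \<omega>|M. W z \<omega>\<bar>"
    by (intro ennreal_leI) simp
  also have "\<dots> \<le> (\<integral>\<^sup>+z. ennreal \<bar>LINT \<omega>|M. W z \<omega>\<bar> \<partial>(?P \<Otimes>\<^sub>M ?R))"
    by (rule integral_abs_le_nn_integral)
  also have "\<dots> \<le> (\<integral>\<^sup>+z. ennreal C ^ k * (\<Prod>i\<in>{1..p}. ennreal \<bar>J i (snd z i) (fst z)\<bar>) \<partial>(?P \<Otimes>\<^sub>M ?R))"
  proof (intro nn_integral_mono)
    fix z :: "(nat \<Rightarrow> 'a) \<times> (nat \<Rightarrow> nat \<Rightarrow> real)"
    have "\<bar>\<Prod>l<k. f (fst z l)\<bar> \<le> (\<Prod>l<k. C)"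
      unfolding abs_prod using f_bound by (intro prod_mono) auto
    then have "\<bar>LINT \<omega>|M. W z \<omega>\<bar> \<le> C ^ k * (\<Prod>i\<in>{1..p}. \<bar>J i (snd z i) (fst z)\<bar>)"
      using EW[of "fst z" "snd z"] by (simp add: abs_mult abs_prod mult_right_mono prod_nonneg)
    then have "ennreal \<bar>LINT \<omega>|M. W z \<omega>\<bar> \<le> ennreal (C ^ k * (\<Prod>i\<in>{1..p}. \<bar>J i (snd z i) (fst z)\<bar>))"
      by (rule ennreal_leI)
    also have "\<dots> = ennreal C ^ k * (\<Prod>i\<in>{1..p}. ennreal \<bar>J i (snd z i) (fst z)\<bar>)"
      using C0 by (subst ennreal_mult') (auto simp: ennreal_power prod_ennreal)
    finally show "ennreal \<bar>LINT \<omega>|M. W z \<omega>\<bar> \<le> ennreal C ^ k * (\<Prod>i\<in>{1..p}. ennreal \<bar>J i (snd z i) (fst z)\<bar>)" .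
  qed
  also have "\<dots> = ennreal C ^ k * (\<integral>\<^sup>+z. (\<Prod>i\<in>{1..p}. ennreal \<bar>J i (snd z i) (fst z)\<bar>) \<partial>(?P \<Otimes>\<^sub>M ?R))"
    by (rule nn_integral_cmult)
      (intro borel_measurable_prod_ennreal measurable_compose[OF _ measurable_ennreal] borel_measurable_abs J_meas)
  also have "(\<integral>\<^sup>+z. (\<Prod>i\<in>{1..p}. ennreal \<bar>J i (snd z i) (fst z)\<bar>) \<partial>(?P \<Otimes>\<^sub>M ?R))
    = (\<integral>\<^sup>+\<tau>. \<integral>\<^sup>+x. (\<Prod>i\<in>{1..p}. ennreal \<bar>J i (\<tau> i) x\<bar>) \<partial>?P \<partial>?R)"
  proof -
    have "(\<lambda>z. \<Prod>i\<in>{1..p}. ennreal \<bar>J i (snd z i) (fst z)\<bar>) \<in> borel_measurable (?P \<Otimes>\<^sub>M ?R)"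
      by (intro borel_measurable_prod_ennreal measurable_compose[OF _ measurable_ennreal] borel_measurable_abs J_meas)
    from PR.nn_integral_snd[OF this] show ?thesis by simp
  qed
  also have "\<dots> \<le> (\<integral>\<^sup>+\<tau>. (\<Prod>i\<in>{1..p}. c i * symmetrized_weight \<gamma> k (\<tau> i)) \<partial>?R)"
  proof (intro nn_integral_mono)
    fix \<tau> :: "nat \<Rightarrow> nat \<Rightarrow> real"
    have "(\<integral>\<^sup>+x. (\<Prod>i\<in>{1..p}. ennreal \<bar>J i (\<tau> i) x\<bar>) \<partial>?P) ^ card {1..p}
      \<le> (\<Prod>i\<in>{1..p}. \<integral>\<^sup>+x. ennreal \<bar>J i (\<tau> i) x\<bar> ^ card {1..p} \<partial>?P)"
      using p by (intro nn_integral_Hoelder measurable_compose[OF _ measurable_ennreal] borel_measurable_abs J_meas_x) auto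
    also have "\<dots> \<le> (\<Prod>i\<in>{1..p}. (c i * symmetrized_weight \<gamma> k (\<tau> i)) ^ p)"
      using bound unfolding J_def by (intro prod_mono_ennreal) simp
    also have "\<dots> = (\<Prod>i\<in>{1..p}. c i * symmetrized_weight \<gamma> k (\<tau> i)) ^ p"
      by (rule prod_power_distrib[symmetric])
    finally have "(\<integral>\<^sup>+x. (\<Prod>i\<in>{1..p}. ennreal \<bar>J i (\<tau> i) x\<bar>) \<partial>?P) ^ p
        \<le> (\<Prod>i\<in>{1..p}. c i * symmetrized_weight \<gamma> k (\<tau> i)) ^ p" by simp
    then show "(\<integral>\<^sup>+x. (\<Prod>i\<in>{1..p}. ennreal \<bar>J i (\<tau> i) x\<bar>) \<partial>?P) \<le> (\<Prod>i\<in>{1..p}. c i * symmetrized_weight \<gamma> k (\<tau> i))"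
      using p by (rule ennreal_power_le_imp_le)
  qed
  also have "\<dots> = (\<Prod>i\<in>{1..p}. \<integral>\<^sup>+s. c i * symmetrized_weight \<gamma> k s \<partial>?S)"
    by (rule SP.product_nn_integral_prod) (auto intro!: borel_measurable_times_ennreal symmetrized_weight_measurable[OF t])
  also have "\<dots> \<le> (\<Prod>i\<in>{1..p}. c i * (fact k * (ennreal (exp t) * time_constant \<gamma> ^ k)))"
  proof (intro prod_mono_ennreal)
    fix i
    have "(\<integral>\<^sup>+s. c i * symmetrized_weight \<gamma> k s \<partial>?S) = c i * (\<integral>\<^sup>+s. symmetrized_weight \<gamma> k s \<partial>?S)"
      by (rule nn_integral_cmult[OF symmetrized_weight_measurable[OF t]])
    also have "\<dots> \<le> c i * (fact k * (ennreal (exp t) * time_constant \<gamma> ^ k))"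
      by (intro mult_left_mono symmetrized_weight_integral[OF t]) simp
    finally show "(\<integral>\<^sup>+s. c i * symmetrized_weight \<gamma> k s \<partial>?S) \<le> c i * (fact k * (ennreal (exp t) * time_constant \<gamma> ^ k))" .
  qed
  finally show "(\<integral>\<^sup>+\<omega>. ennreal (mixed_functional p Q X t f \<omega> ^ k) \<partial>M)
      \<le> ennreal C ^ k * (\<Prod>i\<in>{1..p}. c i * (fact k * (ennreal (exp t) * time_constant \<gamma> ^ k)))"
    by (simp add: Z_def mult_left_mono)
qed

section \<open>Differences of approximated intersection measures\<close>

definition ball_density :: "real \<Rightarrow> 'a::euclidean_space \<Rightarrow> 'a \<Rightarrow> real" where
  "ball_density \<epsilon> x y = indicat_real (ball x \<epsilon>) y / measure lborel (ball x \<epsilon>)"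

lemma q_eq_lift_killed: "q \<epsilon> x z = lift_killed (ball_density \<epsilon>) x z"
  by (simp add: q_def lift_killed_def ball_density_def split: option.split)

context
  fixes \<epsilon> :: real
  assumes \<epsilon>: "\<epsilon> > 0"
begin

lemma measure_ball_eq:
  "measure lborel (ball (x::'a::euclidean_space) \<epsilon>) = unit_ball_vol (real DIM('a)) * \<epsilon> ^ DIM('a)"
  using \<epsilon> content_ball[of \<epsilon> x] by (simp add: measure_completion)

text \<open>The volume of a ball does not depend on its centre. This makes the density symmetric, so
  both mass bounds of \<open>mollifier\<close> follow from one integral.\<close>

lemma ball_density_eq:
  fixes x y :: "'a::euclidean_space"
  shows "ball_density \<epsilon> x y = (if dist x y < \<epsilon> then 1 / (unit_ball_vol (real DIM('a)) * \<epsilon> ^ DIM('a)) else 0)"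
  unfolding ball_density_def measure_ball_eq by (simp add: indicator_def)

lemma ball_density_measurable:
  "case_prod (ball_density \<epsilon>) \<in> borel_measurable (borel \<Otimes>\<^sub>M (borel :: 'a::euclidean_space measure))"
  unfolding ball_density_eq by measurable

lemma ball_density_nonneg: "0 \<le> ball_density \<epsilon> x y"
  using \<epsilon> by (simp add: ball_density_eq)

lemma ball_density_le:
  fixes x y :: "'a::euclidean_space"
  shows "ball_density \<epsilon> x y \<le> 1 / (unit_ball_vol (real DIM('a)) * \<epsilon> ^ DIM('a))"
  using \<epsilon> by (simp add: ball_density_eq)

lemma ball_density_commute: "ball_density \<epsilon> x y = ball_density \<epsilon> y x"
  by (simp add: ball_density_eq dist_commute)

lemma nn_integral_ball_density:
  fixes x :: "'a::euclidean_space"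
  shows "(\<integral>\<^sup>+y. ennreal (ball_density \<epsilon> x y) \<partial>lborel) = 1"
proof -
  let ?v = "unit_ball_vol (real DIM('a)) * \<epsilon> ^ DIM('a)"
  have v: "?v > 0" using \<epsilon> by simp
  have "(\<integral>\<^sup>+y. ennreal (ball_density \<epsilon> x y) \<partial>lborel) = (\<integral>\<^sup>+y. ennreal (1 / ?v) * indicator (ball x \<epsilon>) y \<partial>lborel)"
    by (intro nn_integral_cong) (simp add: ball_density_eq indicator_def)
  also have "\<dots> = ennreal (1 / ?v) * emeasure lborel (ball x \<epsilon>)"
    by (rule nn_integral_cmult_indicator) simp
  also have "\<dots> = ennreal (1 / ?v * ?v)"
    using \<epsilon> v by (simp only: emeasure_ball[OF less_imp_le[OF \<epsilon>]] ennreal_mult'[symmetric] zero_le_divide_1_iff less_imp_le)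
  also have "1 / ?v * ?v = 1" using v by (metis less_irrefl nonzero_eq_divide_eq)
  finally show ?thesis by simp
qed

lemma integrable_ball_density: "integrable lborel (ball_density \<epsilon> (x::'a::euclidean_space))"
proof (rule integrableI_bounded)
  note [measurable] = ball_density_measurable[where 'a = 'a]
  show "ball_density \<epsilon> x \<in> borel_measurable lborel" by measurable
  show "(\<integral>\<^sup>+y. ennreal (norm (ball_density \<epsilon> x y)) \<partial>lborel) < \<infinity>"
    using nn_integral_ball_density[of x] by (simp add: ball_density_nonneg)
qed

lemma integral_ball_density: "(LINT y|lborel. ball_density \<epsilon> (x::'a::euclidean_space) y) = 1"
proof -
  have "(LINT y|lborel. ball_density \<epsilon> x y) = enn2real (\<integral>\<^sup>+y. ennreal (ball_density \<epsilon> x y) \<partial>lborel)"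
    by (rule integral_eq_nn_integral) (use integrable_ball_density[of x] ball_density_nonneg in auto)
  then show ?thesis by (simp add: nn_integral_ball_density)
qed

end

section \<open>Mollifiers built from ball densities, and telescoping\<close>

definition density_bound :: "'a::euclidean_space itself \<Rightarrow> real \<Rightarrow> real" where
  "density_bound _ \<epsilon> = 1 / (unit_ball_vol (real DIM('a)) * \<epsilon> ^ DIM('a))"

lemma mollifier_ball_density:
  fixes K :: "'a::euclidean_space set"
  assumes \<epsilon>: "\<epsilon> > 0" and b: "density_bound TYPE('a) \<epsilon> \<le> b"
    and K: "K \<in> sets borel" "emeasure lborel K < \<infinity>" and p: "p \<ge> 1"
  shows "mollifier (ball_density \<epsilon> :: 'a \<Rightarrow> 'a \<Rightarrow> real) b K p"
proof
  fix x y :: 'a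
  show "\<bar>ball_density \<epsilon> x y\<bar> \<le> b"
    using ball_density_le[OF \<epsilon>, of x y] ball_density_nonneg[OF \<epsilon>, of x y] b by (simp add: density_bound_def)
  show "(\<integral>\<^sup>+y. ennreal \<bar>ball_density \<epsilon> x y\<bar> \<partial>lborel) \<le> 2"
    using nn_integral_ball_density[OF \<epsilon>, of x] by (simp add: ball_density_nonneg[OF \<epsilon>])
  show "(\<integral>\<^sup>+x. ennreal \<bar>ball_density \<epsilon> x y\<bar> \<partial>lborel) \<le> 2"
    using nn_integral_ball_density[OF \<epsilon>, of y] by (simp add: ball_density_nonneg[OF \<epsilon>] ball_density_commute[OF \<epsilon>, of _ y])
qed (use K p ball_density_measurable[OF \<epsilon>] in auto)

lemma mollifier_ball_density_diff:
  fixes K :: "'a::euclidean_space set"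
  assumes \<epsilon>: "\<epsilon> > 0" and \<delta>: "\<delta> > 0" and b: "density_bound TYPE('a) \<epsilon> \<le> b" "density_bound TYPE('a) \<delta> \<le> b"
    and K: "K \<in> sets borel" "emeasure lborel K < \<infinity>" and p: "p \<ge> 1"
  shows "mollifier (\<lambda>(x::'a) y. ball_density \<epsilon> x y - ball_density \<delta> x y) b K p"
proof
  note [measurable] = ball_density_measurable[OF \<epsilon>, where 'a = 'a] ball_density_measurable[OF \<delta>, where 'a = 'a]
  fix x y :: 'a
  have le: "\<bar>ball_density \<epsilon> x y - ball_density \<delta> x y\<bar> \<le> ball_density \<epsilon> x y + ball_density \<delta> x y" for x y :: 'a
    using ball_density_nonneg[OF \<epsilon>, of x y] ball_density_nonneg[OF \<delta>, of x y] by linarith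
  show "\<bar>ball_density \<epsilon> x y - ball_density \<delta> x y\<bar> \<le> b"
    using ball_density_le[OF \<epsilon>, of x y] ball_density_nonneg[OF \<epsilon>, of x y]
      ball_density_le[OF \<delta>, of x y] ball_density_nonneg[OF \<delta>, of x y] b by (auto simp: density_bound_def abs_le_iff)
  show "(\<lambda>(x, y). ball_density \<epsilon> x y - ball_density \<delta> x y) \<in> borel_measurable (borel \<Otimes>\<^sub>M (borel :: 'a measure))"
    by measurable
  have "(\<integral>\<^sup>+y. ennreal \<bar>ball_density \<epsilon> x y - ball_density \<delta> x y\<bar> \<partial>lborel)
      \<le> (\<integral>\<^sup>+y. ennreal (ball_density \<epsilon> x y) + ennreal (ball_density \<delta> x y) \<partial>lborel)" for x :: 'a
    using le by (intro nn_integral_mono)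
      (auto simp: ennreal_plus[symmetric] ball_density_nonneg[OF \<epsilon>] ball_density_nonneg[OF \<delta>] simp del: ennreal_plus intro!: ennreal_leI)
  also have "(\<integral>\<^sup>+y. ennreal (ball_density \<epsilon> x y) + ennreal (ball_density \<delta> x y) \<partial>lborel) = 2" for x :: 'a
    by (subst nn_integral_add) (auto simp: nn_integral_ball_density[OF \<epsilon>] nn_integral_ball_density[OF \<delta>])
  finally have mass: "(\<integral>\<^sup>+y. ennreal \<bar>ball_density \<epsilon> x y - ball_density \<delta> x y\<bar> \<partial>lborel) \<le> 2" for x :: 'a .
  show "(\<integral>\<^sup>+y. ennreal \<bar>ball_density \<epsilon> x y - ball_density \<delta> x y\<bar> \<partial>lborel) \<le> 2" by (rule mass)
  show "(\<integral>\<^sup>+x. ennreal \<bar>ball_density \<epsilon> x y - ball_density \<delta> x y\<bar> \<partial>lborel) \<le> 2"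
    using mass[of y] by (simp add: ball_density_commute[OF \<epsilon>, of _ y] ball_density_commute[OF \<delta>, of _ y])
qed (use K p in auto)

text \<open>The factors are exchanged one at a time from the first on; summand j records the
  exchange of the j-th.\<close>

lemma prod_telescope:
  fixes a b :: "nat \<Rightarrow> real"
  shows "(\<Prod>i\<in>{1..n}. a i) - (\<Prod>i\<in>{1..n}. b i)
    = (\<Sum>j\<in>{1..n}. \<Prod>i\<in>{1..n}. if i < j then b i else if i = j then a i - b i else a i)"
proof (induction n)
  case (Suc n)
  let ?F = "\<lambda>j i. if i < j then b i else if i = j then a i - b i else a i"
  have "(\<Sum>j\<in>{1..Suc n}. \<Prod>i\<in>{1..Suc n}. ?F j i)
    = (\<Sum>j\<in>{1..n}. (\<Prod>i\<in>{1..n}. ?F j i) * a (Suc n)) + (\<Prod>i\<in>{1..n}. b i) * (a (Suc n) - b (Suc n))"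
  proof -
    have "(\<Sum>j\<in>{1..n}. \<Prod>i\<in>{1..Suc n}. ?F j i) = (\<Sum>j\<in>{1..n}. (\<Prod>i\<in>{1..n}. ?F j i) * a (Suc n))"
      by (intro sum.cong) auto
    moreover have "(\<Prod>i\<in>{1..Suc n}. ?F (Suc n) i) = (\<Prod>i\<in>{1..n}. b i) * (a (Suc n) - b (Suc n))"
      by (simp add: prod.nat_ivl_Suc')
    ultimately show ?thesis by simp
  qed
  also have "\<dots> = ((\<Prod>i\<in>{1..n}. a i) - (\<Prod>i\<in>{1..n}. b i)) * a (Suc n) + (\<Prod>i\<in>{1..n}. b i) * (a (Suc n) - b (Suc n))"
    unfolding Suc sum_distrib_right ..
  also have "\<dots> = (\<Prod>i\<in>{1..Suc n}. a i) - (\<Prod>i\<in>{1..Suc n}. b i)"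
    by (simp add: algebra_simps)
  finally show ?case ..
qed simp

text \<open>The sum is at most its number of terms times the largest modulus, and for even k the
  k-th power of that modulus is one of the nonnegative terms on the right.\<close>

lemma sum_power_even_le:
  fixes z :: "'i \<Rightarrow> real"
  assumes J: "finite J" and k: "even k" "k \<ge> 1"
  shows "(\<Sum>j\<in>J. z j) ^ k \<le> real (card J) ^ k * (\<Sum>j\<in>J. z j ^ k)"
proof (cases "J = {}")
  case False
  define m where "m = Max ((\<lambda>j. \<bar>z j\<bar>) ` J)"
  have "m \<in> (\<lambda>j. \<bar>z j\<bar>) ` J" unfolding m_def using J False by (intro Max_in) auto
  then obtain j0 where j0: "j0 \<in> J" "m = \<bar>z j0\<bar>" by auto
  have "\<bar>\<Sum>j\<in>J. z j\<bar> \<le> (\<Sum>j\<in>J. \<bar>z j\<bar>)" by (rule sum_abs)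
  also have "\<dots> \<le> real (card J) * m"
    using J by (intro sum_bounded_above) (auto simp: m_def)
  finally have "\<bar>\<Sum>j\<in>J. z j\<bar> ^ k \<le> (real (card J) * m) ^ k"
    by (intro power_mono) auto
  also have "\<dots> = real (card J) ^ k * z j0 ^ k"
    using k by (simp add: power_mult_distrib j0 power_even_abs)
  also have "\<dots> \<le> real (card J) ^ k * (\<Sum>j\<in>J. z j ^ k)"
    using J j0 k by (intro mult_left_mono member_le_sum) (auto simp: zero_le_even_power)
  finally show ?thesis using k by (simp add: power_even_abs)
qed (use k in \<open>simp add: zero_power\<close>)

text \<open>Only the values of f on D are meaningful, hence the factor
  \<open>indicat_real D\<close>. Compactness of K within D provides a positive distance to the
  complement, which the cancellation estimate consumes.\<close>

locale intersection_setting =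
  fixes M :: "'w measure" and D K :: "'a::euclidean_space set" and p :: nat and x0 :: "nat \<Rightarrow> 'a"
    and X :: "nat \<Rightarrow> real \<Rightarrow> 'w \<Rightarrow> 'a option" and f :: "'a \<Rightarrow> real" and C \<gamma> :: real
  assumes M: "prob_space M" and D: "open D" and x0: "\<And>i. i \<in> {1..p} \<Longrightarrow> x0 i \<in> D"
    and X: "\<And>i. i \<in> {1..p} \<Longrightarrow> killed_brownian_motion M D (x0 i) (X i)"
    and ind: "independent_killed_processes M D p X"
    and K: "compact K" "K \<subseteq> D" and p: "p \<ge> 2"
    and f: "(\<lambda>x. indicat_real D x * f x) \<in> borel_measurable borel"
    and f_bound: "\<And>x. \<bar>indicat_real D x * f x\<bar> \<le> C" and f_supp: "\<And>x. x \<in> D - K \<Longrightarrow> f x = 0"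
    and C: "C > 0"
    and \<gamma>: "critical_exponent TYPE('a) p < \<gamma>" "\<gamma> < 1"
begin

sublocale prob_space M by (rule M)

lemma K_borel: "K \<in> sets borel" and K_finite: "emeasure lborel K < \<infinity>"
  using K emeasure_compact_finite[of K] by (auto intro: borel_compact)

lemma p1: "p \<ge> 1" using p by simp

lemma f_supp': "x \<notin> K \<Longrightarrow> indicat_real D x * f x = 0"
  using f_supp[of x] by (cases "x \<in> D") auto

definition approx :: "real \<Rightarrow> real \<Rightarrow> 'w \<Rightarrow> real" where
  "approx t \<epsilon> \<omega> = approx_IS D p (\<lambda>i s. X i s \<omega>) t \<epsilon> f"

lemma approx_eq:
  assumes \<epsilon>: "\<epsilon> > 0" and \<omega>: "\<omega> \<in> space M"
  shows "approx t \<epsilon> \<omega> = mixed_functional p (\<lambda>_. ball_density \<epsilon>) X t (\<lambda>x. indicat_real D x * f x) \<omega>"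
proof -
  have "(LINT s:{0..t}|lborel. q \<epsilon> x (X i s \<omega>)) = (LINT s|on_set {0..t}. lift_killed (ball_density \<epsilon>) x (X i (max 0 s) \<omega>))"
    if i: "i \<in> {1..p}" for x i
  proof -
    have m: "(\<lambda>s. lift_killed (ball_density \<epsilon>) x (X i (max 0 s) \<omega>)) \<in> borel_measurable borel"
      by (rule killed_process_measurable'[OF X[OF i] D x0[OF i] ball_density_measurable[OF \<epsilon>]]) (use \<omega> in measurable)
    have "(LINT s|on_set {0..t}. lift_killed (ball_density \<epsilon>) x (X i (max 0 s) \<omega>))
      = (LINT s|lborel. indicat_real {0..t} s * lift_killed (ball_density \<epsilon>) x (X i (max 0 s) \<omega>))"
      by (rule integral_on_set[OF _ m]) simp
    also have "\<dots> = (LINT s:{0..t}|lborel. q \<epsilon> x (X i s \<omega>))"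
      unfolding set_lebesgue_integral_def
      by (intro Bochner_Integration.integral_cong) (auto simp: q_eq_lift_killed indicator_def)
    finally show ?thesis ..
  qed
  then show ?thesis
    unfolding approx_def approx_IS_def mixed_functional_def set_lebesgue_integral_def[of lborel D]
    by (intro Bochner_Integration.integral_cong refl) (simp add: mult.assoc)
qed

definition telescope_kernel :: "real \<Rightarrow> real \<Rightarrow> nat \<Rightarrow> nat \<Rightarrow> 'a \<Rightarrow> 'a \<Rightarrow> real" where
  "telescope_kernel \<epsilon> \<delta> j i = (if i < j then ball_density \<delta> else if i = j
     then (\<lambda>x y. ball_density \<epsilon> x y - ball_density \<delta> x y) else ball_density \<epsilon>)"

definition common_bound :: "real \<Rightarrow> real \<Rightarrow> real" where
  "common_bound \<epsilon> \<delta> = max (density_bound TYPE('a) \<epsilon>) (density_bound TYPE('a) \<delta>)"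

lemma telescope_mollifier:
  assumes "\<epsilon> > 0" "\<delta> > 0"
  shows "mollifier (telescope_kernel \<epsilon> \<delta> j i) (common_bound \<epsilon> \<delta>) K p"
  unfolding telescope_kernel_def common_bound_def using assms K_borel K_finite p1
  by (auto intro!: mollifier_ball_density mollifier_ball_density_diff)

lemma occupation_integrable:
  assumes i: "i \<in> {1..p}" and Q: "mollifier Q b K p" and t: "t \<ge> 0" and \<omega>: "\<omega> \<in> space M"
  shows "integrable (on_set {0..t}) (\<lambda>s. lift_killed Q x (X i (max 0 s) \<omega>))"
proof -
  interpret T: finite_measure "on_set {0..t}"
    by (rule finite_measure_on_set) (use t in simp_all)
  show ?thesis
  proof (rule T.integrable_of_bound)
    show "(\<lambda>s. lift_killed Q x (X i (max 0 s) \<omega>)) \<in> borel_measurable (on_set {0..t})"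
      by (rule killed_process_measurable'[OF X[OF i] D x0[OF i] mollifier.Q_measurable[OF Q]]) (use \<omega> in measurable)
    show "\<bar>lift_killed Q x (X i (max 0 s) \<omega>)\<bar> \<le> b" for s
      using mollifier.Q_bound[OF Q] mollifier.b_nonneg[OF Q] by (auto simp: lift_killed_def split: option.splits)
  qed
qed

lemma joint_moment_unordered:
  assumes i: "i \<in> {1..p}" and Q: "mollifier Q b K p" and c: "c \<noteq> 0"
    and ordered: "\<And>r. (\<And>l. r l > 0) \<Longrightarrow>
      (\<integral>\<^sup>+x. ennreal \<bar>joint_moment M (X i) Q k (\<lambda>l. sum r {..<Suc l}) x\<bar> ^ p \<partial>PiM {0..<k} (\<lambda>_. on_set K))
        \<le> (c * (\<Prod>l<k. gap_weight \<gamma> (r l))) ^ p"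
  shows "(\<integral>\<^sup>+x. ennreal \<bar>joint_moment M (\<lambda>s. X i (max 0 s)) Q k s x\<bar> ^ p \<partial>PiM {0..<k} (\<lambda>_. on_set K))
     \<le> (c * symmetrized_weight \<gamma> k s) ^ p"
  by (rule joint_moment_unordered_bound[OF M X[OF i] D x0[OF i] Q c ordered])

text \<open>C bounds f, and each of the p processes contributes 2 from the mass of its kernel and
  the constant of one time gap. The factor p^2 pays for telescoping: one p from the power of a sum
  of p terms, one from their number, as p \<le> p^k.\<close>

definition moment_scale :: real where
  "moment_scale = real p ^ 2 * (C * (2 * enn2real (time_constant \<gamma>)) ^ p)"

text \<open>A gain of \<theta> per point for the difference of two ball densities. As a predicate it
  lets one moment estimate serve two cases: \<theta> = 1 for every \<epsilon>, and arbitrarily small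
  \<theta> for small \<epsilon>.\<close>

definition difference_bound :: "real \<Rightarrow> real \<Rightarrow> real \<Rightarrow> nat \<Rightarrow> bool" where
  "difference_bound \<theta> \<epsilon> \<delta> k \<longleftrightarrow> (\<forall>i\<in>{1..p}. \<forall>r. (\<forall>l. r l > 0) \<longrightarrow>
      (\<integral>\<^sup>+x. ennreal \<bar>joint_moment M (X i) (\<lambda>x y. ball_density \<epsilon> x y - ball_density \<delta> x y) k (\<lambda>l. sum r {..<Suc l}) x\<bar> ^ p
          \<partial>PiM {0..<k} (\<lambda>_. on_set K))
        \<le> (ennreal (\<theta> ^ k) * 2 ^ k * (\<Prod>l<k. gap_weight \<gamma> (r l))) ^ p)"

lemma approx_diff_moment:
  assumes \<epsilon>: "\<epsilon> > 0" and \<delta>: "\<delta> > 0" and t: "t \<ge> 0" and k: "even k" "k \<ge> 1" and \<theta>: "\<theta> > 0"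
    and small: "difference_bound \<theta> \<epsilon> \<delta> k"
  shows "(\<integral>\<^sup>+\<omega>. ennreal ((approx t \<epsilon> \<omega> - approx t \<delta> \<omega>) ^ k) \<partial>M)
     \<le> ennreal (exp (real p * t) * fact k ^ p * (moment_scale * \<theta>) ^ k)"
proof -
  let ?f = "\<lambda>x. indicat_real D x * f x"
  let ?Q = "telescope_kernel \<epsilon> \<delta>"
  let ?b = "common_bound \<epsilon> \<delta>"
  define Z where "Z j \<omega> = mixed_functional p (?Q j) X t ?f \<omega>" for j \<omega>
  define G where "G = enn2real (time_constant \<gamma>)"
  have G: "time_constant \<gamma> = ennreal G" "G \<ge> 0"
    using time_constant_finite[OF \<gamma>(2)] by (auto simp: G_def less_top)
  \<comment> \<open>In summand j only process j carries a difference of densities, so the gain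
    \<theta>^k occurs exactly once in the product over the processes.\<close>
  define c where "c j i = (if i = j then ennreal (\<theta> ^ k) * 2 ^ k else 2 ^ k)" for j i :: nat
  have bound: "(\<integral>\<^sup>+x. ennreal \<bar>joint_moment M (\<lambda>s. X i (max 0 s)) (?Q j i) k s x\<bar> ^ p \<partial>PiM {0..<k} (\<lambda>_. on_set K))
        \<le> (c j i * symmetrized_weight \<gamma> k s) ^ p" if i: "i \<in> {1..p}" for i j s
  proof (rule joint_moment_unordered[OF i telescope_mollifier[OF \<epsilon> \<delta>]])
    show "c j i \<noteq> 0" using \<theta> by (simp add: c_def)
    fix r :: "nat \<Rightarrow> real" assume r: "\<And>l. r l > 0"
    show "(\<integral>\<^sup>+x. ennreal \<bar>joint_moment M (X i) (?Q j i) k (\<lambda>l. sum r {..<Suc l}) x\<bar> ^ p \<partial>PiM {0..<k} (\<lambda>_. on_set K))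
      \<le> (c j i * (\<Prod>l<k. gap_weight \<gamma> (r l))) ^ p"
    proof (cases "i = j")
      case True
      then show ?thesis
        using small i r unfolding difference_bound_def by (simp add: telescope_kernel_def c_def)
    next
      case False
      then show ?thesis
        using joint_moment_abs_bound[OF M D x0[OF i] X[OF i] telescope_mollifier[OF \<epsilon> \<delta>] r less_imp_le[OF \<gamma>(1)]]
        by (simp add: c_def)
    qed
  qed
  note mixed = mixed_moment_bound[OF M D x0 X ind telescope_mollifier[OF \<epsilon> \<delta>] p1 t k(1) f f_bound f_supp' bound]
  have Z_meas: "Z j \<in> borel_measurable M" for j
    unfolding Z_def[abs_def] by (rule mixed(1))
  define E where "E = C ^ k * (\<theta> ^ k * ((2 ^ k) ^ p * (fact k * (exp t * G ^ k)) ^ p))"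
  have E0: "E \<ge> 0" using C \<theta> G by (simp add: E_def)
  have Z_moment: "(\<integral>\<^sup>+\<omega>. ennreal (Z j \<omega> ^ k) \<partial>M) \<le> ennreal E" if j: "j \<in> {1..p}" for j
  proof -
    have "(\<integral>\<^sup>+\<omega>. ennreal (Z j \<omega> ^ k) \<partial>M)
      \<le> ennreal C ^ k * (\<Prod>i\<in>{1..p}. c j i * (fact k * (ennreal (exp t) * time_constant \<gamma> ^ k)))"
      unfolding Z_def by (rule mixed(2))
    also have "(\<Prod>i\<in>{1..p}. c j i * (fact k * (ennreal (exp t) * time_constant \<gamma> ^ k)))
       = ennreal (\<theta> ^ k) * ((2 ^ k) ^ p * (fact k * (ennreal (exp t) * time_constant \<gamma> ^ k)) ^ p)"
    proof -
      have "c j i = (if i = j then ennreal (\<theta> ^ k) else 1) * 2 ^ k" for i by (simp add: c_def)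
      then have "(\<Prod>i\<in>{1..p}. c j i) = (\<Prod>i\<in>{1..p}. if i = j then ennreal (\<theta> ^ k) else 1) * (2 ^ k) ^ p"
        by (simp add: prod.distrib)
      also have "(\<Prod>i\<in>{1..p}. if i = j then ennreal (\<theta> ^ k) else 1) = ennreal (\<theta> ^ k)"
        using j by (subst prod.delta) auto
      finally show ?thesis by (simp add: prod.distrib mult.assoc)
    qed
    also have "ennreal C ^ k * \<dots> = ennreal E"
    proof -
      have "(fact k :: ennreal) = ennreal (fact k)"
        by (metis ennreal_of_nat_eq_real_of_nat of_nat_fact)
      moreover have "(2::ennreal) ^ k = ennreal (2 ^ k)"
        by (simp add: ennreal_power[symmetric])
      ultimately show ?thesis
        using C \<theta> G by (simp add: E_def ennreal_power ennreal_mult'[symmetric])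
    qed
    finally show ?thesis .
  qed
  have diff: "approx t \<epsilon> \<omega> - approx t \<delta> \<omega> = (\<Sum>j\<in>{1..p}. Z j \<omega>)" if \<omega>: "\<omega> \<in> space M" for \<omega>
  proof -
    define A where "A \<epsilon> i x = (LINT s|on_set {0..t}. lift_killed (ball_density \<epsilon>) x (X i (max 0 s) \<omega>))" for \<epsilon> i x
    have moll: "mollifier (ball_density \<epsilon>) ?b K p" "mollifier (ball_density \<delta>) ?b K p"
      using telescope_mollifier[OF \<epsilon> \<delta>, of 0 1] telescope_mollifier[OF \<epsilon> \<delta>, of 1 0]
      by (simp_all add: telescope_kernel_def)
    have Q_int: "(LINT s|on_set {0..t}. lift_killed (?Q j i) x (X i (max 0 s) \<omega>))
       = (if i < j then A \<delta> i x else if i = j then A \<epsilon> i x - A \<delta> i x else A \<epsilon> i x)" if i: "i \<in> {1..p}" for i j x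
    proof -
      have "lift_killed (\<lambda>x y. ball_density \<epsilon> x y - ball_density \<delta> x y) x z
         = lift_killed (ball_density \<epsilon>) x z - lift_killed (ball_density \<delta>) x z" for z
        by (cases z) auto
      then show ?thesis
        unfolding A_def telescope_kernel_def
        using Bochner_Integration.integral_diff[OF occupation_integrable[OF i moll(1) t \<omega>, of x]
            occupation_integrable[OF i moll(2) t \<omega>, of x]]
        by auto
    qed
    have int1: "integrable lborel (\<lambda>x. ?f x * (\<Prod>i\<in>{1..p}. A e i x))" if "e = \<epsilon> \<or> e = \<delta>" for e
    proof -
      have moll_e: "mollifier (ball_density e) ?b K p" using that moll by auto
      have e: "e > 0" using that \<epsilon> \<delta> by auto
      have b: "(\<integral>\<^sup>+x. ennreal \<bar>joint_moment M (\<lambda>s. X i (max 0 s)) (ball_density e) 0 s x\<bar> ^ p \<partial>PiM {0..<0} (\<lambda>_. on_set K))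
        \<le> (1 * symmetrized_weight \<gamma> 0 s) ^ p" if i: "i \<in> {1..p}" for i s
        using joint_moment_abs_bound[OF M D x0[OF i] X[OF i] moll_e _ less_imp_le[OF \<gamma>(1)], of _ 0]
        by (intro joint_moment_unordered[OF i moll_e]) auto
      show ?thesis
        unfolding A_def
        by (rule mixed_moment_bound(3)[where k = 0, OF M D x0 X ind moll_e p1 t dvd_0_right f f_bound f_supp' b])
          (use \<omega> in auto)
    qed
    have int2: "integrable lborel (\<lambda>x. ?f x * (\<Prod>i\<in>{1..p}. if i < j then A \<delta> i x else if i = j then A \<epsilon> i x - A \<delta> i x else A \<epsilon> i x))" for j
    proof -
      have "integrable lborel (\<lambda>x. ?f x * (\<Prod>i\<in>{1..p}. LINT s|on_set {0..t}. lift_killed (?Q j i) x (X i (max 0 s) \<omega>)))"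
        by (rule mixed(3)) (use \<omega> in auto)
      then show ?thesis using Q_int by simp
    qed
    have "approx t \<epsilon> \<omega> - approx t \<delta> \<omega> = (LINT x|lborel. ?f x * (\<Prod>i\<in>{1..p}. A \<epsilon> i x)) - (LINT x|lborel. ?f x * (\<Prod>i\<in>{1..p}. A \<delta> i x))"
      unfolding approx_eq[OF \<epsilon> \<omega>] approx_eq[OF \<delta> \<omega>] mixed_functional_def A_def ..
    also have "\<dots> = (LINT x|lborel. ?f x * (\<Prod>i\<in>{1..p}. A \<epsilon> i x) - ?f x * (\<Prod>i\<in>{1..p}. A \<delta> i x))"
      by (rule Bochner_Integration.integral_diff[symmetric]) (use int1 in auto)
    also have "\<dots> = (LINT x|lborel. (\<Sum>j\<in>{1..p}. ?f x * (\<Prod>i\<in>{1..p}. if i < j then A \<delta> i x else if i = j then A \<epsilon> i x - A \<delta> i x else A \<epsilon> i x)))"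
      by (simp only: right_diff_distrib[symmetric] prod_telescope sum_distrib_left)
    also have "\<dots> = (\<Sum>j\<in>{1..p}. LINT x|lborel. ?f x * (\<Prod>i\<in>{1..p}. if i < j then A \<delta> i x else if i = j then A \<epsilon> i x - A \<delta> i x else A \<epsilon> i x))"
      by (rule Bochner_Integration.integral_sum) (rule int2)
    also have "\<dots> = (\<Sum>j\<in>{1..p}. Z j \<omega>)"
      unfolding Z_def mixed_functional_def using Q_int by simp
    finally show ?thesis .
  qed
  have "(\<integral>\<^sup>+\<omega>. ennreal ((approx t \<epsilon> \<omega> - approx t \<delta> \<omega>) ^ k) \<partial>M)
     \<le> (\<integral>\<^sup>+\<omega>. ennreal (real p ^ k) * (\<Sum>j\<in>{1..p}. ennreal (Z j \<omega> ^ k)) \<partial>M)"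
  proof (intro nn_integral_mono)
    fix \<omega> assume \<omega>: "\<omega> \<in> space M"
    have "(approx t \<epsilon> \<omega> - approx t \<delta> \<omega>) ^ k \<le> real p ^ k * (\<Sum>j\<in>{1..p}. Z j \<omega> ^ k)"
      unfolding diff[OF \<omega>] using sum_power_even_le[of "{1..p}" k "\<lambda>j. Z j \<omega>"] k by simp
    then have "ennreal ((approx t \<epsilon> \<omega> - approx t \<delta> \<omega>) ^ k) \<le> ennreal (real p ^ k * (\<Sum>j\<in>{1..p}. Z j \<omega> ^ k))"
      by (rule ennreal_leI)
    also have "\<dots> = ennreal (real p ^ k) * (\<Sum>j\<in>{1..p}. ennreal (Z j \<omega> ^ k))"
      using k by (simp add: ennreal_mult' zero_le_even_power)
    finally show "ennreal ((approx t \<epsilon> \<omega> - approx t \<delta> \<omega>) ^ k) \<le> ennreal (real p ^ k) * (\<Sum>j\<in>{1..p}. ennreal (Z j \<omega> ^ k))" .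
  qed
  also have "\<dots> = ennreal (real p ^ k) * (\<Sum>j\<in>{1..p}. \<integral>\<^sup>+\<omega>. ennreal (Z j \<omega> ^ k) \<partial>M)"
    using Z_meas by (simp add: nn_integral_cmult nn_integral_sum)
  also have "\<dots> \<le> ennreal (real p ^ k) * (\<Sum>j\<in>{1..p}. ennreal E)"
    by (intro mult_left_mono sum_mono Z_moment) auto
  also have "\<dots> = ennreal (real p ^ k * (real p * E))"
    using E0 by (simp add: ennreal_mult' ennreal_of_nat_eq_real_of_nat)
  also have "\<dots> \<le> ennreal (exp (real p * t) * fact k ^ p * (moment_scale * \<theta>) ^ k)"
  proof (rule ennreal_leI)
    have "real p \<le> real p ^ k" using p k by (intro self_le_power) auto
    then have "real p ^ k * (real p * E) \<le> real p ^ k * (real p ^ k * E)"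
      using E0 by (intro mult_left_mono mult_right_mono) auto
    also have "\<dots> = exp (real p * t) * fact k ^ p * (moment_scale * \<theta>) ^ k"
      unfolding E_def moment_scale_def G_def[symmetric] exp_of_nat_mult
      by (simp add: power_mult_distrib power_mult[symmetric] power2_eq_square mult_ac)
    finally show "real p ^ k * (real p * E) \<le> exp (real p * t) * fact k ^ p * (moment_scale * \<theta>) ^ k" .
  qed
  finally show ?thesis .
qed

text \<open>Taken from the moment lemma with k = 0, where the products over points and times are
  empty.\<close>

lemma approx_measurable:
  assumes \<epsilon>: "\<epsilon> > 0" and t: "t \<ge> 0"
  shows "approx t \<epsilon> \<in> borel_measurable M"
proof -
  have moll: "mollifier (ball_density \<epsilon>) (density_bound TYPE('a) \<epsilon>) K p"
    by (rule mollifier_ball_density[OF \<epsilon> order_refl K_borel K_finite p1])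
  have b: "(\<integral>\<^sup>+x. ennreal \<bar>joint_moment M (\<lambda>s. X i (max 0 s)) (ball_density \<epsilon>) 0 s x\<bar> ^ p \<partial>PiM {0..<0} (\<lambda>_. on_set K))
    \<le> (1 * symmetrized_weight \<gamma> 0 s) ^ p" if i: "i \<in> {1..p}" for i s
    using joint_moment_abs_bound[OF M D x0[OF i] X[OF i] moll _ less_imp_le[OF \<gamma>(1)], of _ 0]
    by (intro joint_moment_unordered[OF i moll]) auto
  have "mixed_functional p (\<lambda>_. ball_density \<epsilon>) X t (\<lambda>x. indicat_real D x * f x) \<in> borel_measurable M"
    by (rule mixed_moment_bound(1)[where k = 0, OF M D x0 X ind moll p1 t dvd_0_right f f_bound f_supp' b])
  then show ?thesis by (subst measurable_cong[OF approx_eq[OF \<epsilon>]])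
qed

end

section \<open>Passage to the limit\<close>

text \<open>The central binomial coefficient is at most 4^k. After the moment has been doubled this
  returns to (k!)^2 at the price of a geometric factor.\<close>

lemma fact_double_le: "(fact (2 * k) :: real) \<le> (2 ^ k * fact k) ^ 2"
proof -
  have "(fact (2 * k) :: nat) = (2 * k choose k) * (fact k * fact k)"
    using binomial_fact_lemma[of k "2 * k"] by (simp add: mult_2 mult_ac)
  also have "\<dots> \<le> 2 ^ (2 * k) * (fact k * fact k)"
    by (intro mult_right_mono binomial_le_pow2) simp
  also have "\<dots> = (2 ^ k * fact k) ^ 2"
  proof -
    have "(2::nat) ^ (2 * k) = 2 ^ k * 2 ^ k"
      unfolding power_add[symmetric] by (rule arg_cong[where f = "\<lambda>n. 2 ^ n"]) simp
    then show ?thesis by (simp add: power2_eq_square mult_ac)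
  qed
  finally have "real (fact (2 * k)) \<le> real ((2 ^ k * fact k) ^ 2)" by (simp only: of_nat_le_iff)
  then show ?thesis by simp
qed

lemma abs_add_power_le: "\<bar>a + b\<bar> ^ k \<le> 2 ^ k * (\<bar>a\<bar> ^ k + \<bar>b\<bar> ^ k)" for a b :: real
proof -
  define m where "m = max \<bar>a\<bar> \<bar>b\<bar>"
  have "\<bar>a + b\<bar> ^ k \<le> (2 * m) ^ k" by (intro power_mono) (auto simp: m_def)
  also have "\<dots> \<le> 2 ^ k * (\<bar>a\<bar> ^ k + \<bar>b\<bar> ^ k)"
    unfolding power_mult_distrib by (intro mult_left_mono) (auto simp: m_def max_def)
  finally show ?thesis .
qed

lemma vague_integral_measurable:
  assumes \<mu>: "random_radon_measure M D \<mu>" and f: "f \<in> C_K D"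
  shows "(\<lambda>\<omega>. integral\<^sup>L (\<mu> \<omega>) f) \<in> borel_measurable M"
proof -
  let ?T = "vague_topology D"
  have sub: "{U. openin ?T U} \<subseteq> Pow (topspace ?T)" using openin_subset by blast
  have space: "space (topology_borel ?T) = radon_measures D"
    unfolding topology_borel_def space_measure_of[OF sub] by (rule topspace_vague_topology)
  have "(\<lambda>\<nu>. integral\<^sup>L \<nu> f) \<in> borel_measurable (topology_borel ?T)"
  proof (rule borel_measurableI)
    fix U :: "real set" assume U: "open U"
    have "openin ?T {\<nu> \<in> radon_measures D. integral\<^sup>L \<nu> f \<in> U}"
      unfolding vague_topology_def using f U by (intro topology_generated_by_Basis) blast
    then have "{\<nu> \<in> radon_measures D. integral\<^sup>L \<nu> f \<in> U} \<in> sets (topology_borel ?T)"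
      unfolding topology_borel_def sets_measure_of[OF sub] by auto
    also have "{\<nu> \<in> radon_measures D. integral\<^sup>L \<nu> f \<in> U} = (\<lambda>\<nu>. integral\<^sup>L \<nu> f) -` U \<inter> space (topology_borel ?T)"
      by (auto simp: space)
    finally show "(\<lambda>\<nu>. integral\<^sup>L \<nu> f) -` U \<inter> space (topology_borel ?T) \<in> sets (topology_borel ?T)" .
  qed
  with \<mu> show ?thesis
    unfolding random_radon_measure_def by (rule measurable_compose)
qed

context intersection_setting
begin

text \<open>No smallness is claimed; this supplies a finite admissible constant for every \<epsilon>
  > 0, however large.\<close>

lemma difference_bound_1:
  assumes "\<epsilon> > 0" "\<delta> > 0"
  shows "difference_bound 1 \<epsilon> \<delta> k"
  unfolding difference_bound_def
proof (intro ballI allI impI)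
  fix i and r :: "nat \<Rightarrow> real" assume i: "i \<in> {1..p}" and r: "\<forall>l. 0 < r l"
  have "mollifier (\<lambda>x y. ball_density \<epsilon> x y - ball_density \<delta> x y) (common_bound \<epsilon> \<delta>) K p"
    using telescope_mollifier[OF assms, of 1 1] by (simp add: telescope_kernel_def)
  from joint_moment_abs_bound[OF M D x0[OF i] X[OF i] this r[rule_format] less_imp_le[OF \<gamma>(1)], of k]
  show "(\<integral>\<^sup>+x. ennreal \<bar>joint_moment M (X i) (\<lambda>x y. ball_density \<epsilon> x y - ball_density \<delta> x y) k (\<lambda>l. sum r {..<Suc l}) x\<bar> ^ p
          \<partial>PiM {0..<k} (\<lambda>_. on_set K))
        \<le> (ennreal (1 ^ k) * 2 ^ k * (\<Prod>l<k. gap_weight \<gamma> (r l))) ^ p"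
    by simp
qed

lemma difference_bound_small:
  assumes \<theta>: "\<theta> > 0"
  shows "\<exists>\<epsilon>0>0. \<forall>\<epsilon> \<delta> k. 0 < \<delta> \<longrightarrow> \<delta> \<le> \<epsilon> \<longrightarrow> \<epsilon> < \<epsilon>0 \<longrightarrow> even k \<longrightarrow> difference_bound \<theta> \<epsilon> \<delta> k"
proof -
  \<comment> \<open>Each pair of points gains one factor \<Lambda>, so a gain \<theta> per point
    amounts to \<theta>^2 per pair.\<close>
  define \<Lambda> where "\<Lambda> = \<theta> ^ 2"
  define \<beta> where "\<beta> = critical_exponent TYPE('a) p"
  have \<Lambda>: "\<Lambda> > 0" using \<theta> by (simp add: \<Lambda>_def)
  \<comment> \<open>Solves h^(\<gamma> - \<beta>) = \<Lambda>, so that gaps shorter than h gain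
    exactly \<Lambda>. The threshold is fixed before \<epsilon> is made small.\<close>
  define h where "h = \<Lambda> powr (1 / (\<gamma> - \<beta>))"
  have h: "h > 0" "h powr (\<gamma> - \<beta>) = \<Lambda>"
    using \<Lambda> \<gamma> by (auto simp: h_def powr_powr \<beta>_def)
  obtain d where d: "d > 0" "\<And>x z. x \<in> K \<Longrightarrow> z \<notin> D \<Longrightarrow> d \<le> dist x z"
    using separate_compact_closed[of K "- D"] K D by (force simp: closed_Compl)
  define \<rho> where "\<rho> = d / 3"
  have \<rho>: "\<rho> > 0" "\<And>x z. x \<in> K \<Longrightarrow> z \<notin> D \<Longrightarrow> 3 * \<rho> \<le> dist x z" using d by (auto simp: \<rho>_def)
  \<comment> \<open>E \<epsilon> is the bound for two long gaps at radius \<epsilon>. Its linearity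
    in \<epsilon> leads to the threshold \<Lambda> / E below.\<close>
  define E where "E = (measure lborel K + 1) * (2 * (1 / sqrt (2 * pi * h)) ^ DIM('a) *
        ((1 / sqrt h) * (1 / sqrt (2 * pi * h)) ^ DIM('a)
          + (2 / \<rho> * (1 / \<rho>) ^ DIM('a) * (exp 1 * fact (Suc DIM('a))))))"
  have E: "E > 0"
    unfolding E_def using h \<rho>(1) by (intro mult_pos_pos add_nonneg_pos add_pos_pos) auto
  define \<epsilon>0 where "\<epsilon>0 = min \<rho> (\<Lambda> / E)"
  have "\<epsilon>0 > 0" using \<rho> \<Lambda> E by (simp add: \<epsilon>0_def)
  moreover have "difference_bound \<theta> \<epsilon> \<delta> k" if \<delta>: "0 < \<delta>" "\<delta> \<le> \<epsilon>" and \<epsilon>: "\<epsilon> < \<epsilon>0" and k: "even k" for \<epsilon> \<delta> k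
    unfolding difference_bound_def
  proof (intro ballI allI impI)
    fix i and r :: "nat \<Rightarrow> real" assume i: "i \<in> {1..p}" and r: "\<forall>l. 0 < r l"
    obtain m where m: "k = 2 * m" using k by auto
    have \<epsilon>': "\<epsilon> > 0" "\<epsilon> < \<rho>" "\<epsilon> < \<Lambda> / E" using \<delta> \<epsilon> by (auto simp: \<epsilon>0_def)
    have moll: "mollifier (\<lambda>x y. ball_density \<epsilon> x y - ball_density \<delta> x y) (common_bound \<epsilon> \<delta>) K p"
      using telescope_mollifier[OF \<epsilon>'(1) \<delta>(1), of 1 1] by (simp add: telescope_kernel_def)
    \<comment> \<open>Since \<delta> \<le> \<epsilon>, both densities are supported in the larger
      ball, and the oscillation over that ball controls the difference for all such
      \<delta>.\<close>
    have supp: "ball_density \<epsilon> x y - ball_density \<delta> x y = 0" if "y \<notin> ball x \<epsilon>" for x y :: 'a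
      using that \<delta> \<epsilon>'(1) by (simp add: ball_density_eq)
    have zero: "(LINT y|lborel. ball_density \<epsilon> x y - ball_density \<delta> x y) = 0" for x :: 'a
      using integral_ball_density[OF \<epsilon>'(1), of x] integral_ball_density[OF \<delta>(1), of x]
        integrable_ball_density[OF \<epsilon>'(1), of x] integrable_ball_density[OF \<delta>(1), of x] by simp
    have eL: "(measure lborel K + 1) * (2 * (1 / sqrt (2 * pi * h)) ^ DIM('a) *
        (((1 / sqrt h) * (1 / sqrt (2 * pi * h)) ^ DIM('a)
          + (2 / \<rho> * (1 / \<rho>) ^ DIM('a) * (exp 1 * fact (Suc DIM('a))))) * \<epsilon>)) \<le> \<Lambda>"
    proof -
      have "E * \<epsilon> \<le> \<Lambda>" using \<epsilon>'(3) E by (simp add: pos_less_divide_eq mult.commute)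
      then show ?thesis unfolding E_def by (simp only: mult.assoc)
    qed
    have "h powr (\<gamma> - critical_exponent TYPE('a) p) \<le> \<Lambda>" using h by (simp add: \<beta>_def)
    from joint_moment_small_bound[OF M D x0[OF i] X[OF i] moll p r[rule_format] \<gamma>(1) \<rho> \<epsilon>'(1,2) h(1) supp zero this eL, of m]
    show "(\<integral>\<^sup>+x. ennreal \<bar>joint_moment M (X i) (\<lambda>x y. ball_density \<epsilon> x y - ball_density \<delta> x y) k (\<lambda>l. sum r {..<Suc l}) x\<bar> ^ p
          \<partial>PiM {0..<k} (\<lambda>_. on_set K))
        \<le> (ennreal (\<theta> ^ k) * 2 ^ k * (\<Prod>l<k. gap_weight \<gamma> (r l))) ^ p"
      using \<theta> by (simp add: m \<Lambda>_def ennreal_power power_mult[symmetric])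
  qed
  ultimately show ?thesis by blast
qed

text \<open>Cauchy-Schwarz against the constant 1 reduces the k-th absolute moment to the moment of
  order 2k. The root of exp(p t) is relaxed to exp(p t) again, and replacing (2k)! by (k!)^2 costs
  the factor 2^p in the base.\<close>

lemma approx_diff_abs_moment:
  assumes \<epsilon>: "\<epsilon> > 0" and \<delta>: "\<delta> > 0" and t: "t \<ge> 0" and k: "k \<ge> 1" and \<theta>: "\<theta> > 0"
    and small: "difference_bound \<theta> \<epsilon> \<delta> (2 * k)"
  shows "(\<integral>\<^sup>+\<omega>. ennreal (\<bar>approx t \<epsilon> \<omega> - approx t \<delta> \<omega>\<bar> ^ k) \<partial>M)
     \<le> ennreal (exp (real p * t) * fact k ^ p * (2 ^ p * moment_scale * \<theta>) ^ k)"
proof -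
  note [measurable] = approx_measurable[OF \<epsilon> t] approx_measurable[OF \<delta> t]
  have S0: "moment_scale \<ge> 0" using C by (simp add: moment_scale_def)
  define Z where "Z \<omega> = ennreal (\<bar>approx t \<epsilon> \<omega> - approx t \<delta> \<omega>\<bar> ^ k)" for \<omega>
  have [measurable]: "Z \<in> borel_measurable M" unfolding Z_def by measurable
  have "(\<integral>\<^sup>+\<omega>. Z \<omega> \<partial>M) ^ 2 \<le> (\<integral>\<^sup>+\<omega>. 1 \<partial>M) ^ (2 - 1) * (\<integral>\<^sup>+\<omega>. 1 * Z \<omega> ^ 2 \<partial>M)"
    using nn_integral_mult_power_le[of "\<lambda>_. 1" M Z 2] by simp
  also have "\<dots> = (\<integral>\<^sup>+\<omega>. ennreal ((approx t \<epsilon> \<omega> - approx t \<delta> \<omega>) ^ (2 * k)) \<partial>M)"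
    by (simp add: Z_def ennreal_power power_mult[symmetric] emeasure_space_1 mult.commute[of k] power_even_abs)
  also have "\<dots> \<le> ennreal (exp (real p * t) * fact (2 * k) ^ p * (moment_scale * \<theta>) ^ (2 * k))"
    by (rule approx_diff_moment[OF \<epsilon> \<delta> t _ _ \<theta> small]) (use k in auto)
  also have "\<dots> \<le> ennreal ((exp (real p * t) * fact k ^ p * (2 ^ p * moment_scale * \<theta>) ^ k) ^ 2)"
  proof (rule ennreal_leI)
    have "exp (real p * t) * 1 \<le> exp (real p * t) * exp (real p * t)"
      using t by (intro mult_left_mono) auto
    then have 1: "exp (real p * t) \<le> exp (real p * t) ^ 2" by (simp add: power2_eq_square)
    have 2: "(fact (2 * k) :: real) ^ p \<le> ((2 ^ k * fact k) ^ 2) ^ p"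
      by (intro power_mono fact_double_le) simp
    have "exp (real p * t) * fact (2 * k) ^ p * (moment_scale * \<theta>) ^ (2 * k)
      \<le> exp (real p * t) ^ 2 * ((2 ^ k * fact k) ^ 2) ^ p * (moment_scale * \<theta>) ^ (2 * k)"
      using S0 \<theta> by (intro mult_mono 1 2) auto
    also have "\<dots> = (exp (real p * t) * fact k ^ p * (2 ^ p * moment_scale * \<theta>) ^ k) ^ 2"
      by (simp add: power_mult_distrib power_mult[symmetric] mult_ac)
    finally show "exp (real p * t) * fact (2 * k) ^ p * (moment_scale * \<theta>) ^ (2 * k)
      \<le> (exp (real p * t) * fact k ^ p * (2 ^ p * moment_scale * \<theta>) ^ k) ^ 2" .
  qed
  also have "\<dots> = ennreal (exp (real p * t) * fact k ^ p * (2 ^ p * moment_scale * \<theta>) ^ k) ^ 2"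
    using S0 \<theta> by (simp add: ennreal_power)
  finally show ?thesis
    unfolding Z_def by (rule ennreal_power_le_imp_le) simp
qed

text \<open>The estimate for two radii is uniform in \<delta> \<le> \<epsilon>, so only the distance
  from radius \<delta> to the intersection measure has to vanish. Splitting the k-th power of a sum
  doubles the base.\<close>

lemma limit_moment:
  assumes \<epsilon>: "\<epsilon> > 0" and t: "t > 0" and k: "k \<ge> 1" and \<theta>: "\<theta> > 0"
    and small: "\<And>\<delta>. 0 < \<delta> \<Longrightarrow> \<delta> \<le> \<epsilon> \<Longrightarrow> difference_bound \<theta> \<epsilon> \<delta> (2 * k)"
    and \<mu>: "intersection_measure M D p X t \<mu>" and f_CK: "f \<in> C_K D"
  shows "(\<integral>\<^sup>+\<omega>. ennreal (\<bar>approx t \<epsilon> \<omega> - integral\<^sup>L (\<mu> \<omega>) f\<bar> ^ k) \<partial>M)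
     \<le> ennreal (exp (real p * t) * fact k ^ p * (2 * 2 ^ p * moment_scale * \<theta>) ^ k)"
proof -
  have S0: "moment_scale \<ge> 0" using C by (simp add: moment_scale_def)
  have t0: "t \<ge> 0" using t by simp
  define L where "L \<omega> = integral\<^sup>L (\<mu> \<omega>) f" for \<omega>
  have [measurable]: "L \<in> borel_measurable M"
    unfolding L_def using \<mu> f_CK by (intro vague_integral_measurable) (auto simp: intersection_measure_def)
  define R where "R = exp (real p * t) * fact k ^ p * (2 ^ p * moment_scale * \<theta>) ^ k"
  have R0: "R \<ge> 0" using S0 \<theta> by (simp add: R_def)
  define \<eta> where "\<eta> \<delta> = (\<integral>\<^sup>+\<omega>. ennreal (IS_error D p X \<mu> t \<delta> f \<omega> ^ k) \<partial>M)" for \<delta>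
  have \<eta>: "(\<eta> \<longlongrightarrow> 0) (at_right 0)"
    using \<mu> f_CK k unfolding intersection_measure_def \<eta>_def by blast
  have "(\<integral>\<^sup>+\<omega>. ennreal (\<bar>approx t \<epsilon> \<omega> - L \<omega>\<bar> ^ k) \<partial>M) \<le> 2 ^ k * (ennreal R + \<eta> \<delta>)"
    if \<delta>: "0 < \<delta>" "\<delta> \<le> \<epsilon>" for \<delta>
  proof -
    note [measurable] = approx_measurable[OF \<epsilon> t0] approx_measurable[OF \<delta>(1) t0]
    have "(\<integral>\<^sup>+\<omega>. ennreal (\<bar>approx t \<epsilon> \<omega> - L \<omega>\<bar> ^ k) \<partial>M)
      \<le> (\<integral>\<^sup>+\<omega>. 2 ^ k * (ennreal (\<bar>approx t \<epsilon> \<omega> - approx t \<delta> \<omega>\<bar> ^ k) + ennreal (\<bar>approx t \<delta> \<omega> - L \<omega>\<bar> ^ k)) \<partial>M)"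
    proof (intro nn_integral_mono)
      fix \<omega>
      have "\<bar>approx t \<epsilon> \<omega> - L \<omega>\<bar> ^ k \<le> 2 ^ k * (\<bar>approx t \<epsilon> \<omega> - approx t \<delta> \<omega>\<bar> ^ k + \<bar>approx t \<delta> \<omega> - L \<omega>\<bar> ^ k)"
        using abs_add_power_le[of "approx t \<epsilon> \<omega> - approx t \<delta> \<omega>" "approx t \<delta> \<omega> - L \<omega>" k] by simp
      from ennreal_leI[OF this]
      show "ennreal (\<bar>approx t \<epsilon> \<omega> - L \<omega>\<bar> ^ k)
        \<le> 2 ^ k * (ennreal (\<bar>approx t \<epsilon> \<omega> - approx t \<delta> \<omega>\<bar> ^ k) + ennreal (\<bar>approx t \<delta> \<omega> - L \<omega>\<bar> ^ k))"
        by (simp add: ennreal_mult' ennreal_power[symmetric])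
    qed
    also have "\<dots> = 2 ^ k * ((\<integral>\<^sup>+\<omega>. ennreal (\<bar>approx t \<epsilon> \<omega> - approx t \<delta> \<omega>\<bar> ^ k) \<partial>M)
        + (\<integral>\<^sup>+\<omega>. ennreal (\<bar>approx t \<delta> \<omega> - L \<omega>\<bar> ^ k) \<partial>M))"
      by (subst nn_integral_cmult) (auto simp: nn_integral_add)
    also have "(\<integral>\<^sup>+\<omega>. ennreal (\<bar>approx t \<delta> \<omega> - L \<omega>\<bar> ^ k) \<partial>M) = \<eta> \<delta>"
      by (simp add: \<eta>_def IS_error_def approx_def L_def)
    also have "2 ^ k * ((\<integral>\<^sup>+\<omega>. ennreal (\<bar>approx t \<epsilon> \<omega> - approx t \<delta> \<omega>\<bar> ^ k) \<partial>M) + \<eta> \<delta>) \<le> 2 ^ k * (ennreal R + \<eta> \<delta>)"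
      unfolding R_def
      by (intro mult_left_mono add_right_mono approx_diff_abs_moment[OF \<epsilon> \<delta>(1) t0 k \<theta> small[OF \<delta>]]) auto
    finally show ?thesis .
  qed
  then have "eventually (\<lambda>\<delta>. (\<integral>\<^sup>+\<omega>. ennreal (\<bar>approx t \<epsilon> \<omega> - L \<omega>\<bar> ^ k) \<partial>M) \<le> 2 ^ k * (ennreal R + \<eta> \<delta>)) (at_right 0)"
    using \<epsilon> by (auto simp: eventually_at_right_field intro!: exI[of _ \<epsilon>])
  moreover have "((\<lambda>\<delta>. 2 ^ k * (ennreal R + \<eta> \<delta>)) \<longlongrightarrow> 2 ^ k * (ennreal R + 0)) (at_right 0)"
    by (intro ennreal_tendsto_cmult tendsto_add tendsto_const \<eta>) (simp add: power_less_top_ennreal)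
  ultimately have "(\<integral>\<^sup>+\<omega>. ennreal (\<bar>approx t \<epsilon> \<omega> - L \<omega>\<bar> ^ k) \<partial>M) \<le> 2 ^ k * (ennreal R + 0)"
    by (intro tendsto_lowerbound[where F = "at_right 0"]) auto
  also have "\<dots> = ennreal (exp (real p * t) * fact k ^ p * (2 * 2 ^ p * moment_scale * \<theta>) ^ k)"
  proof -
    have "2 ^ k * (ennreal R + 0) = ennreal (2 ^ k * R)"
      using R0 by (simp add: ennreal_mult' ennreal_power[symmetric])
    also have "2 ^ k * R = exp (real p * t) * fact k ^ p * (2 * 2 ^ p * moment_scale * \<theta>) ^ k"
      by (simp add: R_def power_mult_distrib mult_ac)
    finally show ?thesis .
  qed
  finally show ?thesis by (simp add: L_def)
qed

end

text \<open>The infimum of the admissible constants need not be attained. Adding \<epsilon> brings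
  the value into the upward closed set V \<epsilon>, hence makes it positive, and leaves the limit
  at 0 unchanged.\<close>

lemma exists_vanishing_constant:
  fixes V :: "real \<Rightarrow> real set"
  assumes pos: "\<And>\<epsilon> c. c \<in> V \<epsilon> \<Longrightarrow> 0 < c" and up: "\<And>\<epsilon> c c'. c \<in> V \<epsilon> \<Longrightarrow> c \<le> c' \<Longrightarrow> c' \<in> V \<epsilon>"
    and nonempty: "\<And>\<epsilon>. \<epsilon> > 0 \<Longrightarrow> V \<epsilon> \<noteq> {}"
    and small: "\<And>e. e > 0 \<Longrightarrow> eventually (\<lambda>\<epsilon>. e \<in> V \<epsilon>) (at_right 0)"
  shows "\<exists>C. (\<forall>\<epsilon>>0. 0 < C \<epsilon> \<and> C \<epsilon> \<in> V \<epsilon>) \<and> (C \<longlongrightarrow> 0) (at_right 0)"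
proof -
  define C where "C \<epsilon> = Inf (V \<epsilon>) + \<epsilon>" for \<epsilon>
  have bdd: "bdd_below (V \<epsilon>)" for \<epsilon> using pos by (intro bdd_belowI[of _ 0]) (auto intro: less_imp_le)
  have C_V: "C \<epsilon> \<in> V \<epsilon>" if \<epsilon>: "\<epsilon> > 0" for \<epsilon>
  proof -
    have "Inf (V \<epsilon>) < C \<epsilon>" using \<epsilon> by (simp add: C_def)
    then obtain c where "c \<in> V \<epsilon>" "c < C \<epsilon>"
      using cInf_lessD[OF nonempty[OF \<epsilon>]] by blast
    then show ?thesis using up[of c \<epsilon> "C \<epsilon>"] by simp
  qed
  have "(C \<longlongrightarrow> 0) (at_right 0)"
  proof (rule tendstoI)
    fix e :: real assume e: "e > 0"
    have "eventually (\<lambda>\<epsilon>. \<epsilon> < e / 2) (at_right (0::real))"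
      using e by (auto simp: eventually_at_right_field intro!: exI[of _ "e / 2"])
    moreover have "eventually (\<lambda>\<epsilon>. \<epsilon> > 0) (at_right (0::real))"
      by (rule eventually_at_right_less)
    moreover have "eventually (\<lambda>\<epsilon>. e / 2 \<in> V \<epsilon>) (at_right 0)" using e by (intro small) simp
    ultimately show "eventually (\<lambda>\<epsilon>. dist (C \<epsilon>) 0 < e) (at_right 0)"
    proof eventually_elim
      case (elim \<epsilon>)
      have "Inf (V \<epsilon>) \<le> e / 2" using elim by (intro cInf_lower bdd) auto
      then have "C \<epsilon> < e" using elim by (simp add: C_def)
      moreover have "C \<epsilon> > 0" using pos[OF C_V[OF elim(2)]] .
      ultimately show ?case by (simp add: dist_real_def)
    qed
  qed
  then show ?thesis using C_V pos by blast
qed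

theorem theorem2p1:
  fixes D :: "'a::euclidean_space set"
    and p :: nat
    and M :: "'w measure"
    and x0 :: "nat \<Rightarrow> 'a"
    and X :: "nat \<Rightarrow> real \<Rightarrow> 'w \<Rightarrow> 'a option"
    and l :: "real \<Rightarrow> 'w \<Rightarrow> 'a measure"
    and f :: "'a \<Rightarrow> real"
  assumes "open D" and "connected D" and "smooth_boundary D"
    and "p \<ge> 2"
    and "int DIM('a) - int p * (int DIM('a) - 2) > 0"
    and "prob_space M"
    and "\<forall>i\<in>{1..p}. x0 i \<in> D"
    and "\<forall>i\<in>{1..p}. killed_brownian_motion M D (x0 i) (X i)"
    and "independent_killed_processes M D p X"
    and "\<forall>t>0. intersection_measure M D p X t (l t)"
    and "f \<in> C_K D"
  shows "\<exists>C :: real \<Rightarrow> real.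
           (\<forall>\<epsilon>>0. 0 < C \<epsilon>) \<and>
           (C \<longlongrightarrow> 0) (at_right 0) \<and>
           (\<forall>\<epsilon>>0. \<forall>k::nat. \<forall>t>0. 1 \<le> k \<longrightarrow>
              (\<integral>\<^sup>+\<omega>. ennreal (\<bar>approx_IS D p (\<lambda>i s. X i s \<omega>) t \<epsilon> f - integral\<^sup>L (l t \<omega>) f\<bar> ^ k) \<partial>M)
                \<le> ennreal (exp (real p * t) * fact k ^ p * C \<epsilon> ^ k))"
proof -
  define K where "K = top_of_set D closure_of support_on D f"
  have cont: "continuous_on D f" and K_compact: "compact K"
    using \<open>f \<in> C_K D\<close> by (auto simp: C_K_def K_def)
  have KD: "K \<subseteq> D"
    unfolding K_def using closure_of_subset_topspace[of "top_of_set D"] by simp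
  have supp: "f x = 0" if "x \<in> D - K" for x
  proof -
    have "support_on D f \<subseteq> K"
      unfolding K_def by (rule closure_of_subset) (auto simp: support_on_def)
    then show ?thesis using that by (auto simp: support_on_def)
  qed
  have "compact (f ` K)"
    by (rule compact_continuous_image[OF continuous_on_subset[OF cont KD] K_compact])
  then obtain c where c: "\<And>x. x \<in> K \<Longrightarrow> \<bar>f x\<bar> \<le> c"
    by (metis bounded_real compact_imp_bounded imageI)
  \<comment> \<open>The maximum with 1 makes the bound positive, as the setting demands, even if f
    vanishes on D.\<close>
  have f_bound: "\<bar>indicat_real D x * f x\<bar> \<le> max c 1" for x
  proof (cases "x \<in> K")
    case True
    then show ?thesis using c[of x] by (auto simp: indicator_def)
  next
    case False
    then have "indicat_real D x * f x = 0" using supp[of x] by (cases "x \<in> D") auto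
    then show ?thesis unfolding \<open>indicat_real D x * f x = 0\<close> by simp
  qed
  have f_meas: "(\<lambda>x. indicat_real D x * f x) \<in> borel_measurable borel"
    using borel_measurable_continuous_on_indicator[OF _ cont] \<open>open D\<close> by simp
  have \<beta>: "critical_exponent TYPE('a) p < 1"
  proof -
    \<comment> \<open>The dimension condition rearranged to d (p - 1) < 2 p. It is treated in the
      integers because d - 2 may be negative.\<close>
    have "int DIM('a) * (int p - 1) < 2 * int p"
      using \<open>int DIM('a) - int p * (int DIM('a) - 2) > 0\<close> by (simp add: algebra_simps)
    moreover have "int (DIM('a) * (p - 1)) = int DIM('a) * (int p - 1)"
      using \<open>p \<ge> 2\<close> by (simp add: of_nat_diff)
    ultimately have "DIM('a) * (p - 1) < 2 * p" by linarith
    then have "real (DIM('a) * (p - 1)) < 2 * real p" by (metis of_nat_less_iff of_nat_mult of_nat_numeral)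
    then show ?thesis using \<open>p \<ge> 2\<close> by (simp add: critical_exponent_def)
  qed
  define \<gamma> where "\<gamma> = (critical_exponent TYPE('a) p + 1) / 2"
  interpret intersection_setting M D K p x0 X f "max c 1" \<gamma>
  proof (rule intersection_setting.intro)
    show "prob_space M" "open D" "independent_killed_processes M D p X" "compact K" "K \<subseteq> D" "2 \<le> p"
      by (fact assms K_compact KD)+
    show "x0 i \<in> D" "killed_brownian_motion M D (x0 i) (X i)" if "i \<in> {1..p}" for i
      using assms(7,8) that by blast+
    show "(\<lambda>x. indicat_real D x * f x) \<in> borel_measurable borel" by (fact f_meas)
    show "\<bar>indicat_real D x * f x\<bar> \<le> max c 1" for x by (fact f_bound)
    show "f x = 0" if "x \<in> D - K" for x using that by (rule supp)
    show "critical_exponent TYPE('a) p < \<gamma>" "\<gamma> < 1" using \<beta> by (simp_all add: \<gamma>_def)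
  qed simp
  \<comment> \<open>The constants that work for this \<epsilon> with all k and all t at once;
    choosing from this set makes C(\<epsilon>) independent of both.\<close>
  define V where "V \<epsilon> = {c. 0 < c \<and> (\<forall>k::nat. \<forall>t>0. 1 \<le> k \<longrightarrow>
      (\<integral>\<^sup>+\<omega>. ennreal (\<bar>approx_IS D p (\<lambda>i s. X i s \<omega>) t \<epsilon> f - integral\<^sup>L (l t \<omega>) f\<bar> ^ k) \<partial>M)
        \<le> ennreal (exp (real p * t) * fact k ^ p * c ^ k))}" for \<epsilon>
  \<comment> \<open>The base of the limiting moment bound per unit of \<theta>. The summand 1 makes
    A positive, so that \<theta> = e / A can be chosen for a prescribed e.\<close>
  define A where "A = 2 * 2 ^ p * moment_scale + 1"
  have S0: "moment_scale \<ge> 0" by (simp add: moment_scale_def)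
  then have A: "A > 0" by (simp add: A_def add_nonneg_pos)
  have up: "c' \<in> V \<epsilon>" if c: "c \<in> V \<epsilon>" "c \<le> c'" for \<epsilon> c c'
    unfolding V_def
  proof (intro CollectI conjI allI impI)
    show "0 < c'" using c by (auto simp: V_def)
    fix k :: nat and t :: real assume kt: "t > 0" "1 \<le> k"
    have "(\<integral>\<^sup>+\<omega>. ennreal (\<bar>approx_IS D p (\<lambda>i s. X i s \<omega>) t \<epsilon> f - integral\<^sup>L (l t \<omega>) f\<bar> ^ k) \<partial>M)
        \<le> ennreal (exp (real p * t) * fact k ^ p * c ^ k)"
      using c(1) kt by (auto simp: V_def)
    also have "\<dots> \<le> ennreal (exp (real p * t) * fact k ^ p * c' ^ k)"
      using c by (intro ennreal_leI mult_left_mono power_mono) (auto simp: V_def)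
    finally show "(\<integral>\<^sup>+\<omega>. ennreal (\<bar>approx_IS D p (\<lambda>i s. X i s \<omega>) t \<epsilon> f - integral\<^sup>L (l t \<omega>) f\<bar> ^ k) \<partial>M)
        \<le> ennreal (exp (real p * t) * fact k ^ p * c' ^ k)" .
  qed
  have in_V: "A * \<theta> \<in> V \<epsilon>"
    if "\<epsilon> > 0" "\<theta> > 0" and small: "\<And>\<delta> k. 0 < \<delta> \<Longrightarrow> \<delta> \<le> \<epsilon> \<Longrightarrow> difference_bound \<theta> \<epsilon> \<delta> (2 * k)" for \<epsilon> \<theta>
    unfolding V_def
  proof (intro CollectI conjI allI impI)
    show "0 < A * \<theta>" using A that by simp
    fix k :: nat and t :: real assume kt: "t > 0" "1 \<le> k"
    have "(\<integral>\<^sup>+\<omega>. ennreal (\<bar>approx t \<epsilon> \<omega> - integral\<^sup>L (l t \<omega>) f\<bar> ^ k) \<partial>M)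
      \<le> ennreal (exp (real p * t) * fact k ^ p * (2 * 2 ^ p * moment_scale * \<theta>) ^ k)"
      using \<open>\<forall>t>0. intersection_measure M D p X t (l t)\<close> \<open>f \<in> C_K D\<close> kt
      by (intro limit_moment that small) simp_all
    also have "\<dots> \<le> ennreal (exp (real p * t) * fact k ^ p * (A * \<theta>) ^ k)"
      using S0 that(2) by (intro ennreal_leI mult_left_mono power_mono mult_right_mono) (auto simp: A_def)
    finally show "(\<integral>\<^sup>+\<omega>. ennreal (\<bar>approx_IS D p (\<lambda>i s. X i s \<omega>) t \<epsilon> f - integral\<^sup>L (l t \<omega>) f\<bar> ^ k) \<partial>M)
        \<le> ennreal (exp (real p * t) * fact k ^ p * (A * \<theta>) ^ k)"
      by (simp add: approx_def)
  qed
  have nonempty: "V \<epsilon> \<noteq> {}" if "\<epsilon> > 0" for \<epsilon>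
    using in_V[OF that zero_less_one difference_bound_1[OF that]] by blast
  have small: "eventually (\<lambda>\<epsilon>. e \<in> V \<epsilon>) (at_right 0)" if e: "e > 0" for e
  proof -
    have \<theta>: "e / A > 0" using e A by simp
    obtain \<epsilon>0 where "\<epsilon>0 > 0" and \<epsilon>0: "\<And>\<epsilon> \<delta> k. 0 < \<delta> \<Longrightarrow> \<delta> \<le> \<epsilon> \<Longrightarrow> \<epsilon> < \<epsilon>0 \<Longrightarrow> even k \<Longrightarrow> difference_bound (e / A) \<epsilon> \<delta> k"
      using difference_bound_small[OF \<theta>] by blast
    have "e \<in> V \<epsilon>" if "0 < \<epsilon>" "\<epsilon> < \<epsilon>0" for \<epsilon>
    proof -
      have "A * (e / A) \<in> V \<epsilon>" using that \<epsilon>0 by (intro in_V \<theta>) auto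
      then show ?thesis using A by simp
    qed
    then show ?thesis
      using \<open>\<epsilon>0 > 0\<close> by (auto simp: eventually_at_right_field intro!: exI[of _ \<epsilon>0])
  qed
  have "\<exists>C. (\<forall>\<epsilon>>0. 0 < C \<epsilon> \<and> C \<epsilon> \<in> V \<epsilon>) \<and> (C \<longlongrightarrow> 0) (at_right 0)"
  proof (rule exists_vanishing_constant)
    show "0 < c" if "c \<in> V \<epsilon>" for \<epsilon> c using that by (simp add: V_def)
  qed (fact up nonempty small)+
  then obtain C where "\<forall>\<epsilon>>0. 0 < C \<epsilon> \<and> C \<epsilon> \<in> V \<epsilon>" "(C \<longlongrightarrow> 0) (at_right 0)"
    by blast
  then show ?thesis
    by (intro exI[of _ C]) (auto simp: V_def)
qed

end
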